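(* Let $(P, \mathcal{F}_1, \mathcal{F}_2)$ be a bifoliated plane with oriented foliations. Let $\mathrm{Aut}^+(P, \mathcal{F}_1, \mathcal{F}_2)$ be the group of homeomorphisms of $P$ that preserve the foliations $\mathcal{F}_1$ and $\mathcal{F}_2$ as well as their orientations. Then $\mathrm{Aut}^+(P, \mathcal{F}_1, \mathcal{F}_2)$ is left-orderable.
   Context: A bifoliated plane $(P, \mathcal{F}_1, \mathcal{F}_2)$ is a topological plane $P$ (homeomorphic to $\mathbb{R}^2$) equipped with two $C^0$ foliations by lines $\mathcal{F}_1, \mathcal{F}_2$ such that each leaf of each foliation is properly embedded in $P$, and $\mathcal{F}_1$ and $\mathcal{F}_2$ are transverse. The foliations are non-singular and orientable, and are always assumed to be oriented. A group is left-orderable if it admits a linear (total) order invariant under left multiplication. *)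

theory Defs
  imports "HOL-Analysis.Analysis" "HOL-Algebra.Bij"
begin

definition proper_embedding :: "'a topology \<Rightarrow> 'b topology \<Rightarrow> ('a \<Rightarrow> 'b) \<Rightarrow> bool" where
  "proper_embedding X Y f \<longleftrightarrow> embedding_map X Y f \<and> proper_map X Y f"

definition topological_plane :: "'a topology \<Rightarrow> bool" where
  "topological_plane X \<longleftrightarrow> X homeomorphic_space (euclidean :: (real \<times> real) topology)"

definition plane_chart :: "'a topology \<Rightarrow> 'a set \<Rightarrow> ('a \<Rightarrow> real \<times> real) \<Rightarrow> bool" where
  "plane_chart X U \<phi> \<longleftrightarrow> openin X U \<and> homeomorphic_map (subtopology X U) euclidean \<phi>"

definition plaques :: "'a topology \<Rightarrow> 'a set set \<Rightarrow> 'a set \<Rightarrow> 'a set set" where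
  "plaques X F U = (\<Union>L\<in>F. connected_components_of (subtopology X (L \<inter> U)))"

definition foliated_chart ::
    "'a topology \<Rightarrow> 'a set set \<Rightarrow> 'a set \<Rightarrow> ('a \<Rightarrow> real \<times> real) \<Rightarrow> bool" where
  "foliated_chart X F U \<phi> \<longleftrightarrow>
     plane_chart X U \<phi> \<and> (\<forall>C \<in> plaques X F U. \<exists>c. \<phi> ` C = UNIV \<times> {c})"

text \<open>A one-dimensional foliation of class \<open>C\<^sup>0\<close>, given by its set of leaves.\<close>

definition foliation :: "'a topology \<Rightarrow> 'a set set \<Rightarrow> bool" where
  "foliation X F \<longleftrightarrow>
     partition_on (topspace X) F \<and> (\<forall>L\<in>F. connectedin X L) \<and>
     (\<forall>p \<in> topspace X. \<exists>U \<phi>. p \<in> U \<and> foliated_chart X F U \<phi>)"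

definition foliation_by_proper_lines :: "'a topology \<Rightarrow> 'a set set \<Rightarrow> bool" where
  "foliation_by_proper_lines X F \<longleftrightarrow>
     foliation X F \<and> (\<forall>L\<in>F. \<exists>\<gamma>. proper_embedding euclideanreal X \<gamma> \<and> range \<gamma> = L)"

text \<open>
  Transversality is topological: locally the pair of foliations is the pair of horizontal and
  vertical foliations of the coordinate plane (the coordinate swap makes the leaves of the second
  foliation vertical).
\<close>

definition transverse_foliations :: "'a topology \<Rightarrow> 'a set set \<Rightarrow> 'a set set \<Rightarrow> bool" where
  "transverse_foliations X F\<^sub>1 F\<^sub>2 \<longleftrightarrow>
     (\<forall>p \<in> topspace X. \<exists>U \<phi>. p \<in> U \<and>
        foliated_chart X F\<^sub>1 U \<phi> \<and> foliated_chart X F\<^sub>2 U (prod.swap \<circ> \<phi>))"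

text \<open>
  An orientation of a foliation by lines is encoded by the set \<open>Or\<close> of all positively oriented
  parametrizations of its leaves. On each leaf these form one class modulo increasing
  reparametrization; the last condition says that the class varies continuously with the leaf:
  around each point there is a foliated chart in which every plaque is oriented from left to right.
\<close>

definition foliation_orientation ::
    "'a topology \<Rightarrow> 'a set set \<Rightarrow> (real \<Rightarrow> 'a) set \<Rightarrow> bool" where
  "foliation_orientation X F Or \<longleftrightarrow>
     (\<forall>\<gamma>\<in>Or. proper_embedding euclideanreal X \<gamma> \<and> range \<gamma> \<in> F) \<and>
     (\<forall>L\<in>F. \<exists>\<gamma>\<in>Or. range \<gamma> = L) \<and>
     (\<forall>\<gamma>\<in>Or. {\<delta>\<in>Or. range \<delta> = range \<gamma>} =
        {\<gamma> \<circ> h | h. strict_mono h \<and> homeomorphic_map euclideanreal euclideanreal h}) \<and>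
     (\<forall>p \<in> topspace X. \<exists>U \<phi>. p \<in> U \<and> foliated_chart X F U \<phi> \<and>
        (\<forall>\<gamma>\<in>Or. \<forall>s t. \<forall>C \<in> plaques X F U.
           s < t \<and> \<gamma> s \<in> C \<and> \<gamma> t \<in> C \<longrightarrow> fst (\<phi> (\<gamma> s)) < fst (\<phi> (\<gamma> t))))"

definition bifoliated_plane :: "'a topology \<Rightarrow> 'a set set \<Rightarrow> 'a set set \<Rightarrow> bool" where
  "bifoliated_plane X F\<^sub>1 F\<^sub>2 \<longleftrightarrow>
     topological_plane X \<and>
     foliation_by_proper_lines X F\<^sub>1 \<and> foliation_by_proper_lines X F\<^sub>2 \<and>
     transverse_foliations X F\<^sub>1 F\<^sub>2"

definition preserves_foliation :: "('a \<Rightarrow> 'a) \<Rightarrow> 'a set set \<Rightarrow> bool" where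
  "preserves_foliation f F \<longleftrightarrow> (\<lambda>L. f ` L) ` F = F"

definition preserves_orientation :: "('a \<Rightarrow> 'a) \<Rightarrow> (real \<Rightarrow> 'a) set \<Rightarrow> bool" where
  "preserves_orientation f Or \<longleftrightarrow> (\<lambda>\<gamma>. f \<circ> \<gamma>) ` Or = Or"

text \<open>As in \<open>BijGroup\<close>, homeomorphisms are represented by extensional functions.\<close>

definition Aut_plus ::
    "'a topology \<Rightarrow> 'a set set \<Rightarrow> (real \<Rightarrow> 'a) set \<Rightarrow> 'a set set \<Rightarrow> (real \<Rightarrow> 'a) set \<Rightarrow> ('a \<Rightarrow> 'a) monoid" where
  "Aut_plus X F\<^sub>1 Or\<^sub>1 F\<^sub>2 Or\<^sub>2 = BijGroup (topspace X)
     \<lparr>carrier := {f \<in> Bij (topspace X). homeomorphic_map X X f \<and>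
        preserves_foliation f F\<^sub>1 \<and> preserves_orientation f Or\<^sub>1 \<and>
        preserves_foliation f F\<^sub>2 \<and> preserves_orientation f Or\<^sub>2}\<rparr>"

definition left_orderable :: "('a, 'b) monoid_scheme \<Rightarrow> bool" where
  "left_orderable G \<longleftrightarrow> group G \<and>
     (\<exists>r. linear_order_on (carrier G) r \<and>
        (\<forall>g \<in> carrier G. \<forall>(a, b) \<in> r. (g \<otimes>\<^bsub>G\<^esub> a, g \<otimes>\<^bsub>G\<^esub> b) \<in> r))"

end

theory Submission
  imports Defs "HOL-Complex_Analysis.Complex_Analysis" "HOL-Real_Asymp.Real_Asymp"
begin

text \<open>
  Identify the plane with \<open>\<complex>\<close>. For a point \<open>p\<close> let \<open>r p\<close> be the closed half leaf of the first foliation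
  starting at \<open>p\<close> in the positive direction. Its complement is simply connected, so \<open>y - p\<close> has a
  continuous logarithm \<open>\<alpha> p y\<close> there, unique up to \<open>2 pi \<i> \<int>\<close>. Since the plane has no cohomology, these
  branches can be chosen coherently: for \<open>y\<close> shortly behind \<open>p\<close> on its leaf, \<open>\<alpha> p y\<close> is continuous in
  both variables. For \<open>p\<close> and \<open>q\<close> on different leaves the numbers \<open>\<alpha> p q\<close> and \<open>\<alpha> q p\<close> are logarithms of
  \<open>q - p\<close> and \<open>p - q\<close>, so their difference is an odd multiple of \<open>\<i> pi\<close>; it depends only on the two
  leaves, and its sign decides which leaf is the smaller one. Totality and antisymmetry are
  immediate. Transitivity says that for three pairwise disjoint rays the cyclic sum of the three
  differences is \<open>\<plusminus> \<i> pi\<close>: the sum is unchanged when the rays are prolonged backwards until they start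
  on the boundary of a common round disc that they do not meet otherwise, and then it is the angle
  sum of a Euclidean triangle. Within a leaf, points are ordered by the orientation.

  A homeomorphism preserving the oriented first foliation multiplies all these differences by its
  degree. The degree is \<open>1\<close> when the second oriented foliation is preserved as well, because all
  charts adapted to both oriented foliations have the same degree. Hence the group acts faithfully
  on the totally ordered set of points of the plane, and comparing two elements at the first point,
  for some well-order, at which they differ gives a left-invariant total order.
\<close>


section \<open>Rays in the plane\<close>

text \<open>The leaf space of a plane foliation is in general not Hausdorff, so leaves need not be
  comparable along a transversal. Comparing logarithms treats all pairs of distinct leaves alike.
  The price is that a logarithm cut along a leaf may record full turns: a single difference gets a
  lower bound, \<open>pi\<close> for the absolute value of its imaginary part, but no upper bound.
  Transitivity rests on the contrast of two estimates: three differences of equal sign would sum to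
  at least \<open>3 * pi\<close> in absolute value, whereas the cyclic sum is a sum of three angles
  below \<open>pi\<close> each. The foliations are only continuous, so tangent vectors and Jacobians
  are out of reach. One principle replaces them throughout: a continuous function on a connected set
  whose exponential is constant is itself constant. The second foliation is there to fix the degree:
  a reflection across the leaves can preserve the oriented first foliation, yet it has degree
  \<open>-1\<close> and reverses the comparison of leaves.\<close>

lemma exp_const_imp_constant:
  fixes h :: "'a::topological_space \<Rightarrow> complex"
  assumes "connected S" "continuous_on S h" "\<And>x. x \<in> S \<Longrightarrow> exp (h x) = c"
  obtains a where "\<And>x. x \<in> S \<Longrightarrow> h x = a"
proof -
  have "h constant_on S"
  proof (rule continuous_discrete_range_constant[OF assms(1,2)])
    fix x assume x: "x \<in> S"
    \<comment> \<open>\<open>2*pi\<close> is the spacing of the logarithms of a single number, so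
      the fibres of \<open>exp\<close> are uniformly discrete.\<close>
    show "\<exists>e>0. \<forall>y. y \<in> S \<and> h y \<noteq> h x \<longrightarrow> e \<le> cmod (h y - h x)"
    proof (intro exI[of _ "2*pi"] conjI allI impI)
      fix y assume y: "y \<in> S \<and> h y \<noteq> h x"
      then have "exp (h y) = exp (h x)" using assms(3) x by auto
      then obtain n :: int where n: "h y = h x + (of_int (2*n) * pi) * \<i>"
        by (auto simp: exp_eq)
      with y have "n \<noteq> 0" by auto
      then have "1 \<le> \<bar>real_of_int n\<bar>" by linarith
      moreover have "cmod (h y - h x) = 2 * pi * \<bar>real_of_int n\<bar>"
        using n by (simp add: norm_mult abs_mult)
      ultimately show "2*pi \<le> cmod (h y - h x)" by simp
    qed simp
  qed
  then show ?thesis using that by (auto simp: constant_on_def)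
qed

lemma same_exp_imp_diff_constant:
  fixes h k :: "'a::topological_space \<Rightarrow> complex"
  assumes "connected S" "continuous_on S h" "continuous_on S k"
    and "\<And>x. x \<in> S \<Longrightarrow> exp (h x) = exp (k x)"
    and "x \<in> S" "y \<in> S"
  shows "h x - h y = k x - k y"
proof -
  obtain a where "\<And>x. x \<in> S \<Longrightarrow> h x - k x = a"
    using exp_const_imp_constant[of S "\<lambda>x. h x - k x" 1] assms(1-4)
    by (auto simp: continuous_intros exp_diff)
  with assms(5,6) have "h x - k x = h y - k y" by simp
  then show ?thesis by (simp add: algebra_simps)
qed

lemma locally_constant_imp_constant:
  assumes "connected S" "\<And>a. a \<in> S \<Longrightarrow> \<forall>\<^sub>F b in nhds a. b \<in> S \<longrightarrow> f b = f a" "x \<in> S" "y \<in> S"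
  shows "f x = f y"
proof (rule connected_local_const[OF assms(1,3,4)], intro ballI)
  fix a assume "a \<in> S"
  from assms(2)[OF this] show "\<forall>\<^sub>F b in at a within S. f a = f b"
    by (auto simp: eventually_at_filter elim: eventually_mono)
qed

section \<open>Proper rays, inversion and connected complements\<close>

definition ray :: "(real \<Rightarrow> complex) \<Rightarrow> bool" where
  "ray \<rho> \<longleftrightarrow> continuous_on {0..} \<rho> \<and> inj_on \<rho> {0..} \<and> filterlim \<rho> at_infinity at_top"

text \<open>The point \<open>c\<close> is sent to infinity, and infinity to the inserted
  \<open>0\<close>, so that a closed unbounded \<open>K\<close> avoiding \<open>c\<close> becomes
  compact. This makes separation theorems for compact sets and arcs available for proper
  rays.\<close>

definition inversion :: "complex \<Rightarrow> complex set \<Rightarrow> complex set" where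
  "inversion c K = insert 0 ((\<lambda>z. 1 / (z - c)) ` K)"

lemma compl_inversion:
  assumes "c \<notin> K"
  shows "- inversion c K = {w. w \<noteq> 0 \<and> c + 1 / w \<notin> K}"
proof -
  have "w \<in> (\<lambda>z. 1 / (z - c)) ` K \<longleftrightarrow> c + 1 / w \<in> K" if "w \<noteq> 0" for w
  proof
    assume "w \<in> (\<lambda>z. 1 / (z - c)) ` K"
    then show "c + 1 / w \<in> K" by auto
  next
    assume "c + 1 / w \<in> K"
    then show "w \<in> (\<lambda>z. 1 / (z - c)) ` K" by (intro rev_image_eqI) auto
  qed
  then show ?thesis by (auto simp: inversion_def)
qed

lemma image_compl_inversion:
  assumes "c \<notin> K"
  shows "(\<lambda>w. c + 1 / w) ` (- inversion c K) = - K - {c}"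
    and "(\<lambda>z. 1 / (z - c)) ` (- K - {c}) = - inversion c K"
proof -
  show "(\<lambda>w. c + 1 / w) ` (- inversion c K) = - K - {c}"
  proof (intro equalityI subsetI)
    fix z assume "z \<in> - K - {c}"
    then show "z \<in> (\<lambda>w. c + 1 / w) ` (- inversion c K)"
      by (intro image_eqI[of _ _ "1 / (z - c)"]) (auto simp: compl_inversion[OF assms])
  qed (auto simp: compl_inversion[OF assms])
  show "(\<lambda>z. 1 / (z - c)) ` (- K - {c}) = - inversion c K"
  proof (intro equalityI subsetI)
    fix w assume "w \<in> - inversion c K"
    then show "w \<in> (\<lambda>z. 1 / (z - c)) ` (- K - {c})"
      by (intro image_eqI[of _ _ "c + 1 / w"]) (auto simp: compl_inversion[OF assms])
  qed (auto simp: compl_inversion[OF assms])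
qed

lemma compact_inversion:
  assumes "closed K" "c \<notin> K"
  shows "compact (inversion c K)"
proof -
  obtain e where e: "e > 0" "ball c e \<subseteq> - K"
    using assms open_contains_ball[of "-K"] by auto
  have "cmod (1 / (z - c)) \<le> 1 / e" if "z \<in> K" for z
  proof -
    have "e \<le> cmod (z - c)"
      using that e by (metis ComplD dist_norm linorder_not_le mem_ball norm_minus_commute subsetD)
    then show ?thesis using e by (simp add: norm_divide frac_le)
  qed
  then have "bounded (inversion c K)"
    unfolding inversion_def bounded_iff by (intro exI[of _ "1/e"]) (use e in auto)
  moreover have "open (- inversion c K)"
  proof -
    have "open ((- {0}) \<inter> (\<lambda>w. c + 1 / w) -` (- K))"
      by (rule continuous_open_preimage) (use assms in \<open>auto intro!: continuous_intros\<close>)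
    moreover have "(- {0}) \<inter> (\<lambda>w. c + 1 / w) -` (- K) = - inversion c K"
      using compl_inversion[OF assms(2)] by auto
    ultimately show ?thesis by simp
  qed
  ultimately show ?thesis by (simp add: compact_eq_bounded_closed closed_def)
qed

text \<open>The inversion matches \<open>- K - {c}\<close> with the complement of the compact set.
  Passing between \<open>- K\<close> and \<open>- K - {c}\<close> is harmless: a connected open
  plane set stays connected when a point is deleted, and \<open>c\<close> is a limit point of what
  remains.\<close>

lemma connected_compl_inversion:
  assumes "closed K" "c \<notin> K"
  shows "connected (- inversion c K) \<longleftrightarrow> connected (- K)"
proof
  assume "connected (- inversion c K)"
  then have "connected (- K - {c})"
    unfolding image_compl_inversion(1)[OF assms(2), symmetric]
    by (intro connected_continuous_image continuous_intros) (auto simp: inversion_def)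
  moreover have "c islimpt (- K)"
    using assms by (intro interior_limit_point) (simp add: interior_open open_Compl)
  then have "c \<in> closure (- K - {c})"
    by (simp add: islimpt_in_closure)
  then have "- K \<subseteq> closure (- K - {c})"
    using closure_subset[of "- K - {c}"] by auto
  ultimately show "connected (- K)"
    using connected_intermediate_closure[of "- K - {c}" "- K"] by simp
next
  assume "connected (- K)"
  then have "connected (- K - {c})"
    using assms by (intro connected_open_delete) auto
  then show "connected (- inversion c K)"
    unfolding image_compl_inversion(2)[OF assms(2), symmetric]
    by (intro connected_continuous_image continuous_intros) auto
qed

text \<open>Janiszewski's theorem asks for compact sets with connected intersection. After inversion
  about a point off both sets, the disjoint closed sets meet exactly in \<open>0\<close>, the image
  of infinity.\<close>

lemma connected_compl_disjoint_Un:
  fixes K L :: "complex set"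
  assumes "closed K" "closed L" "K \<inter> L = {}" "connected (- K)" "connected (- L)"
  shows "connected (- (K \<union> L))"
proof (cases "K \<union> L = UNIV")
  case False
  then obtain c where c: "c \<notin> K" "c \<notin> L" by auto
  have eq: "inversion c (K \<union> L) = inversion c K \<union> inversion c L"
    by (auto simp: inversion_def)
  have "inversion c K \<inter> inversion c L = {0}"
    using assms(3) c by (auto simp: inversion_def)
  then have "connected (- (inversion c K \<union> inversion c L))"
    using assms c
    by (intro Janiszewski_connected) (auto simp: compact_inversion compact_imp_closed connected_compl_inversion)
  with connected_compl_inversion[of "K \<union> L" c] show ?thesis
    using assms c eq by auto
qed simp

lemma continuous_on_ray:
  assumes "ray \<rho>" "continuous_on S f" "\<And>x. x \<in> S \<Longrightarrow> 0 \<le> f x"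
  shows "continuous_on S (\<lambda>x. \<rho> (f x))"
proof (rule continuous_on_compose2[OF _ assms(2)])
  show "continuous_on {0..} \<rho>" using assms(1) by (simp add: ray_def)
qed (use assms(3) in auto)

lemma ray_inj: "ray \<rho> \<Longrightarrow> \<rho> s = \<rho> t \<Longrightarrow> 0 \<le> s \<Longrightarrow> 0 \<le> t \<Longrightarrow> s = t"
  by (auto simp: ray_def dest: inj_onD)

lemma ray_large:
  assumes "ray \<rho>"
  obtains M where "\<And>u. u \<ge> M \<Longrightarrow> B \<le> cmod (\<rho> u)"
proof -
  have "filterlim (\<lambda>u. cmod (\<rho> u)) at_top at_top"
    using assms unfolding ray_def by (intro filterlim_at_infinity_imp_norm_at_top) auto
  then have "\<forall>\<^sub>F u in at_top. B \<le> cmod (\<rho> u)"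
    by (rule filterlim_at_top[THEN iffD1, rule_format])
  then show ?thesis using that unfolding eventually_at_top_linorder by auto
qed

lemma closed_ray:
  assumes "ray \<rho>" "0 \<le> t"
  shows "closed (\<rho> ` {t..})"
  unfolding closed_sequential_limits
proof (intro allI impI, elim conjE)
  fix x l assume x: "\<forall>n. x n \<in> \<rho> ` {t..}" and l: "x \<longlonglongrightarrow> l"
  have "\<forall>n. \<exists>s. s \<ge> t \<and> x n = \<rho> s" using x by auto
  then obtain s where s: "\<And>n. s n \<ge> t" "\<And>n. x n = \<rho> (s n)" by metis
  have "Bseq x" using l by (intro convergent_imp_Bseq convergentI)
  then obtain B where B: "\<And>n. cmod (x n) \<le> B"
    by (auto simp: Bseq_def)
  obtain M where M: "\<And>u. u \<ge> M \<Longrightarrow> B + 1 \<le> cmod (\<rho> u)"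
    using ray_large[OF assms(1), of "B + 1"] by blast
  have "s n < M" for n
    using M[of "s n"] B[of n] s(2)[of n] by force
  then have xM: "x n \<in> \<rho> ` {t..M}" for n
    using s by (simp add: less_imp_le)
  have "continuous_on {t..M} \<rho>"
    using assms unfolding ray_def by (auto intro: continuous_on_subset)
  then have "closed (\<rho> ` {t..M})"
    by (intro compact_imp_closed compact_continuous_image) auto
  then have "l \<in> \<rho> ` {t..M}"
    unfolding closed_sequential_limits using xM l by blast
  then show "l \<in> \<rho> ` {t..}" by auto
qed

lemma unbounded_ray:
  assumes "ray \<rho>"
  shows "\<not> bounded (\<rho> ` {t..})"
proof
  assume "bounded (\<rho> ` {t..})"
  then obtain B where B: "\<And>u. u \<ge> t \<Longrightarrow> cmod (\<rho> u) \<le> B" by (auto simp: bounded_iff)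
  obtain M where M: "\<And>u. u \<ge> M \<Longrightarrow> B + 1 \<le> cmod (\<rho> u)"
    using ray_large[OF assms, of "B + 1"] by blast
  show False using M[of "max t M"] B[of "max t M"] by force
qed

lemma ray_shift:
  assumes "ray \<rho>" "0 \<le> t"
  shows "ray (\<lambda>s. \<rho> (s + t))"
proof -
  have "filterlim (\<lambda>s. \<rho> (s + t)) at_infinity at_top"
  proof (rule filterlim_compose[of \<rho>])
    show "filterlim (\<lambda>s. s + t) at_top at_top" by real_asymp
  qed (use assms(1) in \<open>simp add: ray_def\<close>)
  moreover have "continuous_on {0..} (\<lambda>s. \<rho> (s + t))"
    using assms(2) by (intro continuous_on_ray[OF assms(1)] continuous_intros) auto
  moreover have "inj_on (\<lambda>s. \<rho> (s + t)) {0..}"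
    using ray_inj[OF assms(1)] assms(2) by (force intro: inj_onI)
  ultimately show ?thesis by (simp add: ray_def)
qed

lemma image_ray_shift: "(\<lambda>s. \<rho> (s + t)) ` {0..} = \<rho> ` {t::real..}"
proof -
  have "(\<lambda>s. s + t) ` {0..} = {t..}"
    by (auto intro!: image_eqI[of _ _ "_ - t"])
  then show ?thesis by (metis image_image)
qed

text \<open>An inverted proper ray, completed by the image of infinity, is an arc, and an arc does
  not separate the plane.\<close>

lemma connected_compl_ray0:
  assumes "ray \<rho>"
  shows "connected (- (\<rho> ` {0..}))"
proof (cases "\<rho> ` {0..} = UNIV")
  case False
  then obtain c where c: "c \<notin> \<rho> ` {0..}" by auto
  \<comment> \<open>\<open>t / (1 - t)\<close> stretches the half-open unit interval to the half
    line; the value at \<open>1\<close> is the image of infinity.\<close>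
  define g where "g t = (if t = 1 then 0 else 1 / (\<rho> (t / (1 - t)) - c))" for t :: real
  have c': "\<rho> u \<noteq> c" if "u \<ge> 0" for u using c that by auto
  have "continuous_on {0..1} g"
    unfolding continuous_on_eq_continuous_within
  proof
    fix t :: real assume t: "t \<in> {0..1}"
    show "continuous (at t within {0..1}) g"
    proof (cases "t = 1")
      case True
      have lim: "filterlim (\<lambda>t::real. t / (1 - t)) at_top (at_left 1)" by real_asymp
      have "filterlim \<rho> at_infinity at_top" using assms by (simp add: ray_def)
      from filterlim_compose[OF this lim] have "filterlim (\<lambda>t. \<rho> (t / (1 - t))) at_infinity (at_left 1)" .
      then have "filterlim (\<lambda>t. \<rho> (t / (1 - t)) - c) at_infinity (at_left 1)"
        using tendsto_add_filterlim_at_infinity[OF tendsto_const[of "-c"]] by simp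
      then have "((\<lambda>t. 1 / (\<rho> (t / (1 - t)) - c)) \<longlongrightarrow> 0) (at_left 1)"
        by (intro tendsto_divide_0[OF tendsto_const])
      then have "(g \<longlongrightarrow> 0) (at_left 1)"
        by (rule Lim_transform_eventually) (auto simp: g_def eventually_at_filter)
      then have "(g \<longlongrightarrow> g 1) (at 1 within {0..1})"
        using at_within_Icc_at_left[of 0 "1::real"] by (simp add: g_def)
      then show ?thesis using True by (simp add: continuous_within)
    next
      case False
      have "continuous_on {0..<1} (\<lambda>t. 1 / (\<rho> (t / (1 - t)) - c))"
        using c' by (intro continuous_intros continuous_on_ray[OF assms]) auto
      then have "continuous_on {0..<1} g"
        by (rule continuous_on_cong[THEN iffD1, rotated -1]) (auto simp: g_def)
      then have "continuous (at t within {0..<1}) g"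
        using t False by (simp add: continuous_on_eq_continuous_within)
      moreover have "at t within {0..<1} = at t within {0..1}"
        by (rule at_within_nhd[of t "{..<1}"]) (use t False in auto)
      ultimately show ?thesis by (simp add: continuous_within)
    qed
  qed
  moreover have "inj_on g {0..1}"
  proof (rule inj_onI)
    fix s t :: real assume st: "s \<in> {0..1}" "t \<in> {0..1}" "g s = g t"
    have nz: "g u \<noteq> 0" if "u \<in> {0..1}" "u \<noteq> 1" for u
      using c'[of "u / (1-u)"] that by (auto simp: g_def)
    show "s = t"
    proof (cases "s = 1 \<or> t = 1")
      case True
      then show ?thesis using nz st by (metis g_def)
    next
      case False
      then have "\<rho> (s / (1 - s)) = \<rho> (t / (1 - t))" using st by (simp add: g_def)
      then have "s / (1 - s) = t / (1 - t)"
        using st False by (intro ray_inj[OF assms]) auto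
      then show ?thesis using False by (simp add: field_simps)
    qed
  qed
  ultimately have arc: "arc g" by (simp add: arc_def path_def)
  have "path_image g = inversion c (\<rho> ` {0..})"
  proof (intro equalityI subsetI)
    fix w assume "w \<in> path_image g"
    then obtain t where "t \<in> {0..1}" "w = g t" by (auto simp: path_image_def)
    then show "w \<in> inversion c (\<rho> ` {0..})" by (auto simp: g_def inversion_def)
  next
    fix w assume "w \<in> inversion c (\<rho> ` {0..})"
    then consider "w = 0" | u where "u \<ge> 0" "w = 1 / (\<rho> u - c)" by (auto simp: inversion_def)
    then show "w \<in> path_image g"
    proof cases
      case 1 then have "w = g 1" by (simp add: g_def)
      then show ?thesis by (auto simp: path_image_def)
    next
      case 2
      have "(u / (1 + u)) / (1 - u / (1 + u)) = u" "u / (1 + u) \<noteq> 1"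
        using 2(1) by (simp_all add: divide_simps)
      then have "w = g (u / (1 + u))" using 2 by (simp add: g_def)
      then show ?thesis using 2 by (auto simp: path_image_def intro!: imageI)
    qed
  qed
  then have "connected (- inversion c (\<rho> ` {0..}))"
    using connected_arc_complement[OF arc] by simp
  then show ?thesis
    using connected_compl_inversion closed_ray[OF assms] c by auto
qed simp

lemma connected_compl_ray:
  assumes "ray \<rho>" "0 \<le> t"
  shows "connected (- (\<rho> ` {t..}))"
  using connected_compl_ray0[OF ray_shift[OF assms]] image_ray_shift[of \<rho> t] by simp

section \<open>Logarithms cut along a ray\<close>

definition branch :: "complex \<Rightarrow> complex set \<Rightarrow> (complex \<Rightarrow> complex) \<Rightarrow> bool" where
  "branch p K L \<longleftrightarrow> continuous_on (- K) L \<and> (\<forall>y \<in> - K. exp (L y) = y - p)"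

text \<open>A connected open plane set is simply connected once all components of its complement are
  unbounded; here the complement is the ray itself, which is connected and unbounded.\<close>

lemma branch_exists:
  assumes "ray \<rho>" "0 \<le> t"
  shows "\<exists>L. branch (\<rho> t) (\<rho> ` {t..}) L"
proof -
  let ?K = "\<rho> ` {t..}"
  have "open (- ?K)" using closed_ray[OF assms] by auto
  moreover have "connected ?K"
    using assms(2) by (intro connected_continuous_image continuous_on_ray[OF assms(1)] continuous_intros) auto
  then have "components ?K = {?K}" by (auto simp: components_eq_sing_iff)
  ultimately have "simply_connected (- ?K)"
    using connected_compl_ray[OF assms] unbounded_ray[OF assms(1)]
    by (subst simply_connected_eq_unbounded_complement_components) auto
  moreover have "continuous_on (- ?K) (\<lambda>y. y - \<rho> t)" by (intro continuous_intros)
  moreover have "y - \<rho> t \<noteq> 0" if "y \<in> - ?K" for y using that by auto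
  ultimately obtain L where "continuous_on (- ?K) L" "\<And>y. y \<in> - ?K \<Longrightarrow> y - \<rho> t = exp (L y)"
    using continuous_logarithm_on_simply_connected[of "- ?K" "\<lambda>y. y - \<rho> t"] \<open>open (- ?K)\<close>
    by (metis open_imp_locally_path_connected)
  then show ?thesis by (auto simp: branch_def)
qed

text \<open>No branch is known explicitly. Along a path avoiding the cut, any continuous logarithm
  \<open>\<Theta>\<close> of the same vector has the same increment and can be used to compute
  it.\<close>

lemma branch_diff_along:
  assumes "branch p K L" "continuous_on {a..b} \<tau>" "a \<le> b" "\<tau> ` {a..b} \<subseteq> - K"
    and "continuous_on {a..b} \<Theta>" "\<And>s. s \<in> {a..b} \<Longrightarrow> exp (\<Theta> s) = \<tau> s - p"
  shows "L (\<tau> b) - L (\<tau> a) = \<Theta> b - \<Theta> (a::real)"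
proof (rule same_exp_imp_diff_constant[of "{a..b}" "\<lambda>s. L (\<tau> s)" \<Theta> b a])
  have L: "continuous_on (- K) L" "\<And>y. y \<notin> K \<Longrightarrow> exp (L y) = y - p"
    using assms(1) by (auto simp: branch_def)
  show "continuous_on {a..b} (\<lambda>s. L (\<tau> s))"
    using continuous_on_compose2[OF L(1) assms(2,4)] .
  show "exp (L (\<tau> s)) = exp (\<Theta> s)" if "s \<in> {a..b}" for s
  proof -
    have "\<tau> s \<notin> K" using assms(4) that by blast
    then show ?thesis using L(2) assms(6)[OF that] by simp
  qed
  show "connected {a..b}" by (rule connected_Icc)
  show "continuous_on {a..b} \<Theta>" by fact
  show "b \<in> {a..b}" using assms(3) by simp
  show "a \<in> {a..b}" using assms(3) by simp
qed

text \<open>The branches \<open>L t\<close> are chosen independently for each \<open>t\<close>, so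
  only increments between two points can be expected to vary continuously. A fixed path from
  \<open>z\<close> to \<open>q\<close> avoids all the shrinking cuts at once, and over the convex
  domain of path and sliding parameters there is a jointly continuous logarithm that computes the
  increments.\<close>

lemma ray_slide_continuous:
  assumes "ray \<rho>" "q \<notin> \<rho> ` {0..}" "z \<notin> \<rho> ` {0..}"
    and br: "\<And>t. 0 \<le> t \<Longrightarrow> branch (\<rho> t) (\<rho> ` {t..}) (L t)"
  shows "continuous_on {0..} (\<lambda>t. L t q - L t z)"
proof -
  have "open (- (\<rho> ` {0..}))" using closed_ray[OF assms(1)] by auto
  then have "path_connected (- (\<rho> ` {0..}))"
    using connected_compl_ray[OF assms(1)] by (simp add: connected_open_path_connected)
  then obtain \<tau> where \<tau>: "path \<tau>" "path_image \<tau> \<subseteq> - (\<rho> ` {0..})" "pathstart \<tau> = z" "pathfinish \<tau> = q"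
    using assms(2,3) unfolding path_connected_def by (metis ComplI)
  let ?D = "{0..1::real} \<times> {0::real..}"
  have c\<tau>: "continuous_on {0..1} \<tau>" using \<tau>(1) by (simp add: path_def)
  have "continuous_on ?D (\<lambda>x. \<tau> (fst x))"
    by (rule continuous_on_compose2[OF c\<tau>]) (auto intro: continuous_on_fst continuous_on_id)
  moreover have "continuous_on ?D (\<lambda>x. \<rho> (snd x))"
    by (rule continuous_on_ray[OF assms(1)]) (auto intro: continuous_on_snd continuous_on_id)
  ultimately have "continuous_on ?D (\<lambda>x. \<tau> (fst x) - \<rho> (snd x))"
    by (rule continuous_on_diff)
  moreover have "contractible ?D"
    by (intro convex_imp_contractible convex_Times) auto
  moreover have "\<tau> (fst x) - \<rho> (snd x) \<noteq> 0" if "x \<in> ?D" for x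
  proof -
    have "\<tau> (fst x) \<in> path_image \<tau>" "\<rho> (snd x) \<in> \<rho> ` {0..}"
      using that by (auto simp: path_image_def)
    then show ?thesis using \<tau>(2) by auto
  qed
  ultimately obtain \<Theta> where \<Theta>: "continuous_on ?D \<Theta>" "\<And>x. x \<in> ?D \<Longrightarrow> \<tau> (fst x) - \<rho> (snd x) = exp (\<Theta> x)"
    using continuous_logarithm_on_contractible[of ?D "\<lambda>x. \<tau> (fst x) - \<rho> (snd x)"] by blast
  have "L t q - L t z = \<Theta> (1, t) - \<Theta> (0, t)" if t: "t \<in> {0..}" for t
  proof -
    have "L t (\<tau> 1) - L t (\<tau> 0) = \<Theta> (1, t) - \<Theta> (0, t)"
    proof (rule branch_diff_along[OF br])
      show "continuous_on {0..1} (\<lambda>s. \<Theta> (s, t))"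
        by (rule continuous_on_compose2[OF \<Theta>(1)]) (use t in \<open>auto intro!: continuous_intros\<close>)
      show "\<tau> ` {0..1} \<subseteq> - (\<rho> ` {t..})"
        using \<tau>(2) t by (force simp: path_image_def)
      show "exp (\<Theta> (s, t)) = \<tau> s - \<rho> t" if "s \<in> {0..1}" for s
        using \<Theta>(2)[of "(s, t)"] that t by simp
    qed (use t c\<tau> in simp_all)
    then show ?thesis using \<tau> by (simp add: pathstart_def pathfinish_def)
  qed
  moreover have "continuous_on {0..} (\<lambda>t. \<Theta> (1, t) - \<Theta> (0, t))"
    by (intro continuous_on_diff continuous_on_compose2[OF \<Theta>(1)] continuous_on_Pair continuous_on_const continuous_on_id) auto
  ultimately show ?thesis by (subst continuous_on_cong[OF refl, of _ _ "\<lambda>t. \<Theta> (1, t) - \<Theta> (0, t)"]) auto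
qed

lemma branch_unique:
  assumes "branch p K L" "branch p K L'" "connected (- K)" "q \<notin> K" "z \<notin> K"
  shows "L q - L z = L' q - L' z"
  by (rule same_exp_imp_diff_constant[of "- K"]) (use assms in \<open>auto simp: branch_def\<close>)

text \<open>An unspecified branch is good enough, because the increment from \<open>z\<close> to
  \<open>q\<close> does not depend on it when the complement of the cut is connected. The imaginary
  part is the angle swept, seen from \<open>p\<close>, without crossing the cut.\<close>

definition sweep :: "complex \<Rightarrow> complex set \<Rightarrow> complex \<Rightarrow> complex \<Rightarrow> complex" where
  "sweep p K q z = (SOME L. branch p K L) q - (SOME L. branch p K L) z"

lemma sweep_eq:
  assumes "branch p K L" "connected (- K)" "q \<notin> K" "z \<notin> K"
  shows "sweep p K q z = L q - L z"
  unfolding sweep_def using someI[of "branch p K", OF assms(1)] assms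
  by (intro branch_unique) auto

text \<open>For straight rays pointing away from the triangle of their starting points, \<open>turn\<close> is \<open>\<i>\<close> times the
  signed angle sum of that triangle. Sliding a ray along itself does not change it, since it varies
  continuously and its exponential is \<open>- 1\<close>.\<close>

definition turn :: "(real \<Rightarrow> complex) \<Rightarrow> (real \<Rightarrow> complex) \<Rightarrow> (real \<Rightarrow> complex) \<Rightarrow> complex" where
  "turn \<rho>1 \<rho>2 \<rho>3 = sweep (\<rho>1 0) (\<rho>1 ` {0..}) (\<rho>2 0) (\<rho>3 0)
     + sweep (\<rho>2 0) (\<rho>2 ` {0..}) (\<rho>3 0) (\<rho>1 0) + sweep (\<rho>3 0) (\<rho>3 ` {0..}) (\<rho>1 0) (\<rho>2 0)"

lemma turn_rotate: "turn \<rho>1 \<rho>2 \<rho>3 = turn \<rho>2 \<rho>3 \<rho>1"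
  by (simp add: turn_def add.commute add.left_commute)

definition disjoint_rays :: "(real \<Rightarrow> complex) \<Rightarrow> (real \<Rightarrow> complex) \<Rightarrow> bool" where
  "disjoint_rays \<rho> \<sigma> \<longleftrightarrow> ray \<rho> \<and> ray \<sigma> \<and> \<rho> ` {0..} \<inter> \<sigma> ` {0..} = {}"

lemma disjoint_rays_sym: "disjoint_rays \<rho> \<sigma> \<Longrightarrow> disjoint_rays \<sigma> \<rho>"
  by (auto simp: disjoint_rays_def)

lemma disjoint_raysD:
  assumes "disjoint_rays \<rho> \<sigma>"
  shows "ray \<rho>" "ray \<sigma>" "0 \<le> s \<Longrightarrow> 0 \<le> t \<Longrightarrow> \<rho> s \<noteq> \<sigma> t" "0 \<le> t \<Longrightarrow> \<sigma> t \<notin> \<rho> ` {0..}"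
     "0 \<le> s \<Longrightarrow> \<rho> s \<notin> \<sigma> ` {0..}"
  using assms by (auto simp: disjoint_rays_def)

text \<open>The factors cancel in three pairs of opposite differences, each contributing
  \<open>-1\<close>. This is why \<open>turn\<close> is an odd multiple of
  \<open>\<i> * pi\<close>.\<close>

lemma triangle_quotients:
  fixes a b c :: complex
  assumes "a \<noteq> b" "c \<noteq> b" "a \<noteq> c"
  shows "(a - b) / (c - b) * ((c - a) / (b - a)) * ((b - c) / (a - c)) = - 1"
  using assms by (simp add: divide_simps) (simp add: algebra_simps)

lemma turn_shift:
  assumes "disjoint_rays \<rho>1 \<rho>2" "disjoint_rays \<rho>1 \<rho>3" "disjoint_rays \<rho>2 \<rho>3" "0 \<le> t"
  shows "turn (\<lambda>s. \<rho>1 (s + t)) \<rho>2 \<rho>3 = turn \<rho>1 \<rho>2 \<rho>3"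
proof -
  note R = disjoint_raysD[OF assms(1)] disjoint_raysD[OF assms(2)] disjoint_raysD[OF assms(3)]
  have "\<exists>L. branch (\<rho>1 t) (\<rho>1 ` {t..}) L" if "0 \<le> t" for t
    using branch_exists R(1) that by blast
  then obtain L where L: "\<And>t. 0 \<le> t \<Longrightarrow> branch (\<rho>1 t) (\<rho>1 ` {t..}) (L t)" by metis
  obtain L2 where L2: "branch (\<rho>2 0) (\<rho>2 ` {0..}) L2" using branch_exists[OF R(2)] by blast
  obtain L3 where L3: "branch (\<rho>3 0) (\<rho>3 ` {0..}) L3" using branch_exists[OF R(7)] by blast
  \<comment> \<open>The first bracket must stay a difference, since nothing normalises
    \<open>L s\<close> from one \<open>s\<close> to the next. In the other two only the point
    \<open>\<rho>1 s\<close> moves, and it stays off fixed cuts.\<close>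
  define h where "h s = (L s (\<rho>2 0) - L s (\<rho>3 0)) + (L2 (\<rho>3 0) - L2 (\<rho>1 s)) + (L3 (\<rho>1 s) - L3 (\<rho>2 0))" for s
  have h: "turn (\<lambda>u. \<rho>1 (u + s)) \<rho>2 \<rho>3 = h s" if s: "0 \<le> s" for s
  proof -
    have "sweep (\<rho>1 s) (\<rho>1 ` {s..}) (\<rho>2 0) (\<rho>3 0) = L s (\<rho>2 0) - L s (\<rho>3 0)"
      using R(3)[of _ 0] R(8)[of _ 0] s
      by (intro sweep_eq L connected_compl_ray[OF R(1)]) (auto simp: image_iff, (metis R(3,8) order.trans order_refl)+)
    moreover have "sweep (\<rho>2 0) (\<rho>2 ` {0..}) (\<rho>3 0) (\<rho>1 s) = L2 (\<rho>3 0) - L2 (\<rho>1 s)"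
      using R s by (intro sweep_eq L2 connected_compl_ray[OF R(2)]) auto
    moreover have "sweep (\<rho>3 0) (\<rho>3 ` {0..}) (\<rho>1 s) (\<rho>2 0) = L3 (\<rho>1 s) - L3 (\<rho>2 0)"
      using R s by (intro sweep_eq L3 connected_compl_ray[OF R(7)]) auto
    ultimately show ?thesis
      unfolding turn_def h_def image_ray_shift by simp
  qed
  have c1: "continuous_on {0..} (\<lambda>s. L s (\<rho>2 0) - L s (\<rho>3 0))"
    using R by (intro ray_slide_continuous[OF R(1)] L) auto
  have c2: "continuous_on {0..} (\<lambda>s. L2 (\<rho>1 s))"
    by (rule continuous_on_compose2[of "- (\<rho>2 ` {0..})" L2])
       (use L2 R in \<open>auto simp: branch_def ray_def\<close>)
  have c3: "continuous_on {0..} (\<lambda>s. L3 (\<rho>1 s))"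
    by (rule continuous_on_compose2[of "- (\<rho>3 ` {0..})" L3])
       (use L3 R in \<open>auto simp: branch_def ray_def\<close>)
  have ch: "continuous_on {0..} h"
    unfolding h_def
    by (rule continuous_on_add[OF continuous_on_add[OF c1 continuous_on_diff[OF continuous_on_const c2]]
        continuous_on_diff[OF c3 continuous_on_const]])
  have "exp (h s) = -1" if s: "s \<in> {0..}" for s
  proof -
    have e1: "exp (L s y) = y - \<rho>1 s" if "y \<notin> \<rho>1 ` {s..}" for y
      using L[of s] s that by (auto simp: branch_def)
    have e2: "exp (L2 y) = y - \<rho>2 0" if "y \<notin> \<rho>2 ` {0..}" for y using L2 that by (auto simp: branch_def)
    have e3: "exp (L3 y) = y - \<rho>3 0" if "y \<notin> \<rho>3 ` {0..}" for y using L3 that by (auto simp: branch_def)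
    have sub: "\<rho>1 ` {s..} \<subseteq> \<rho>1 ` {0..}" using s by auto
    have m: "\<rho>2 0 \<notin> \<rho>1 ` {s..}" "\<rho>3 0 \<notin> \<rho>1 ` {s..}"
      using sub R(4)[of 0] R(9)[of 0] by auto
    have "exp (h s) = (\<rho>2 0 - \<rho>1 s) / (\<rho>3 0 - \<rho>1 s) * ((\<rho>3 0 - \<rho>2 0) / (\<rho>1 s - \<rho>2 0)) * ((\<rho>1 s - \<rho>3 0) / (\<rho>2 0 - \<rho>3 0))"
      unfolding h_def exp_add exp_diff e1[OF m(1)] e1[OF m(2)]
        e2[OF R(14)[of 0, OF order_refl]] e2[OF R(5)[of s, OF s[simplified]]]
        e3[OF R(10)[of s, OF s[simplified]]] e3[OF R(15)[of 0, OF order_refl]] ..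
    moreover have "\<rho>2 0 \<noteq> \<rho>1 s" "\<rho>3 0 \<noteq> \<rho>1 s" "\<rho>2 0 \<noteq> \<rho>3 0"
      using R(3)[of s 0] R(8)[of s 0] R(13)[of 0 0] s by auto
    ultimately show ?thesis using triangle_quotients[of "\<rho>2 0" "\<rho>1 s" "\<rho>3 0"] by simp
  qed
  then obtain a where "\<And>s. s \<in> {0..} \<Longrightarrow> h s = a"
    using exp_const_imp_constant[OF _ ch, of "-1"] by (metis connected_Ici)
  then show ?thesis using h[of 0] h[of t] assms(4) by simp
qed

text \<open>The two rays have a common tail, and cutting off an initial piece does not change
  \<open>turn\<close>; hence the initial piece may be exchanged.\<close>

lemma turn_extend:
  assumes "disjoint_rays \<rho> \<rho>2" "disjoint_rays \<rho>' \<rho>2" "disjoint_rays \<rho> \<rho>3" "disjoint_rays \<rho>' \<rho>3"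
    and "disjoint_rays \<rho>2 \<rho>3" and t: "0 \<le> t" "0 \<le> t'" "\<And>s. 0 \<le> s \<Longrightarrow> \<rho>' (s + t') = \<rho> (s + t)"
  shows "turn \<rho>' \<rho>2 \<rho>3 = turn \<rho> \<rho>2 \<rho>3"
proof -
  have "(\<lambda>s. \<rho>' (s + t')) ` {0..} = (\<lambda>s. \<rho> (s + t)) ` {0..}"
    using t(3) by (intro image_cong) auto
  then have "turn (\<lambda>s. \<rho>' (s + t')) \<rho>2 \<rho>3 = turn (\<lambda>s. \<rho> (s + t)) \<rho>2 \<rho>3"
    using t(3)[of 0] by (simp add: turn_def)
  then show ?thesis using turn_shift assms by simp
qed

text \<open>Seen from \<open>p\<close>, a segment that misses \<open>p\<close> subtends an angle
  below \<open>pi\<close>: as \<open>x\<close> runs from \<open>z\<close> to \<open>q\<close>, the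
  quotient \<open>(x - p) / (z - p)\<close> starts at \<open>1\<close> and never meets the
  nonpositive real axis, so the principal logarithm follows it continuously.\<close>

lemma branch_segment:
  assumes "branch p K L" "p \<in> K" "closed_segment z q \<inter> K = {}"
  shows "\<bar>Im (L q - L z)\<bar> < pi"
proof -
  define w where "w = (q - p) / (z - p)"
  have zp: "z \<noteq> p" using assms by auto
  have nz: "1 - of_real s + of_real s * w \<notin> \<real>\<^sub>\<le>\<^sub>0" if s: "s \<in> {0..1}" for s
  proof
    assume "1 - of_real s + of_real s * w \<in> \<real>\<^sub>\<le>\<^sub>0"
    then obtain r where r: "r \<le> 0" "1 - of_real s + of_real s * w = of_real r" by (auto simp: nonpos_Reals_def)
    have s0: "s > 0" using r s by (cases "s = 0") auto
    define v where "v = (r - (1 - s)) / s"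
    have "of_real s * w = of_real (r - (1 - s))" using r(2) by (simp add: algebra_simps)
    then have w: "w = of_real v" using s0 by (simp add: v_def field_simps)
    have v: "v \<le> 0" using r s s0 by (simp add: v_def divide_nonpos_pos)
    \<comment> \<open>The parameter at which the segment from \<open>1\<close> to \<open>v\<close>
      passes through \<open>0\<close>; it would place \<open>p\<close> between \<open>z\<close> and
      \<open>q\<close>.\<close>
    define u where "u = 1 / (1 - v)"
    have u: "0 \<le> u" "u \<le> 1" "(1 - u) + u * v = 0" using v by (auto simp: u_def divide_simps)
    have "q - p = of_real v * (z - p)" using w zp by (simp add: w_def field_simps)
    then have q: "q = p + of_real v * (z - p)" by (simp add: algebra_simps)
    have "(1 - u) *\<^sub>R z + u *\<^sub>R q = p + of_real ((1 - u) + u * v) * (z - p)"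
      unfolding q by (simp add: scaleR_conv_of_real algebra_simps)
    then have "p = (1 - u) *\<^sub>R z + u *\<^sub>R q" using u(3) by simp
    then have "p \<in> closed_segment z q" using u by (auto simp: in_segment)
    then show False using assms by auto
  qed
  define \<Theta> where "\<Theta> s = Ln (1 - of_real s + of_real s * w) + Ln (z - p)" for s :: real
  have "L (linepath z q 1) - L (linepath z q 0) = \<Theta> 1 - \<Theta> 0"
  proof (rule branch_diff_along[OF assms(1)])
    show "continuous_on {0..1} \<Theta>" unfolding \<Theta>_def using nz by (intro continuous_intros) auto
    show "linepath z q ` {0..1} \<subseteq> - K" using assms(3) by (auto simp: linepath_image_01)
    show "exp (\<Theta> s) = linepath z q s - p" if "s \<in> {0..1}" for s
    proof -
      have "1 - of_real s + of_real s * w \<noteq> 0" using nz[OF that] by auto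
      then have "exp (\<Theta> s) = (1 - of_real s + of_real s * w) * (z - p)"
        using zp by (simp add: \<Theta>_def exp_add)
      also have "\<dots> = linepath z q s - p"
        using zp by (simp add: w_def linepath_def scaleR_conv_of_real divide_simps) (simp add: algebra_simps)
      finally show ?thesis .
    qed
  qed auto
  then have "L q - L z = Ln w" by (simp add: \<Theta>_def linepath_def)
  moreover have w: "w \<notin> \<real>\<^sub>\<le>\<^sub>0" "w \<noteq> 0" using nz[of 1] by auto
  then have "- pi < Im (Ln w)" "Im (Ln w) < pi"
    using mpi_less_Im_Ln[OF w(2)] Im_Ln_less_pi[OF w(1)] by auto
  ultimately show ?thesis by simp
qed

text \<open>Strict convexity of the disc: interior points of a chord are not on the circle, while
  the ray touches the disc only in its starting point, which is on the circle. So the chord avoids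
  the cut and \<open>branch_segment\<close> applies.\<close>

lemma sweep_ball:
  assumes "ray \<rho>" "\<rho> 0 \<in> sphere c e" "\<rho> ` {0<..} \<inter> cball c e = {}"
    and "q \<in> sphere c e" "z \<in> sphere c e" "q \<notin> \<rho> ` {0..}" "z \<notin> \<rho> ` {0..}"
  shows "\<bar>Im (sweep (\<rho> 0) (\<rho> ` {0..}) q z)\<bar> < pi"
proof -
  obtain L where L: "branch (\<rho> 0) (\<rho> ` {0..}) L" using branch_exists[OF assms(1)] by blast
  have "closed_segment z q \<inter> \<rho> ` {0..} = {}"
  proof (rule ccontr)
    assume "closed_segment z q \<inter> \<rho> ` {0..} \<noteq> {}"
    then obtain t where t: "t \<ge> 0" "\<rho> t \<in> closed_segment z q" by auto
    have "closed_segment z q \<subseteq> cball c e"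
      using assms(4,5) by (intro closed_segment_subset) auto
    then have "\<rho> t \<in> cball c e" using t(2) by blast
    then have "\<rho> t \<notin> \<rho> ` {0<..}" using assms(3) by blast
    then have "t = 0" using t(1) by (cases "t = 0") auto
    then have "\<rho> 0 \<in> open_segment z q"
      using t assms(6,7) by (auto simp: open_segment_def)
    then have "dist c (\<rho> 0) < dist c z \<or> dist c (\<rho> 0) < dist c q"
      by (rule dist_decreases_open_segment)
    then show False using assms(2,4,5) by auto
  qed
  then have "\<bar>Im (L q - L z)\<bar> < pi" by (intro branch_segment[OF L]) auto
  then show ?thesis using sweep_eq[OF L connected_compl_ray[OF assms(1)] assms(6,7)] by simp
qed

text \<open>An arc from \<open>c\<close> to \<open>\<rho> 0\<close> off \<open>K\<close> is cut down
  to the piece between its last point in the disc and its next hit of the ray, and the ray is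
  followed from there on. The disc itself may meet \<open>K\<close>, only its centre is kept off:
  rays prolonged earlier start on the same circle.\<close>

lemma ray_extend_to_ball:
  assumes "ray \<rho>" "closed K" "connected (- K)" "\<rho> ` {0..} \<inter> K = {}" "cball c e \<inter> \<rho> ` {0..} = {}" "c \<notin> K" "0 < e"
  obtains \<rho>' t t' where "ray \<rho>'" "\<rho>' ` {0..} \<inter> K = {}" "\<rho>' 0 \<in> sphere c e" "\<rho>' ` {0<..} \<inter> cball c e = {}"
    "0 \<le> t" "0 \<le> t'" "\<And>s. 0 \<le> s \<Longrightarrow> \<rho>' (s + t') = \<rho> (s + t)"
proof -
  have c: "c \<in> cball c e" using assms(7) by simp
  have \<rho>0: "\<rho> 0 \<in> \<rho> ` {0..}" by simp
  have "path_connected (- K)" using assms(2,3) by (simp add: connected_open_path_connected open_Compl)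
  moreover have "\<rho> 0 \<notin> cball c e" using assms(5) \<rho>0 by blast
  then have "c \<in> - K" "\<rho> 0 \<in> - K" "c \<noteq> \<rho> 0" using c \<rho>0 assms(4,6) by auto
  ultimately obtain g where g: "arc g" "path_image g \<subseteq> - K" "pathstart g = c" "pathfinish g = \<rho> 0"
    unfolding path_connected_arcwise by metis
  have gc: "continuous_on {0..1} g" and gi: "inj_on g {0..1}" using g(1) by (auto simp: arc_def path_def)
  have g01: "g 0 = c" "g 1 = \<rho> 0" using g by (auto simp: pathstart_def pathfinish_def)
  have gK: "g s \<notin> K" if "s \<in> {0..1}" for s
  proof -
    have "g s \<in> path_image g" using that by (auto simp: path_image_def)
    then show ?thesis using g(2) by blast
  qed
  define A where "A = {0..1} \<inter> g -` cball c e"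
  have "closed A" unfolding A_def by (intro continuous_closed_preimage gc) auto
  then have "compact ({0..1} \<inter> A)" by (intro compact_Int_closed) auto
  then have "compact A" by (simp add: A_def Int_assoc[symmetric])
  moreover have "0 \<in> A" using c g01 by (simp add: A_def)
  \<comment> \<open>The last parameter at which the arc is in the closed disc; from there on it
    stays outside.\<close>
  ultimately obtain s0 where s0: "s0 \<in> A" "\<And>s. s \<in> A \<Longrightarrow> s \<le> s0"
    using compact_attains_sup[of A] by auto
  have s0r: "0 \<le> s0" "s0 < 1"
  proof -
    show "0 \<le> s0" using s0(1) by (simp add: A_def)
    have "g 1 \<notin> cball c e" using g01 \<rho>0 assms(5) by auto
    then have "s0 \<noteq> 1" using s0(1) by (auto simp: A_def)
    then show "s0 < 1" using s0(1) by (simp add: A_def)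
  qed
  have sph: "g s0 \<in> sphere c e"
  proof (rule ccontr)
    assume "g s0 \<notin> sphere c e"
    then have b: "g s0 \<in> ball c e" using s0(1) by (auto simp: A_def)
    obtain T where T: "open T" "T \<inter> {0..1} = g -` ball c e \<inter> {0..1}"
      using gc[unfolded continuous_on_open_invariant, rule_format, of "ball c e"] by auto
    have "s0 \<in> T" using T(2) b s0r by auto
    then obtain d where d: "d > 0" "ball s0 d \<subseteq> T" using T(1) open_contains_ball by blast
    define s where "s = min 1 (s0 + d/2)"
    have s: "s0 < s" "s \<le> 1" "s \<in> ball s0 d" using d(1) s0r by (auto simp: s_def dist_real_def min_def)
    then have "s \<in> T \<inter> {0..1}" using d(2) s0r by auto
    then have "s \<in> A" using T(2) unfolding A_def by force
    then show False using s0(2) s(1) by force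
  qed
  define B where "B = {s0..1} \<inter> g -` (\<rho> ` {0..})"
  have "closed B" unfolding B_def
    using s0r by (intro continuous_closed_preimage closed_ray[OF assms(1)] continuous_on_subset[OF gc]) auto
  then have "compact ({s0..1} \<inter> B)" by (intro compact_Int_closed) auto
  then have "compact B" by (simp add: B_def Int_assoc[symmetric])
  moreover have "1 \<in> B" using g01 \<rho>0 s0r by (simp add: B_def)
  \<comment> \<open>The first hit of the ray after \<open>s0\<close>. It can be at any
    \<open>\<rho> t\<close>; discarding the ray before \<open>t\<close> keeps the prolonged ray
    injective.\<close>
  ultimately obtain s1 where s1: "s1 \<in> B" "\<And>s. s \<in> B \<Longrightarrow> s1 \<le> s"
    using compact_attains_inf[of B] by auto
  obtain t where t: "t \<ge> 0" "g s1 = \<rho> t" using s1(1) by (auto simp: B_def)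
  have "g s0 \<notin> \<rho> ` {0..}" using sph assms(5) by auto
  then have s01: "s0 < s1" "s1 \<le> 1" using s1(1) by (auto simp: B_def order_less_le)
  define d where "d = s1 - s0"
  define \<rho>' where "\<rho>' u = (if u \<le> d then g (s0 + u) else \<rho> (u - d + t))" for u
  have d: "d > 0" using s01 by (simp add: d_def)
  have e1: "\<rho>' u = g (s0 + u)" "s0 + u \<in> {s0..s1}" if "u \<le> d" "0 \<le> u" for u
    using that by (auto simp: \<rho>'_def d_def)
  have e2: "\<rho>' u = \<rho> (u - d + t)" if "d \<le> u" for u
  proof (cases "u = d")
    case True
    then have "\<rho>' u = g s1" by (simp add: \<rho>'_def d_def)
    then show ?thesis using t True by simp
  qed (use that in \<open>simp add: \<rho>'_def\<close>)
  have notray: "g s \<notin> \<rho> ` {0..}" if "s \<in> {s0..<s1}" for s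
    using s1(2)[of s] that s01 by (auto simp: B_def)
  have c1: "continuous_on {0..d} \<rho>'"
  proof -
    have "continuous_on {0..d} (\<lambda>u. g (s0 + u))"
      by (rule continuous_on_compose2[OF gc]) (use s0r s01 in \<open>auto simp: d_def intro!: continuous_intros\<close>)
    then show ?thesis by (rule continuous_on_eq) (simp add: e1)
  qed
  have c2: "continuous_on {d..} \<rho>'"
  proof -
    have "continuous_on {d..} (\<lambda>u. \<rho> (u - d + t))"
      by (rule continuous_on_ray[OF assms(1)]) (use t in \<open>auto intro!: continuous_intros\<close>)
    then show ?thesis by (rule continuous_on_eq) (simp add: e2)
  qed
  have "{0..} = {0..d} \<union> {d..}" using d by auto
  then have "continuous_on {0..} \<rho>'"
    using continuous_on_closed_Un[OF _ _ c1 c2] by simp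
  moreover have "inj_on \<rho>' {0..}"
  proof (rule inj_onI)
    have mixed: "\<rho>' u \<noteq> \<rho>' v" if "0 \<le> u" "u < d" "d \<le> v" for u v
    proof -
      have "\<rho>' v \<in> \<rho> ` {0..}" using e2 that t by auto
      moreover have "\<rho>' u \<notin> \<rho> ` {0..}" using e1[of u] notray[of "s0 + u"] that by (simp add: d_def)
      ultimately show ?thesis by metis
    qed
    fix u v assume uv: "u \<in> {0..}" "v \<in> {0..}" "\<rho>' u = \<rho>' v"
    then consider "u < d" "v < d" | "d \<le> u" "d \<le> v"
      using mixed[of u v] mixed[of v u] by fastforce
    then show "u = v"
    proof cases
      case 1
      have "s0 + u = s0 + v"
      proof (rule inj_onD[OF gi])
        show "g (s0 + u) = g (s0 + v)" using e1[of u] e1[of v] 1 uv by simp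
      qed (use 1 uv s0r s01 in \<open>auto simp: d_def\<close>)
      then show ?thesis by simp
    next
      case 2
      then have "u - d + t = v - d + t"
        using uv e2 t by (intro ray_inj[OF assms(1)]) auto
      then show ?thesis by simp
    qed
  qed
  moreover have "filterlim \<rho>' at_infinity at_top"
  proof -
    have l: "filterlim (\<lambda>u. u - d + t) at_top at_top" by real_asymp
    have "filterlim \<rho> at_infinity at_top" using assms(1) by (simp add: ray_def)
    from filterlim_compose[OF this l] show ?thesis
      by (rule filterlim_mono_eventually) (auto simp: eventually_at_top_linorder e2 intro!: exI[of _ d])
  qed
  ultimately have "ray \<rho>'" by (simp add: ray_def)
  moreover have "\<rho>' ` {0..} \<inter> K = {}"
  proof -
    have "\<rho>' u \<notin> K" if "0 \<le> u" for u
    proof (cases "u \<le> d")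
      case True
      then show ?thesis using e1[of u] gK[of "s0 + u"] that s0r s01 by simp
    next
      case False
      then have "\<rho>' u \<in> \<rho> ` {0..}" using e2 t by auto
      then show ?thesis using assms(4) by auto
    qed
    then show ?thesis by auto
  qed
  moreover have "\<rho>' 0 \<in> sphere c e" using e1[of 0] d sph by simp
  moreover have "\<rho>' ` {0<..} \<inter> cball c e = {}"
  proof -
    have "\<rho>' u \<notin> cball c e" if "0 < u" for u
    proof (cases "u \<le> d")
      case True
      then have "s0 + u \<notin> A" using s0(2)[of "s0 + u"] that by auto
      then show ?thesis using e1[of u] that True s0r s01 by (simp add: A_def)
    next
      case False
      then have "\<rho>' u \<in> \<rho> ` {0..}" using e2 t by auto
      then show ?thesis using assms(5) by auto
    qed
    then show ?thesis by auto
  qed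
  moreover have "\<rho>' (s + d) = \<rho> (s + t)" if "0 \<le> s" for s using e2[of "s + d"] that by simp
  ultimately show ?thesis using that t(1) d by (metis less_imp_le)
qed

lemma closed_ray0: "ray \<rho> \<Longrightarrow> closed (\<rho> ` {0..})"
  using closed_ray by simp

lemma connected_compl_two_rays:
  "disjoint_rays \<rho> \<sigma> \<Longrightarrow> connected (- (\<rho> ` {0..} \<union> \<sigma> ` {0..}))"
  by (intro connected_compl_disjoint_Un closed_ray0 connected_compl_ray0) (auto simp: disjoint_rays_def)

text \<open>The set to be avoided is the union of the other two rays, whose complement is connected.
  The centre is again off the new ray, so that the construction can be repeated for the next
  one.\<close>

lemma turn_extend_to_ball:
  assumes "disjoint_rays \<rho>1 \<rho>2" "disjoint_rays \<rho>1 \<rho>3" "disjoint_rays \<rho>2 \<rho>3" "0 < e"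
    and "cball c e \<inter> \<rho>1 ` {0..} = {}" "c \<notin> \<rho>2 ` {0..}" "c \<notin> \<rho>3 ` {0..}"
  obtains \<rho> where "disjoint_rays \<rho> \<rho>2" "disjoint_rays \<rho> \<rho>3" "turn \<rho> \<rho>2 \<rho>3 = turn \<rho>1 \<rho>2 \<rho>3"
    "\<rho> 0 \<in> sphere c e" "\<rho> ` {0<..} \<inter> cball c e = {}" "c \<notin> \<rho> ` {0..}"
proof -
  let ?K = "\<rho>2 ` {0..} \<union> \<rho>3 ` {0..}"
  have r: "ray \<rho>1" "ray \<rho>2" "ray \<rho>3" using assms(1,2) by (auto simp: disjoint_rays_def)
  have K: "closed ?K" "connected (- ?K)" "\<rho>1 ` {0..} \<inter> ?K = {}" "c \<notin> ?K"
    using connected_compl_two_rays[OF assms(3)] closed_ray0 r assms(1,2,6,7)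
    by (auto simp: disjoint_rays_def)
  obtain \<rho> t t' where \<rho>: "ray \<rho>" "\<rho> ` {0..} \<inter> ?K = {}" "\<rho> 0 \<in> sphere c e" "\<rho> ` {0<..} \<inter> cball c e = {}"
    and t: "0 \<le> t" "0 \<le> t'" "\<And>s. 0 \<le> s \<Longrightarrow> \<rho> (s + t') = \<rho>1 (s + t)"
    using ray_extend_to_ball[OF r(1) K(1-3) assms(5) K(4) assms(4)] by blast
  have "c \<notin> \<rho> ` {0..}"
  proof
    assume "c \<in> \<rho> ` {0..}"
    then obtain s where s: "s \<ge> 0" "c = \<rho> s" by auto
    have "s \<noteq> 0" using \<rho>(3) s(2) assms(4) by (intro notI) simp
    then have "c \<in> \<rho> ` {0<..}" using s by auto
    then show False using \<rho>(4) assms(4) by (metis IntI centre_in_cball emptyE less_imp_le)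
  qed
  moreover have "disjoint_rays \<rho> \<rho>2" "disjoint_rays \<rho> \<rho>3" using \<rho> r by (auto simp: disjoint_rays_def)
  ultimately show ?thesis using that turn_extend[OF assms(1) _ assms(2) _ assms(3) t] \<rho> by blast
qed

text \<open>A point off all three rays exists because the connected plane is not the disjoint union
  of two nonempty closed sets. The rays are prolonged one at a time to a small circle around it,
  \<open>turn_rotate\<close> bringing the next one to the front; in the end each of the three angles
  is below \<open>pi\<close>.\<close>

lemma turn_bound:
  assumes "disjoint_rays \<rho>1 \<rho>2" "disjoint_rays \<rho>1 \<rho>3" "disjoint_rays \<rho>2 \<rho>3"
  shows "\<bar>Im (turn \<rho>1 \<rho>2 \<rho>3)\<bar> < 3 * pi"
proof -
  let ?K1 = "\<rho>1 ` {0..}" and ?K2 = "\<rho>2 ` {0..}" and ?K3 = "\<rho>3 ` {0..}"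
  have r: "ray \<rho>1" "ray \<rho>2" "ray \<rho>3" using assms(1,2) by (auto simp: disjoint_rays_def)
  then have cl: "closed ?K1" "closed (?K2 \<union> ?K3)" using closed_ray0 by auto
  have dis: "?K1 \<inter> (?K2 \<union> ?K3) = {}" using assms by (auto simp: disjoint_rays_def)
  have "?K1 \<union> (?K2 \<union> ?K3) \<noteq> UNIV"
  proof
    assume "?K1 \<union> (?K2 \<union> ?K3) = UNIV"
    then have "?K1 = {} \<or> ?K2 \<union> ?K3 = {}"
      using connected_closedD[OF connected_UNIV, of ?K1 "?K2 \<union> ?K3"] cl dis by simp
    then show False by simp
  qed
  then obtain c where c: "c \<notin> ?K1 \<union> (?K2 \<union> ?K3)" by blast
  have "open (- (?K1 \<union> (?K2 \<union> ?K3)))" using closed_Un[OF cl] by (rule open_Compl)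
  then obtain e where e: "0 < e" "cball c e \<subseteq> - (?K1 \<union> (?K2 \<union> ?K3))"
    using c open_contains_cball by blast
  obtain \<sigma>1 where s1: "disjoint_rays \<sigma>1 \<rho>2" "disjoint_rays \<sigma>1 \<rho>3" "turn \<sigma>1 \<rho>2 \<rho>3 = turn \<rho>1 \<rho>2 \<rho>3"
    "\<sigma>1 0 \<in> sphere c e" "\<sigma>1 ` {0<..} \<inter> cball c e = {}" "c \<notin> \<sigma>1 ` {0..}"
    by (rule turn_extend_to_ball[OF assms e(1), of c]) (use e c in auto)
  obtain \<sigma>2 where s2: "disjoint_rays \<sigma>2 \<rho>3" "disjoint_rays \<sigma>2 \<sigma>1" "turn \<sigma>2 \<rho>3 \<sigma>1 = turn \<rho>2 \<rho>3 \<sigma>1"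
    "\<sigma>2 0 \<in> sphere c e" "\<sigma>2 ` {0<..} \<inter> cball c e = {}" "c \<notin> \<sigma>2 ` {0..}"
    by (rule turn_extend_to_ball[OF assms(3) s1(1)[THEN disjoint_rays_sym] s1(2)[THEN disjoint_rays_sym] e(1), of c])
      (use e c s1(6) in auto)
  obtain \<sigma>3 where s3: "disjoint_rays \<sigma>3 \<sigma>1" "disjoint_rays \<sigma>3 \<sigma>2" "turn \<sigma>3 \<sigma>1 \<sigma>2 = turn \<rho>3 \<sigma>1 \<sigma>2"
    "\<sigma>3 0 \<in> sphere c e" "\<sigma>3 ` {0<..} \<inter> cball c e = {}"
    by (rule turn_extend_to_ball[OF s1(2)[THEN disjoint_rays_sym] s2(1)[THEN disjoint_rays_sym] s2(2)[THEN disjoint_rays_sym] e(1), of c])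
      (use e c s1(6) s2(6) in auto)
  have "turn \<rho>1 \<rho>2 \<rho>3 = turn \<sigma>3 \<sigma>1 \<sigma>2"
    using s1(3) s2(3) s3(3) by (metis turn_rotate)
  moreover have sw: "\<bar>Im (sweep (\<sigma>3 0) (\<sigma>3 ` {0..}) (\<sigma>1 0) (\<sigma>2 0))\<bar> < pi"
    "\<bar>Im (sweep (\<sigma>1 0) (\<sigma>1 ` {0..}) (\<sigma>2 0) (\<sigma>3 0))\<bar> < pi"
    "\<bar>Im (sweep (\<sigma>2 0) (\<sigma>2 ` {0..}) (\<sigma>3 0) (\<sigma>1 0))\<bar> < pi"
    by (rule sweep_ball[OF _ _ _ _ _ disjoint_raysD(4)[OF _ order_refl] disjoint_raysD(4)[OF _ order_refl]];
        use s1(1,2,4,5) s2(1,2,4,5) s3(1,2,4,5) in \<open>blast dest: disjoint_raysD(1,2) disjoint_rays_sym\<close>)+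
  have "\<bar>Im (turn \<sigma>3 \<sigma>1 \<sigma>2)\<bar> < 3 * pi"
    unfolding turn_def plus_complex.sel using sw by linarith
  ultimately show ?thesis by simp
qed

section \<open>The degree of an injective self-map of the plane\<close>

text \<open>The vector \<open>f v - f u\<close> winds around the origin \<open>k\<close> times as often as \<open>v - u\<close>.\<close>

definition degree_with :: "(complex \<Rightarrow> complex) \<Rightarrow> int \<Rightarrow> (complex \<times> complex \<Rightarrow> complex) \<Rightarrow> bool" where
  "degree_with f k \<omega> \<longleftrightarrow> continuous_on {(u, v). u \<noteq> v} \<omega> \<and>
     (\<forall>u v. u \<noteq> v \<longrightarrow> f v - f u = (v - u) powi k * exp (\<omega> (u, v)))"

text \<open>\<open>Ln\<close> jumps across the negative axis. Near a pair with \<open>v - u\<close>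
  on that axis, \<open>Ln (u - v) + \<i> * pi\<close> is another logarithm of \<open>v - u\<close>
  and is continuous; by periodicity \<open>h\<close> does not see the difference.\<close>

lemma continuous_on_periodic_log:
  fixes h :: "complex \<times> complex \<Rightarrow> complex"
  assumes h: "continuous_on UNIV h" and per: "\<And>u z z'. exp z = exp z' \<Longrightarrow> h (u, z) = h (u, z')"
  shows "continuous_on {(u, v). u \<noteq> v} (\<lambda>(u, v). h (u, Ln (v - u)))"
proof -
  have "isCont (\<lambda>x. h (fst x, Ln (snd x - fst x))) x" if x: "fst x \<noteq> snd x" for x
  proof (cases "snd x - fst x \<in> \<real>\<^sub>\<le>\<^sub>0")
    case False
    then have "isCont (\<lambda>x. (fst x, Ln (snd x - fst x))) x"
      by (intro continuous_intros) auto
    then show ?thesis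
      using isCont_o2[of x "\<lambda>x. (fst x, Ln (snd x - fst x))" h] h
      by (simp add: continuous_on_eq_continuous_at)
  next
    case True
    then have "fst x - snd x \<notin> \<real>\<^sub>\<le>\<^sub>0"
      using x by (auto simp: complex_nonpos_Reals_iff complex_eq_iff)
    then have "isCont (\<lambda>x. (fst x, Ln (fst x - snd x) + \<i> * pi)) x"
      by (intro continuous_intros) auto
    then have c: "isCont (\<lambda>x. h (fst x, Ln (fst x - snd x) + \<i> * pi)) x"
      using isCont_o2[of x "\<lambda>x. (fst x, Ln (fst x - snd x) + \<i> * pi)" h] h
      by (simp add: continuous_on_eq_continuous_at)
    have "open {y::complex \<times> complex. fst y \<noteq> snd y}"
      by (intro open_Collect_neq continuous_intros)
    then have "\<forall>\<^sub>F y in nhds x. fst y \<noteq> snd y"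
      using x eventually_nhds[of "\<lambda>y. fst y \<noteq> snd y" x] by blast
    then have "\<forall>\<^sub>F y in nhds x. h (fst y, Ln (snd y - fst y)) = h (fst y, Ln (fst y - snd y) + \<i> * pi)"
      by eventually_elim (rule per, simp add: exp_add exp_pi_i')
    then show ?thesis using c by (simp add: isCont_cong)
  qed
  then have "continuous_on {x. fst x \<noteq> snd x} (\<lambda>x. h (fst x, Ln (snd x - fst x)))"
    by (intro continuous_at_imp_continuous_on) auto
  moreover have "{(u, v). u \<noteq> v} = {x::complex \<times> complex. fst x \<noteq> snd x}" by auto
  ultimately show ?thesis by (simp add: case_prod_unfold)
qed

lemma connected_distinct_pairs: "connected {(u::complex, v). u \<noteq> v}"
proof -
  have "{(u::complex, v). u \<noteq> v} = (\<lambda>x. (fst x, fst x + exp (snd x))) ` UNIV"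
  proof (intro equalityI subsetI)
    fix x :: "complex \<times> complex" assume "x \<in> {(u, v). u \<noteq> v}"
    then have "x = (\<lambda>x. (fst x, fst x + exp (snd x))) (fst x, Ln (snd x - fst x))" by auto
    then show "x \<in> (\<lambda>x. (fst x, fst x + exp (snd x))) ` UNIV" by blast
  qed auto
  then show ?thesis by (auto intro!: connected_continuous_image continuous_intros)
qed

text \<open>Pulled back along \<open>(u, z) \<mapsto> (u, u + exp z)\<close>, the vector
  \<open>f v - f u\<close> has a global logarithm \<open>l\<close>. Its increment when
  \<open>z\<close> grows by \<open>2 * pi * \<i>\<close> defines \<open>k\<close>, and
  \<open>l - k * z\<close> is periodic, hence descends to \<open>\<omega>\<close>. Exchanging
  \<open>u\<close> and \<open>v\<close> reverses the vector, which forces \<open>k\<close> to be odd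
  and \<open>\<omega>\<close> to be symmetric.\<close>

lemma degree_exists:
  fixes f :: "complex \<Rightarrow> complex"
  assumes f: "continuous_on UNIV f" "inj f"
  obtains k \<omega> where "degree_with f k \<omega>" "odd k" "\<And>u v. u \<noteq> v \<Longrightarrow> \<omega> (u, v) = \<omega> (v, u)"
proof -
  have "f (fst x + exp (snd x)) - f (fst x) \<noteq> 0" for x
    using f(2) by (auto dest!: injD)
  moreover have "continuous_on UNIV (\<lambda>x. f (fst x + exp (snd x)) - f (fst x))"
    by (intro continuous_intros continuous_on_compose2[OF f(1)]) auto
  moreover have "contractible (UNIV :: (complex \<times> complex) set)"
    by (intro convex_imp_contractible) auto
  ultimately obtain l where l: "continuous_on UNIV l"
    "\<And>x::complex \<times> complex. f (fst x + exp (snd x)) - f (fst x) = exp (l x)"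
    using continuous_logarithm_on_contractible[of UNIV "\<lambda>x. f (fst x + exp (snd x)) - f (fst x)"] by auto
  define D where "D x = l (fst x, snd x + of_real (2*pi) * \<i>) - l x" for x
  have cD: "continuous_on UNIV D" unfolding D_def
    by (intro continuous_intros continuous_on_compose2[OF l(1)]) auto
  have "exp (D x) = 1" for x
    unfolding D_def exp_diff l(2)[symmetric] using l(2)[of x] by (simp add: exp_add)
  then obtain a where a: "\<And>x. D x = a" "exp a = 1"
    using exp_const_imp_constant[OF connected_UNIV cD, of 1] by (metis UNIV_I)
  then obtain k :: int where k: "a = (of_int (2 * k) * pi) * \<i>"
    using exp_eq_1[of a] by (auto simp: complex_eq_iff)
  define h where "h x = l x - of_int k * snd x" for x
  have step: "h (u, z + of_real (2*pi) * \<i>) = h (u, z)" for u z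
    using a(1)[of "(u, z)"] k by (simp add: h_def D_def algebra_simps)
  have stepn: "h (u, z + of_nat n * (of_real (2*pi) * \<i>)) = h (u, z)" for u z n
  proof (induction n)
    case (Suc n)
    have "h (u, z + of_nat (Suc n) * (of_real (2*pi) * \<i>)) = h (u, (z + of_nat n * (of_real (2*pi) * \<i>)) + of_real (2*pi) * \<i>)"
      by (simp add: algebra_simps)
    then show ?case using step Suc by simp
  qed simp
  have per: "h (u, z) = h (u, z')" if zz': "exp z = exp z'" for u z z'
  proof -
    obtain n :: int where n: "z = z' + (of_int (2 * n) * pi) * \<i>"
      using zz' exp_eq[of z z'] by blast
    show ?thesis
    proof (cases "n \<ge> 0")
      case True
      then have "z = z' + of_nat (nat n) * (of_real (2*pi) * \<i>)" using n by (simp add: algebra_simps)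
      then show ?thesis using stepn by simp
    next
      case False
      then have "z' = z + of_nat (nat (- n)) * (of_real (2*pi) * \<i>)" using n by (simp add: algebra_simps)
      then show ?thesis using stepn by simp
    qed
  qed
  define \<omega> where "\<omega> = (\<lambda>(u, v). h (u, Ln (v - u)))"
  have "continuous_on UNIV h" unfolding h_def by (intro continuous_intros l(1))
  then have c\<omega>: "continuous_on {(u, v). u \<noteq> v} \<omega>"
    unfolding \<omega>_def using per by (rule continuous_on_periodic_log)
  have d: "f v - f u = (v - u) powi k * exp (\<omega> (u, v))" if "u \<noteq> v" for u v
  proof -
    have "(v - u) powi k = exp (of_int k * Ln (v - u))"
      using that by (simp add: exp_power_int[symmetric] mult.commute)
    then have "(v - u) powi k * exp (\<omega> (u, v)) = exp (l (u, Ln (v - u)))"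
      by (simp add: \<omega>_def h_def exp_diff)
    then show ?thesis using l(2)[of "(u, Ln (v - u))"] that by simp
  qed
  have sq: "exp (\<omega> (u, v) - \<omega> (v, u)) = - ((-1) powi k)" if "u \<noteq> v" for u v
  proof -
    have "f v - f u = - (f u - f v)" by simp
    then have "(v - u) powi k * exp (\<omega> (u, v)) = - ((u - v) powi k * exp (\<omega> (v, u)))"
      unfolding d[OF that] d[OF that[symmetric]] .
    moreover have "(u - v) powi k = (-1) powi k * (v - u) powi k"
      by (metis minus_diff_eq mult_minus1 power_int_mult_distrib)
    ultimately have eq: "(v - u) powi k * exp (\<omega> (u, v)) = (v - u) powi k * (- ((-1) powi k) * exp (\<omega> (v, u)))"
      by simp
    have "(v - u) powi k \<noteq> 0" using that by simp
    then have "exp (\<omega> (u, v)) = - ((-1) powi k) * exp (\<omega> (v, u))"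
      using eq mult_left_cancel by blast
    then show ?thesis by (simp add: exp_diff)
  qed
  \<comment> \<open>The antisymmetrised \<open>\<omega>\<close> is constant because its exponential
    is; exchanging the points changes its sign, so the constant is \<open>0\<close>.\<close>
  have "continuous_on {(u, v). u \<noteq> v} (\<lambda>x. \<omega> x - \<omega> (snd x, fst x))"
    by (intro continuous_intros c\<omega> continuous_on_compose2[OF c\<omega>]) auto
  then obtain b where b: "\<And>x. x \<in> {(u, v). u \<noteq> v} \<Longrightarrow> \<omega> x - \<omega> (snd x, fst x) = b"
    using exp_const_imp_constant[OF connected_distinct_pairs, of "\<lambda>x. \<omega> x - \<omega> (snd x, fst x)" "- ((-1) powi k)"] sq
    by force
  have bb: "\<omega> (0, 1) - \<omega> (1, 0) = b" "\<omega> (1, 0) - \<omega> (0, 1) = b"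
    using b[of "(0, 1)"] b[of "(1, 0)"] by simp_all
  have "2 * b = (\<omega> (0, 1) - \<omega> (1, 0)) + (\<omega> (1, 0) - \<omega> (0, 1))" unfolding bb by simp
  then have "b = 0" by simp
  then have sym: "\<omega> (u, v) = \<omega> (v, u)" if "u \<noteq> v" for u v
    using b[of "(u, v)"] that by simp
  have "(-1 :: complex) powi k = -1" using sq[of 0 1] sym[of 0 1] by (simp add: minus_equation_iff)
  then have "odd k" using power_int_minus_left_even[of k "1::complex"] by auto
  then show ?thesis using that[of k \<omega>] c\<omega> d sym by (auto simp: degree_with_def)
qed

lemma degree_withD:
  assumes "degree_with f k \<omega>" "u \<noteq> v"
  shows "f v - f u = (v - u) powi k * exp (\<omega> (u, v))"
  using assms by (auto simp: degree_with_def)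

lemma exp_of_int_mult: "exp (of_int k * z) = exp (z::complex) powi k"
  by (simp add: exp_power_int mult.commute)

text \<open>Along the circle \<open>T v - T u\<close> stays within a right angle of
  \<open>v - u\<close>, so both turn once. The vector \<open>f' v - f' u\<close> then turns
  \<open>k'\<close> times by its own degree, and \<open>k\<close> times when read through
  \<open>f\<close>.\<close>

lemma degree_local:
  assumes "degree_with f k \<omega>" "degree_with f' k' \<omega>'" "r > 0"
    and T: "continuous_on (cball u r) T" "\<And>v. v \<in> cball u r \<Longrightarrow> f' v = f (T v)"
    and pos: "\<And>v. v \<in> sphere u r \<Longrightarrow> 0 < Re ((T v - T u) / (v - u))"
  shows "k' = k"
proof -
  define e where "e s = u + of_real r * exp (\<i> * of_real s)" for s :: real
  have es: "e s \<in> sphere u r" "e s - u = of_real r * exp (\<i> * of_real s)" "e s \<noteq> u" for s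
    using assms(3) by (auto simp: e_def dist_norm norm_mult)
  have es': "e s \<in> cball u r" for s using es(1) by (simp add: less_eq_real_def)
  have ce: "continuous_on UNIV e" unfolding e_def by (intro continuous_intros)
  define q where "q s = (T (e s) - T u) / (e s - u)" for s
  have q: "q s \<notin> \<real>\<^sub>\<le>\<^sub>0" "q s \<noteq> 0" for s
    using pos[OF es(1)[of s]] by (auto simp: q_def complex_nonpos_Reals_iff)
  then have Tu: "T (e s) \<noteq> T u" for s by (auto simp: q_def)
  have cT: "continuous_on UNIV (\<lambda>s. T (e s))"
    by (rule continuous_on_compose2[OF T(1) ce]) (use es' in auto)
  have cq: "continuous_on UNIV (\<lambda>s. Ln (q s))" unfolding q_def
    using q es by (intro continuous_intros cT ce) (auto simp: q_def)
  \<comment> \<open>The difference of two logarithms of one vector, written once through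
    \<open>f'\<close> and once through \<open>f\<close>. \<open>Ln (q s)\<close> is continuous
    because \<open>q s\<close> stays in the right half plane.\<close>
  define A where "A s = of_int k' * (\<i> * of_real s + of_real (ln r)) + \<omega>' (u, e s)
     - (of_int k * (\<i> * of_real s + of_real (ln r) + Ln (q s)) + \<omega> (T u, T (e s)))" for s :: real
  have c1: "continuous_on UNIV (\<lambda>s. \<omega>' (u, e s))"
    by (rule continuous_on_compose2[of "{(u, v). u \<noteq> v}" \<omega>'])
       (use assms(2) es(3) in \<open>auto simp: degree_with_def eq_commute[of u] intro!: continuous_intros ce\<close>)
  have c2: "continuous_on UNIV (\<lambda>s. \<omega> (T u, T (e s)))"
    by (rule continuous_on_compose2[of "{(u, v). u \<noteq> v}" \<omega>])
       (use assms(1) Tu in \<open>auto simp: degree_with_def eq_commute[of "T u"] intro!: continuous_intros cT\<close>)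
  have cA: "continuous_on UNIV A" unfolding A_def by (intro continuous_intros c1 c2 cq)
  have "exp (A s) = 1" for s
  proof -
    have r: "exp (\<i> * of_real s + of_real (ln r)) = e s - u"
      using assms(3) by (simp add: es(2) exp_add exp_of_real)
    have "exp (of_int k' * (\<i> * of_real s + of_real (ln r)) + \<omega>' (u, e s)) = f' (e s) - f' u"
      using degree_withD[OF assms(2) es(3)[symmetric]] by (simp add: exp_add[of "of_int k' * _"] exp_of_int_mult r)
    moreover have "exp (\<i> * of_real s + of_real (ln r) + Ln (q s)) = T (e s) - T u"
      using q(2)[of s] es(3)[of s] by (simp add: exp_add[of _ "Ln (q s)"] r) (simp add: q_def)
    then have "exp (of_int k * (\<i> * of_real s + of_real (ln r) + Ln (q s)) + \<omega> (T u, T (e s))) = f (T (e s)) - f (T u)"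
      using degree_withD[OF assms(1) Tu[symmetric]] by (simp add: exp_add[of "of_int k * _"] exp_of_int_mult)
    moreover have "f' (e s) - f' u = f (T (e s)) - f (T u)" using T(2) es' assms(3) by simp
    moreover have "f' (e s) - f' u \<noteq> 0"
      using degree_withD[OF assms(2) es(3)[symmetric]] es(3) by simp
    ultimately show ?thesis unfolding A_def by (simp add: exp_diff)
  qed
  then obtain a where "\<And>s. A s = a"
    using exp_const_imp_constant[OF connected_UNIV cA, of 1] by auto
  \<comment> \<open>After one circuit every term returns to its value except those linear in
    \<open>s\<close>, which leaves \<open>k'\<close> against \<open>k\<close>.\<close>
  then have "A (2*pi) = A 0" by simp
  moreover have "e (2*pi) = e 0" by (simp add: e_def exp_two_pi_i mult.commute[of \<i>])
  ultimately have "of_int k' * (\<i> * of_real (2*pi)) = of_int k * (\<i> * of_real (2*pi))"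
    by (simp add: A_def q_def algebra_simps)
  then show ?thesis by simp
qed

lemma degree_compose:
  assumes "degree_with f k \<omega>" "degree_with g l \<eta>" "continuous_on UNIV g" "inj g"
  obtains \<zeta> where "degree_with (f \<circ> g) (k * l) \<zeta>"
proof -
  define \<zeta> where "\<zeta> = (\<lambda>(u, v). of_int k * \<eta> (u, v) + \<omega> (g u, g v))"
  have c: "continuous_on {(u, v). u \<noteq> v} (\<lambda>x. \<omega> (g (fst x), g (snd x)))"
    by (rule continuous_on_compose2[of "{(u, v). u \<noteq> v}" \<omega>])
       (use assms in \<open>auto simp: degree_with_def inj_eq intro!: continuous_intros continuous_on_compose2[OF assms(3)]\<close>)
  have "continuous_on {(u, v). u \<noteq> v} (\<lambda>x. of_int k * \<eta> x + \<omega> (g (fst x), g (snd x)))"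
    using assms(2) c by (intro continuous_intros) (auto simp: degree_with_def)
  then have "continuous_on {(u, v). u \<noteq> v} \<zeta>" by (simp add: \<zeta>_def case_prod_unfold)
  moreover have "f (g v) - f (g u) = (v - u) powi (k * l) * exp (\<zeta> (u, v))" if "u \<noteq> v" for u v
  proof -
    have "f (g v) - f (g u) = (g v - g u) powi k * exp (\<omega> (g u, g v))"
      using that assms(4) by (intro degree_withD[OF assms(1)]) (simp add: inj_eq)
    also have "g v - g u = (v - u) powi l * exp (\<eta> (u, v))" by (rule degree_withD[OF assms(2) that])
    finally show ?thesis
      by (simp add: \<zeta>_def power_int_mult_distrib power_int_mult[symmetric] mult.commute[of k] exp_add exp_of_int_mult)
  qed
  ultimately show ?thesis using that by (auto simp: degree_with_def)
qed

section \<open>Gluing local sections\<close>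

text \<open>A trivialisation on \<open>S\<close> of the cocycle of differences
  \<open>f x - f y\<close>; comparing with the value at \<open>x\<close> avoids naming the local
  constants.\<close>

definition glued :: "(complex \<Rightarrow> complex \<Rightarrow> 'b::ab_group_add) \<Rightarrow> complex set \<Rightarrow> (complex \<Rightarrow> 'b) \<Rightarrow> bool" where
  "glued f S F \<longleftrightarrow> (\<forall>x\<in>S. \<forall>\<^sub>F z in nhds x. z \<in> S \<longrightarrow> F z - f x z = F x - f x x)"

lemma gluedD: "glued f S F \<Longrightarrow> x \<in> S \<Longrightarrow> \<forall>\<^sub>F z in nhds x. z \<in> S \<longrightarrow> F z - f x z = F x - f x x"
  by (auto simp: glued_def)

lemma glued_diff_const:
  assumes "glued f S F" "glued f T G" "connected U" "U \<subseteq> S \<inter> T" "x \<in> U" "y \<in> U"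
  shows "F x - G x = F y - G y"
proof (rule locally_constant_imp_constant[OF assms(3) _ assms(5,6)])
  fix a assume a: "a \<in> U"
  have e: "\<forall>\<^sub>F z in nhds a. z \<in> S \<longrightarrow> F z - f a z = F a - f a a"
    "\<forall>\<^sub>F z in nhds a. z \<in> T \<longrightarrow> G z - f a z = G a - f a a"
    using assms(1,2,4) a by (auto simp: glued_def)
  show "\<forall>\<^sub>F z in nhds a. z \<in> U \<longrightarrow> F z - G z = F a - G a"
    using e
  proof eventually_elim
    case (elim z)
    show ?case
    proof
      assume "z \<in> U"
      then have "F z - f a z = F a - f a a" "G z - f a z = G a - f a a"
        using elim assms(4) by auto
      then have "(F z - f a z) - (G z - f a z) = (F a - f a a) - (G a - f a a)" by simp
      then show "F z - G z = F a - G a" by (simp add: algebra_simps)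
    qed
  qed
qed

text \<open>A Mayer-Vietoris step: on the connected overlap the two solutions differ by one
  constant, which is absorbed into \<open>G\<close>. Closedness allows either set to be ignored near
  a point outside it.\<close>

lemma glued_Un:
  assumes "glued f S F" "glued f T G" "closed S" "closed T" "connected (S \<inter> T)"
  shows "\<exists>H. glued f (S \<union> T) H"
proof -
  have "\<exists>c. \<forall>x\<in>S \<inter> T. F x - G x = c"
    using glued_diff_const[OF assms(1,2,5) order_refl] by (cases "S \<inter> T = {}") blast+
  then obtain c where c: "\<And>x. x \<in> S \<Longrightarrow> x \<in> T \<Longrightarrow> F x - G x = c" by blast
  define H where "H z = (if z \<in> S then F z else G z + c)" for z
  have HT: "H z = G z + c" if "z \<in> T" for z
    using c[of z] that by (auto simp: H_def algebra_simps)
  have HS: "\<forall>\<^sub>F z in nhds x. z \<in> S \<longrightarrow> H z - f x z = H x - f x x" if "x \<in> S \<union> T" for x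
  proof (cases "x \<in> S")
    case True
    show ?thesis using gluedD[OF assms(1) True] by eventually_elim (simp add: H_def True)
  next
    case False
    then have "\<forall>\<^sub>F z in nhds x. z \<in> - S" using assms(3) by (intro eventually_nhds_in_open) auto
    then show ?thesis by eventually_elim simp
  qed
  have HT': "\<forall>\<^sub>F z in nhds x. z \<in> T \<longrightarrow> H z - f x z = H x - f x x" if "x \<in> S \<union> T" for x
  proof (cases "x \<in> T")
    case True
    show ?thesis using gluedD[OF assms(2) True]
    proof eventually_elim
      case (elim z)
      show ?case
      proof
        assume z: "z \<in> T"
        then have "G z - f x z + c = G x - f x x + c" using elim by simp
        then show "H z - f x z = H x - f x x" using HT True z by (simp add: algebra_simps)
      qed
    qed
  next
    case False
    then have "\<forall>\<^sub>F z in nhds x. z \<in> - T" using assms(4) by (intro eventually_nhds_in_open) auto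
    then show ?thesis by eventually_elim simp
  qed
  have "\<forall>\<^sub>F z in nhds x. z \<in> S \<union> T \<longrightarrow> H z - f x z = H x - f x x" if "x \<in> S \<union> T" for x
    using HS[OF that] HT'[OF that] by eventually_elim blast
  then show ?thesis unfolding glued_def by blast
qed

definition rect :: "real \<Rightarrow> real \<Rightarrow> real \<Rightarrow> real \<Rightarrow> complex set" where
  "rect a b c d = {z. Re z \<in> {a..b} \<and> Im z \<in> {c..d}}"

lemma rect_convex: "convex (rect a b c d)"
proof -
  have "rect a b c d = Re -` {a..b} \<inter> Im -` {c..d}" by (auto simp: rect_def)
  then show ?thesis
    by (auto intro!: convex_Int convex_linear_vimage bounded_linear.linear bounded_linear_Re bounded_linear_Im)
qed

lemma rect_closed: "closed (rect a b c d)"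
proof -
  have "rect a b c d = Re -` {a..b} \<inter> Im -` {c..d}" by (auto simp: rect_def)
  then show ?thesis by (auto intro!: closed_Int closed_vimage continuous_intros)
qed

text \<open>The vanishing of the first cohomology of the plane with constant coefficients: \<open>f x\<close> is a section
  near \<open>x\<close>, and sections count as equal when they differ by a locally constant function.\<close>

lemma local_sections_glue:
  fixes f :: "complex \<Rightarrow> complex \<Rightarrow> 'b::ab_group_add"
  assumes loc: "\<And>x. \<exists>d>0. \<forall>y\<in>ball x d. \<forall>\<^sub>F z in nhds y. f x z - f y z = f x y - f y y"
  obtains F where "\<And>x. \<forall>\<^sub>F z in nhds x. F z - f x z = F x - f x x"
proof -
  define P where "P a b c d \<longleftrightarrow> (\<exists>F. glued f (rect a b c d) F)" for a b c d
  have P1: "P a b' c d" if PP: "P a b c d" "P b b' c d" and "a \<le> b" "b \<le> b'" for a b b' c d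
  proof -
    have "rect a b' c d = rect a b c d \<union> rect b b' c d" "rect a b c d \<inter> rect b b' c d = rect b b c d"
      using that(3,4) by (auto simp: rect_def)
    moreover obtain F G where FG: "glued f (rect a b c d) F" "glued f (rect b b' c d) G"
      using PP by (auto simp: P_def)
    ultimately show ?thesis
      using glued_Un[OF FG rect_closed rect_closed] convex_connected[OF rect_convex] by (simp add: P_def)
  qed
  have P2: "P a b c d'" if PP: "P a b c d" "P a b d d'" and "c \<le> d" "d \<le> d'" for a b c d d'
  proof -
    have "rect a b c d' = rect a b c d \<union> rect a b d d'" "rect a b c d \<inter> rect a b d d' = rect a b d d"
      using that(3,4) by (auto simp: rect_def)
    moreover obtain F G where FG: "glued f (rect a b c d) F" "glued f (rect a b d d') G"
      using PP by (auto simp: P_def)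
    ultimately show ?thesis
      using glued_Un[OF FG rect_closed rect_closed] convex_connected[OF rect_convex] by (simp add: P_def)
  qed
  \<comment> \<open>The bisection is done in two directions: horizontally for all sufficiently thin
    strips around a height \<open>y\<close>, and afterwards vertically. The admissible thickness
    \<open>e\<close> may shrink with each horizontal gluing, hence the minimum.\<close>
  have strip: "\<exists>e>0. \<forall>c d. c \<le> y \<and> y \<le> d \<and> d - c < e \<longrightarrow> P a b c d" if "a \<le> b" for a b y
    using that
  proof (induction rule: Bolzano)
    case (trans a b c)
    then obtain e e' where e: "e > 0" "e' > 0" "\<And>u v. u \<le> y \<Longrightarrow> y \<le> v \<Longrightarrow> v - u < e \<Longrightarrow> P a b u v"
      "\<And>u v. u \<le> y \<Longrightarrow> y \<le> v \<Longrightarrow> v - u < e' \<Longrightarrow> P b c u v" by blast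
    have "P a c u v" if "u \<le> y" "y \<le> v" "v - u < min e e'" for u v
      using that by (intro P1[OF e(3)[of u v] e(4)[of u v] trans(3,4)]) auto
    then show ?case using e(1,2) by (intro exI[of _ "min e e'"]) auto
  next
    case (local x)
    obtain d where d: "d > 0" "\<And>w. w \<in> ball (Complex x y) d \<Longrightarrow>
        \<forall>\<^sub>F z in nhds w. f (Complex x y) z - f w z = f (Complex x y) w - f w w"
      using loc by blast
    have "P a b u v" if ab: "a \<le> x" "x \<le> b" "b - a < d/2" "u \<le> y" "y \<le> v" "v - u < d/2" for a b u v
    proof -
      have "rect a b u v \<subseteq> ball (Complex x y) d"
      proof
        fix z assume "z \<in> rect a b u v"
        then have "a \<le> Re z" "Re z \<le> b" "u \<le> Im z" "Im z \<le> v" by (auto simp: rect_def)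
        then have "\<bar>Re z - x\<bar> < d/2" "\<bar>Im z - y\<bar> < d/2" using ab by linarith+
        then have "cmod (z - Complex x y) < d"
          using cmod_le[of "z - Complex x y"] by simp
        then show "z \<in> ball (Complex x y) d" by (simp add: dist_norm norm_minus_commute)
      qed
      then show ?thesis unfolding P_def glued_def
        by (intro exI[of _ "f (Complex x y)"] ballI eventually_mono[OF d(2)]) auto
    qed
    then have "\<forall>a b. a \<le> x \<and> x \<le> b \<and> b - a < d/2 \<longrightarrow> (\<exists>e>0. \<forall>c d. c \<le> y \<and> y \<le> d \<and> d - c < e \<longrightarrow> P a b c d)"
      using d(1) by (metis half_gt_zero)
    then show ?case using d(1) by (meson half_gt_zero)
  qed
  have all: "P a b c d" if "a \<le> b" "c \<le> d" for a b c d
    using that(2)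
  proof (induction rule: Bolzano)
    case (local y)
    then show ?case using strip[OF that(1), of y] by blast
  qed (use P2 in blast)
  define R where "R n = rect (- real n) n (- real n) n" for n :: nat
  have "\<exists>F. glued f (R n) F" for n using all[of "- real n" n "- real n" n] by (auto simp: P_def R_def)
  then obtain F where F: "\<And>n. glued f (R n) (F n)" by metis
  \<comment> \<open>Solutions on nested squares differ by constants; normalised to vanish at
    \<open>0\<close> they are restrictions of each other.\<close>
  define G where "G n z = F n z - F n 0" for n z
  have R0: "0 \<in> R n" for n by (simp add: R_def rect_def)
  have Rmono: "R m \<subseteq> R n" if "m \<le> n" for m n using that by (auto simp: R_def rect_def)
  have GG: "G m z = G n z" if "m \<le> n" "z \<in> R m" for m n z
  proof -
    have "connected (R m)" unfolding R_def by (rule convex_connected[OF rect_convex])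
    then have "F m z - F n z = F m 0 - F n 0"
      using Rmono[OF that(1)] that(2) R0 by (intro glued_diff_const[OF F F]) auto
    then show ?thesis by (simp add: G_def algebra_simps)
  qed
  define N where "N z = nat \<lceil>cmod z\<rceil> + 1" for z :: complex
  have RN: "z \<in> R n" if "cmod z \<le> real n" for z n
    using that abs_Re_le_cmod[of z] abs_Im_le_cmod[of z] by (auto simp: R_def rect_def abs_le_iff)
  have N: "cmod z + 1 \<le> real (N z)" for z unfolding N_def by linarith
  define H where "H z = G (N z) z" for z
  have H: "H z = G n z" if "N z \<le> n" for z n
    using GG[OF that RN] N[of z] by (simp add: H_def)
  have "\<forall>\<^sub>F z in nhds x. H z - f x z = H x - f x x" for x
  proof -
    have "\<forall>\<^sub>F z in nhds x. z \<in> ball x 1" by (intro eventually_nhds_in_open) auto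
    moreover have "x \<in> R (N x + 1)" using N[of x] by (intro RN) simp
    then have "\<forall>\<^sub>F z in nhds x. z \<in> R (N x + 1) \<longrightarrow> F (N x + 1) z - f x z = F (N x + 1) x - f x x"
      using F gluedD by blast
    ultimately show ?thesis
    proof eventually_elim
      case (elim z)
      have z: "cmod z < cmod x + 1"
        using elim(1) norm_triangle_sub[of z x] by (simp add: dist_norm norm_minus_commute)
      then have "N z \<le> N x + 1" unfolding N_def by linarith
      then have "H z = G (N x + 1) z" "H x = G (N x + 1) x" by (auto intro: H)
      moreover have "z \<in> R (N x + 1)" using N[of x] z by (intro RN) linarith
      then have "F (N x + 1) z - f x z = F (N x + 1) x - f x x" using elim(2) by blast
      moreover have "G (N x + 1) w - f x w = (F (N x + 1) w - f x w) - F (N x + 1) 0" for w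
        by (simp add: G_def diff_diff_eq add.commute)
      ultimately show ?case by simp
    qed
  qed
  then show ?thesis using that by blast
qed

section \<open>Oriented leaves, charts and branches of the logarithm\<close>

definition hseg :: "(complex \<Rightarrow> 'a) \<Rightarrow> real \<Rightarrow> real \<Rightarrow> real \<Rightarrow> 'a set" where
  "hseg \<psi> a a' b = (\<lambda>u. \<psi> (Complex u b)) ` {a..a'}"

text \<open>Disjointness of leaves and consistency of their orientation are both contained in
  \<open>leaf_reparam\<close>: parametrizations sharing a point differ by an increasing change of
  parameter. Properness concerns the positive end, towards which the half leaves serving as cuts
  run.\<close>

locale oriented_leaves =
  fixes \<Gamma> :: "(real \<Rightarrow> complex) set"
  assumes leaf_continuous: "\<gamma> \<in> \<Gamma> \<Longrightarrow> continuous_on UNIV \<gamma>"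
    and leaf_inj: "\<gamma> \<in> \<Gamma> \<Longrightarrow> inj \<gamma>"
    and leaf_proper: "\<gamma> \<in> \<Gamma> \<Longrightarrow> filterlim \<gamma> at_infinity at_top"
    and leaf_exists: "\<exists>\<gamma>\<in>\<Gamma>. p \<in> range \<gamma>"
    and leaf_reparam: "\<gamma> \<in> \<Gamma> \<Longrightarrow> \<delta> \<in> \<Gamma> \<Longrightarrow> \<gamma> s = \<delta> t \<Longrightarrow> \<exists>h. strict_mono h \<and> surj h \<and> \<delta> = \<gamma> \<circ> h"
begin

text \<open>Leaves and horizontal lines are compared on compact arcs, in both directions and with
  their orientation. Nothing is claimed about a leaf across an interval on which it is outside the
  range.\<close>

definition chart :: "(complex \<Rightarrow> complex) \<Rightarrow> bool" where
  "chart \<psi> \<longleftrightarrow> continuous_on UNIV \<psi> \<and> inj \<psi> \<and>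
     (\<forall>a a' b. a < a' \<longrightarrow> (\<exists>\<gamma>\<in>\<Gamma>. \<exists>s t. s < t \<and> \<gamma> s = \<psi> (Complex a b) \<and> \<gamma> t = \<psi> (Complex a' b) \<and>
        \<gamma> ` {s..t} = hseg \<psi> a a' b)) \<and>
     (\<forall>\<gamma>\<in>\<Gamma>. \<forall>s t. s < t \<and> \<gamma> ` {s..t} \<subseteq> range \<psi> \<longrightarrow>
        (\<exists>a a' b. a < a' \<and> \<gamma> s = \<psi> (Complex a b) \<and> \<gamma> t = \<psi> (Complex a' b)))"

definition before :: "complex \<Rightarrow> complex \<Rightarrow> bool" where
  "before p q \<longleftrightarrow> (\<exists>\<gamma>\<in>\<Gamma>. \<exists>s t. s < t \<and> \<gamma> s = p \<and> \<gamma> t = q)"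

definition same_leaf :: "complex \<Rightarrow> complex \<Rightarrow> bool" where
  "same_leaf p q \<longleftrightarrow> (\<exists>\<gamma>\<in>\<Gamma>. p \<in> range \<gamma> \<and> q \<in> range \<gamma>)"

definition half_leaf :: "complex \<Rightarrow> complex set" where
  "half_leaf p = {q. q = p \<or> before p q}"

lemma leaf_obtain:
  obtains \<gamma> s where "\<gamma> \<in> \<Gamma>" "\<gamma> s = p"
  using leaf_exists[of p] by auto

lemma before_iff [simp]:
  assumes "\<gamma> \<in> \<Gamma>"
  shows "before (\<gamma> s) (\<gamma> t) \<longleftrightarrow> s < t"
proof
  assume "before (\<gamma> s) (\<gamma> t)"
  then obtain \<delta> u v where \<delta>: "\<delta> \<in> \<Gamma>" "u < v" "\<delta> u = \<gamma> s" "\<delta> v = \<gamma> t" by (auto simp: before_def)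
  then obtain h where h: "strict_mono h" "\<delta> = \<gamma> \<circ> h" using leaf_reparam[OF assms \<delta>(1)] by metis
  then have "h u = s" "h v = t" using \<delta>(3,4) leaf_inj[OF assms] by (auto dest: injD)
  then show "s < t" using h(1) \<delta>(2) by (auto simp: strict_mono_def)
next
  assume "s < t"
  then show "before (\<gamma> s) (\<gamma> t)" using assms by (auto simp: before_def)
qed

lemma same_leaf_range:
  assumes "\<gamma> \<in> \<Gamma>"
  shows "same_leaf (\<gamma> s) q \<longleftrightarrow> q \<in> range \<gamma>"
proof
  assume "same_leaf (\<gamma> s) q"
  then obtain \<delta> u v where \<delta>: "\<delta> \<in> \<Gamma>" "\<delta> u = \<gamma> s" "\<delta> v = q" by (auto simp: same_leaf_def)
  then obtain h where "\<delta> = \<gamma> \<circ> h" using leaf_reparam[OF assms \<delta>(1)] by metis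
  then show "q \<in> range \<gamma>" using \<delta> by auto
qed (use assms in \<open>auto simp: same_leaf_def\<close>)

lemma same_leaf_refl: "same_leaf p p"
  using leaf_exists by (auto simp: same_leaf_def)

lemma same_leaf_sym: "same_leaf p q \<Longrightarrow> same_leaf q p"
  by (auto simp: same_leaf_def)

lemma same_leaf_trans:
  assumes "same_leaf p q" "same_leaf q r"
  shows "same_leaf p r"
proof -
  obtain \<gamma> s t where g: "\<gamma> \<in> \<Gamma>" "\<gamma> s = p" "\<gamma> t = q" using assms(1) by (auto simp: same_leaf_def)
  then have "r \<in> range \<gamma>" using assms(2) same_leaf_range by metis
  then show ?thesis using g by (auto simp: same_leaf_def)
qed

lemma before_same_leaf: "before p q \<Longrightarrow> same_leaf p q"
  by (auto simp: before_def same_leaf_def)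

lemma half_leaf_same_leaf: "q \<in> half_leaf p \<Longrightarrow> same_leaf p q"
  using before_same_leaf same_leaf_refl by (auto simp: half_leaf_def)

lemma half_leaf_eq:
  assumes "\<gamma> \<in> \<Gamma>"
  shows "half_leaf (\<gamma> s) = \<gamma> ` {s..}"
proof (intro equalityI subsetI)
  fix q assume q: "q \<in> half_leaf (\<gamma> s)"
  then have "q \<in> range \<gamma>" using half_leaf_same_leaf same_leaf_range[OF assms] by blast
  then obtain t where "q = \<gamma> t" by auto
  with q show "q \<in> \<gamma> ` {s..}"
    using assms leaf_inj[OF assms] by (auto simp: half_leaf_def inj_eq)
next
  fix q assume "q \<in> \<gamma> ` {s..}"
  then show "q \<in> half_leaf (\<gamma> s)" using assms by (auto simp: half_leaf_def)
qed

lemma leaf_ray: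
  assumes "\<gamma> \<in> \<Gamma>"
  shows "ray (\<lambda>u. \<gamma> (u + s))"
proof -
  have l: "filterlim (\<lambda>u. u + s) at_top at_top" by real_asymp
  have "continuous_on {0..} (\<lambda>u. \<gamma> (u + s))"
    by (rule continuous_on_compose2[OF leaf_continuous[OF assms]]) (auto intro!: continuous_intros)
  moreover have "inj_on (\<lambda>u. \<gamma> (u + s)) {0..}"
  proof (rule inj_onI)
    fix u v assume "\<gamma> (u + s) = \<gamma> (v + s)"
    then have "u + s = v + s" by (rule injD[OF leaf_inj[OF assms]])
    then show "u = v" by simp
  qed
  ultimately show ?thesis
    using filterlim_compose[OF leaf_proper[OF assms] l] by (simp add: ray_def)
qed

lemma half_leaf_ray:
  obtains \<rho> where "ray \<rho>" "\<rho> 0 = p" "\<rho> ` {0..} = half_leaf p"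
proof -
  obtain \<gamma> s where g: "\<gamma> \<in> \<Gamma>" "\<gamma> s = p" by (rule leaf_obtain)
  have "(\<lambda>u. \<gamma> (u + s)) ` {0..} = half_leaf p"
    using image_ray_shift[of \<gamma> s] half_leaf_eq[OF g(1), of s] g(2) by simp
  then show ?thesis using that[OF leaf_ray[OF g(1), of s]] g(2) by simp
qed

lemma connected_compl_half_leaf: "connected (- half_leaf p)"
  and half_leaf_branch: "\<exists>L. branch p (half_leaf p) L"
proof -
  obtain \<rho> where r: "ray \<rho>" "\<rho> 0 = p" "\<rho> ` {0..} = half_leaf p" by (rule half_leaf_ray)
  show "connected (- half_leaf p)" "\<exists>L. branch p (half_leaf p) L"
    using connected_compl_ray0[OF r(1)] branch_exists[OF r(1), of 0] r(2,3) by simp_all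
qed

lemma self_in_half_leaf [simp]: "p \<in> half_leaf p"
  by (simp add: half_leaf_def)

lemma chart_continuous: "chart \<psi> \<Longrightarrow> continuous_on UNIV \<psi>"
  and chart_inj: "chart \<psi> \<Longrightarrow> inj \<psi>"
  by (auto simp: chart_def)

lemma chart_range_open: "chart \<psi> \<Longrightarrow> open (range \<psi>)"
  by (intro invariance_of_domain) (auto simp: chart_def)

lemma chart_inv_continuous:
  assumes "chart \<psi>" shows "continuous_on (range \<psi>) (inv_into UNIV \<psi>)"
proof -
  obtain g where g: "homeomorphism UNIV (range \<psi>) \<psi> g"
    using invariance_of_domain_homeomorphism[of UNIV \<psi>] assms by (auto simp: chart_def)
  have "g y = inv_into UNIV \<psi> y" if "y \<in> range \<psi>" for y
    using g that chart_inj[OF assms] by (auto simp: homeomorphism_def inv_f_f)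
  then show ?thesis using g by (auto simp: homeomorphism_def cong: continuous_on_cong)
qed

lemma chart_hseg:
  assumes "chart \<psi>" "a < a'"
  obtains \<gamma> s t where "\<gamma> \<in> \<Gamma>" "s < t" "\<gamma> s = \<psi> (Complex a b)" "\<gamma> t = \<psi> (Complex a' b)" "\<gamma> ` {s..t} = hseg \<psi> a a' b"
  using assms unfolding chart_def by metis

lemma chart_leaf_arc:
  assumes "chart \<psi>" "\<gamma> \<in> \<Gamma>" "s < t" "\<gamma> ` {s..t} \<subseteq> range \<psi>"
  obtains a a' b where "a < a'" "\<gamma> s = \<psi> (Complex a b)" "\<gamma> t = \<psi> (Complex a' b)"
  using assms unfolding chart_def by metis

lemma chart_transition:
  assumes "chart \<psi>" "chart \<psi>'" "a < a'" "hseg \<psi>' a a' b \<subseteq> range \<psi>"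
  obtains c c' d where "c < c'" "\<psi>' (Complex a b) = \<psi> (Complex c d)" "\<psi>' (Complex a' b) = \<psi> (Complex c' d)"
proof -
  obtain \<gamma> s t where "\<gamma> \<in> \<Gamma>" "s < t" "\<gamma> s = \<psi>' (Complex a b)" "\<gamma> t = \<psi>' (Complex a' b)" "\<gamma> ` {s..t} = hseg \<psi>' a a' b"
    using assms(2,3) unfolding chart_def by blast
  moreover from this obtain c c' d where "c < c'" "\<gamma> s = \<psi> (Complex c d)" "\<gamma> t = \<psi> (Complex c' d)"
    using assms(1,4) unfolding chart_def by metis
  ultimately show ?thesis using that by metis
qed

lemma chart_before:
  assumes "chart \<psi>" "a < a'"
  shows "before (\<psi> (Complex a b)) (\<psi> (Complex a' b))"
  using assms unfolding chart_def before_def by metis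

lemma before_not_half_leaf: "before q p \<Longrightarrow> q \<notin> half_leaf p"
proof
  assume b: "before q p" and q: "q \<in> half_leaf p"
  obtain \<gamma> s where g: "\<gamma> \<in> \<Gamma>" "\<gamma> s = p" by (rule leaf_obtain)
  then have "q \<in> \<gamma> ` {s..}" using q half_leaf_eq by blast
  then obtain t where "t \<ge> s" "q = \<gamma> t" by auto
  then show False using b g before_iff[OF g(1), of t s] by auto
qed

end

text \<open>The second component is the abscissa of a companion point strictly behind
  \<open>z\<close> at the same height. The set is a half space, hence convex, so continuous
  nonvanishing functions on it have logarithms.\<close>

definition leftward :: "(complex \<times> real) set" where
  "leftward = {(z, a). a < Re z}"

definition left_point :: "complex \<times> real \<Rightarrow> complex" where
  "left_point x = Complex (snd x) (Im (fst x))"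

lemma convex_leftward: "convex leftward"
proof -
  have eq: "leftward = {x. inner (1::complex, -1::real) x > 0}"
    by (auto simp: leftward_def inner_complex_def)
  show ?thesis unfolding eq by (rule convex_halfspace_gt)
qed

lemma continuous_left_point [continuous_intros]: "continuous_on S left_point"
  unfolding left_point_def Complex_eq by (intro continuous_intros)

context oriented_leaves
begin

definition branches :: "(complex \<Rightarrow> complex \<Rightarrow> complex) \<Rightarrow> bool" where
  "branches \<alpha> \<longleftrightarrow> (\<forall>p. branch p (half_leaf p) (\<alpha> p))"

text \<open>Base point and cut move together here, but the point of evaluation is behind the base
  point on the same leaf, so the moving cut never reaches it.\<close>

definition tame :: "(complex \<Rightarrow> complex \<Rightarrow> complex) \<Rightarrow> (complex \<Rightarrow> complex) \<Rightarrow> bool" where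
  "tame \<alpha> \<psi> \<longleftrightarrow> continuous_on leftward (\<lambda>x. \<alpha> (\<psi> (fst x)) (\<psi> (left_point x)))"

lemma branchesD:
  assumes "branches \<alpha>"
  shows "continuous_on (- half_leaf p) (\<alpha> p)" "y \<notin> half_leaf p \<Longrightarrow> exp (\<alpha> p y) = y - p"
  using assms by (auto simp: branches_def branch_def)

lemma left_point_not_half_leaf:
  assumes "chart \<psi>" "x \<in> leftward"
  shows "\<psi> (left_point x) \<notin> half_leaf (\<psi> (fst x))"
proof -
  have "fst x = Complex (Re (fst x)) (Im (fst x))" by simp
  moreover have "snd x < Re (fst x)" using assms(2) by (auto simp: leftward_def)
  ultimately show ?thesis
    using chart_before[OF assms(1)] before_not_half_leaf unfolding left_point_def by metis
qed

lemma chart_log: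
  assumes "chart \<psi>"
  obtains \<Theta> where "continuous_on leftward \<Theta>" "\<And>x. x \<in> leftward \<Longrightarrow> exp (\<Theta> x) = \<psi> (left_point x) - \<psi> (fst x)"
proof -
  have "continuous_on leftward (\<lambda>x. \<psi> (left_point x) - \<psi> (fst x))"
    by (intro continuous_intros continuous_on_compose2[OF chart_continuous[OF assms]]) auto
  moreover have "contractible leftward" by (intro convex_imp_contractible convex_leftward)
  moreover have "\<psi> (left_point x) - \<psi> (fst x) \<noteq> 0" if "x \<in> leftward" for x
    using left_point_not_half_leaf[OF assms that] by auto
  ultimately show ?thesis
    using continuous_logarithm_on_contractible[of leftward "\<lambda>x. \<psi> (left_point x) - \<psi> (fst x)"] that
    by (metis (no_types, lifting))
qed

text \<open>For a fixed base point both terms are logarithms of one vector along the interval behind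
  it. This makes the abscissa used in \<open>defect\<close> immaterial.\<close>

lemma branch_minus_log_const:
  assumes "branches \<alpha>" "chart \<psi>" "continuous_on leftward \<Theta>"
    "\<And>x. x \<in> leftward \<Longrightarrow> exp (\<Theta> x) = \<psi> (left_point x) - \<psi> (fst x)" "(z, a) \<in> leftward" "(z, a') \<in> leftward"
  shows "\<Theta> (z, a) - \<alpha> (\<psi> z) (\<psi> (left_point (z, a))) = \<Theta> (z, a') - \<alpha> (\<psi> z) (\<psi> (left_point (z, a')))"
proof -
  have L: "(z, u) \<in> leftward" if "u \<in> {..<Re z}" for u using that by (simp add: leftward_def)
  have "continuous_on {..<Re z} (\<lambda>u. \<Theta> (z, u))"
    by (rule continuous_on_compose2[OF assms(3)]) (use L in \<open>auto intro!: continuous_intros\<close>)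
  moreover have "continuous_on {..<Re z} (\<lambda>u. \<alpha> (\<psi> z) (\<psi> (left_point (z, u))))"
  proof (rule continuous_on_compose2[OF branchesD(1)[OF assms(1)]])
    show "continuous_on {..<Re z} (\<lambda>u. \<psi> (left_point (z, u)))"
      unfolding left_point_def Complex_eq
      by (rule continuous_on_compose2[OF chart_continuous[OF assms(2)]]) (auto intro!: continuous_intros)
    show "(\<lambda>u. \<psi> (left_point (z, u))) ` {..<Re z} \<subseteq> - half_leaf (\<psi> z)"
      using left_point_not_half_leaf[OF assms(2) L] by auto
  qed
  moreover have "exp (\<Theta> (z, u)) = exp (\<alpha> (\<psi> z) (\<psi> (left_point (z, u))))" if "u \<in> {..<Re z}" for u
    using assms(4)[OF L[OF that]] branchesD(2)[OF assms(1)] left_point_not_half_leaf[OF assms(2) L[OF that]] by simp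
  ultimately have "\<Theta> (z, a) - \<Theta> (z, a') = \<alpha> (\<psi> z) (\<psi> (left_point (z, a))) - \<alpha> (\<psi> z) (\<psi> (left_point (z, a')))"
    using assms(5,6)
    by (intro same_exp_imp_diff_constant[of "{..<Re z}" "\<lambda>u. \<Theta> (z, u)" "\<lambda>u. \<alpha> (\<psi> z) (\<psi> (left_point (z, u)))" a a'])
       (auto simp: leftward_def)
  then show ?thesis by (simp add: algebra_simps)
qed

end

section \<open>Coherent choice of the branches\<close>

locale charted_leaves = oriented_leaves +
  assumes chart_exists: "\<exists>\<psi>. chart \<psi> \<and> p \<in> range \<psi>"
begin

text \<open>The constant by which the logarithm \<open>\<Theta>\<close> carried by the chart \<open>\<psi>\<close> differs from the branch \<open>\<alpha> p\<close>;
  comparing them at abscissa \<open>Re z - 1\<close> is an arbitrary choice.\<close>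

definition defect :: "(complex \<Rightarrow> complex \<Rightarrow> complex) \<Rightarrow> (complex \<Rightarrow> complex) \<Rightarrow> (complex \<times> real \<Rightarrow> complex) \<Rightarrow> complex \<Rightarrow> complex" where
  "defect \<alpha> \<psi> \<Theta> p = (let z = inv_into UNIV \<psi> p; x = (z, Re z - 1) in \<Theta> x - \<alpha> p (\<psi> (left_point x)))"

lemma defect_eq:
  assumes "branches \<alpha>" "chart \<psi>" "continuous_on leftward \<Theta>"
    "\<And>x. x \<in> leftward \<Longrightarrow> exp (\<Theta> x) = \<psi> (left_point x) - \<psi> (fst x)" "x \<in> leftward"
  shows "defect \<alpha> \<psi> \<Theta> (\<psi> (fst x)) = \<Theta> x - \<alpha> (\<psi> (fst x)) (\<psi> (left_point x))"
proof -
  obtain z a where x: "x = (z, a)" by (cases x)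
  have "inv_into UNIV \<psi> (\<psi> z) = z" using chart_inj[OF assms(2)] by simp
  moreover have "(z, Re z - 1) \<in> leftward" by (simp add: leftward_def)
  ultimately show ?thesis
    unfolding x defect_def Let_def using branch_minus_log_const[OF assms(1-4), of z a "Re z - 1"] assms(5) x by simp
qed

lemma exp_defect:
  assumes "branches \<alpha>" "chart \<psi>" "continuous_on leftward \<Theta>"
    "\<And>x. x \<in> leftward \<Longrightarrow> exp (\<Theta> x) = \<psi> (left_point x) - \<psi> (fst x)" "p \<in> range \<psi>"
  shows "exp (defect \<alpha> \<psi> \<Theta> p) = 1"
proof -
  obtain z where z: "p = \<psi> z" using assms(5) by auto
  have l: "(z, Re z - 1) \<in> leftward" by (simp add: leftward_def)
  have e: "exp (\<alpha> (\<psi> z) (\<psi> (left_point (z, Re z - 1)))) = \<psi> (left_point (z, Re z - 1)) - \<psi> z"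
    using left_point_not_half_leaf[OF assms(2) l] by (intro branchesD(2)[OF assms(1)]) simp
  have "\<psi> (left_point (z, Re z - 1)) - \<psi> z \<noteq> 0"
    using left_point_not_half_leaf[OF assms(2) l] by auto
  then show ?thesis
    using defect_eq[OF assms(1-4) l] assms(4)[OF l] e z by (simp add: exp_diff)
qed

text \<open>Both defects can be evaluated at one common point \<open>w p\<close> behind
  \<open>p\<close>. There the uncontrolled term \<open>\<alpha> p (w p)\<close> cancels, leaving a
  continuous function \<open>h\<close> with exponential \<open>1\<close>. So the differences of
  defects are locally constant, however wildly the branches were chosen.\<close>

lemma defect_compatible:
  assumes "branches \<alpha>"
    and \<psi>: "chart \<psi>" "continuous_on leftward \<Theta>" "\<And>x. x \<in> leftward \<Longrightarrow> exp (\<Theta> x) = \<psi> (left_point x) - \<psi> (fst x)"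
    and \<psi>': "chart \<psi>'" "continuous_on leftward \<Theta>'" "\<And>x. x \<in> leftward \<Longrightarrow> exp (\<Theta>' x) = \<psi>' (left_point x) - \<psi>' (fst x)"
    and y: "y \<in> range \<psi>" "y \<in> range \<psi>'"
  shows "\<forall>\<^sub>F p in nhds y. defect \<alpha> \<psi> \<Theta> p - defect \<alpha> \<psi>' \<Theta>' p = defect \<alpha> \<psi> \<Theta> y - defect \<alpha> \<psi>' \<Theta>' y"
proof -
  obtain z0 where z0: "y = \<psi>' z0" using y(2) by auto
  have "open (\<psi>' -` range \<psi>)"
    using chart_continuous[OF \<psi>'(1)] chart_range_open[OF \<psi>(1)] by (auto simp: continuous_on_open_vimage)
  moreover have "z0 \<in> \<psi>' -` range \<psi>" using z0 y by auto
  ultimately obtain e where e: "e > 0" "ball z0 e \<subseteq> \<psi>' -` range \<psi>" using open_contains_ball by blast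
  define B where "B = \<psi>' ` ball z0 (e/2)"
  have oB: "open B" unfolding B_def
    by (intro invariance_of_domain continuous_on_subset[OF chart_continuous[OF \<psi>'(1)]] inj_on_subset[OF chart_inj[OF \<psi>'(1)]]) auto
  have yB: "y \<in> B" using e(1) z0 by (auto simp: B_def)
  have cB: "connected B" unfolding B_def
    by (intro connected_continuous_image continuous_on_subset[OF chart_continuous[OF \<psi>'(1)]]) auto
  have "ball z0 (e/2) \<subseteq> ball z0 e" using e(1) by (intro subset_ball) simp
  then have B: "B \<subseteq> range \<psi>" "B \<subseteq> range \<psi>'" using e(2) by (auto simp: B_def)
  \<comment> \<open>The step \<open>e/2\<close> keeps the horizontal segment from \<open>w p\<close>
    to \<open>p\<close> inside the ball around \<open>z0\<close> that \<open>\<psi>'\<close> maps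
    into \<open>range \<psi>\<close>.\<close>
  define w where "w p = \<psi>' (left_point (inv_into UNIV \<psi>' p, Re (inv_into UNIV \<psi>' p) - e/2))" for p
  have key: "w p \<in> range \<psi>" "(inv_into UNIV \<psi> p, Re (inv_into UNIV \<psi> (w p))) \<in> leftward"
    "left_point (inv_into UNIV \<psi> p, Re (inv_into UNIV \<psi> (w p))) = inv_into UNIV \<psi> (w p)" if p: "p \<in> B" for p
  proof -
    obtain z where z: "p = \<psi>' z" "z \<in> ball z0 (e/2)" using p by (auto simp: B_def)
    have iz: "inv_into UNIV \<psi>' p = z" using z chart_inj[OF \<psi>'(1)] by simp
    have hs: "hseg \<psi>' (Re z - e/2) (Re z) (Im z) \<subseteq> range \<psi>"
    proof
      fix v assume "v \<in> hseg \<psi>' (Re z - e/2) (Re z) (Im z)"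
      then obtain u where u: "Re z - e/2 \<le> u" "u \<le> Re z" "v = \<psi>' (Complex u (Im z))" by (auto simp: hseg_def)
      have "dist z (Complex u (Im z)) \<le> e/2" using u cmod_le[of "z - Complex u (Im z)"] by (simp add: dist_norm)
      then have "dist z0 (Complex u (Im z)) < e"
        using z(2) dist_triangle[of z0 "Complex u (Im z)" z] by simp
      then show "v \<in> range \<psi>" using e(2) u(3) by auto
    qed
    have lt: "Re z - e/2 < Re z" using e(1) by simp
    obtain c c' d where c: "c < c'" "\<psi>' (Complex (Re z - e/2) (Im z)) = \<psi> (Complex c d)"
      "\<psi>' (Complex (Re z) (Im z)) = \<psi> (Complex c' d)"
      using chart_transition[OF \<psi>(1) \<psi>'(1) lt hs] by blast
    have ip: "inv_into UNIV \<psi> p = Complex c' d" using c(3) z(1) chart_inj[OF \<psi>(1)] by (metis complex_surj inv_f_f)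
    have w: "w p = \<psi> (Complex c d)" using c(2) iz by (simp add: w_def left_point_def)
    then have iw: "inv_into UNIV \<psi> (w p) = Complex c d" using chart_inj[OF \<psi>(1)] by simp
    show "w p \<in> range \<psi>" "(inv_into UNIV \<psi> p, Re (inv_into UNIV \<psi> (w p))) \<in> leftward"
      "left_point (inv_into UNIV \<psi> p, Re (inv_into UNIV \<psi> (w p))) = inv_into UNIV \<psi> (w p)"
      using w ip iw c(1) by (auto simp: leftward_def left_point_def)
  qed
  define h where "h p = \<Theta> (inv_into UNIV \<psi> p, Re (inv_into UNIV \<psi> (w p))) - \<Theta>' (inv_into UNIV \<psi>' p, Re (inv_into UNIV \<psi>' p) - e/2)" for p
  have l': "(inv_into UNIV \<psi>' p, Re (inv_into UNIV \<psi>' p) - e/2) \<in> leftward" for p using e(1) by (simp add: leftward_def)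
  have eq: "defect \<alpha> \<psi> \<Theta> p - defect \<alpha> \<psi>' \<Theta>' p = h p" if p: "p \<in> B" for p
  proof -
    have i: "\<psi> (inv_into UNIV \<psi> p) = p" "\<psi>' (inv_into UNIV \<psi>' p) = p" "\<psi> (inv_into UNIV \<psi> (w p)) = w p"
      using p B key(1)[OF p] by (auto simp: f_inv_into_f)
    have "defect \<alpha> \<psi> \<Theta> p = \<Theta> (inv_into UNIV \<psi> p, Re (inv_into UNIV \<psi> (w p))) - \<alpha> p (w p)"
      using defect_eq[OF assms(1) \<psi> key(2)[OF p]] i key(3)[OF p] by simp
    moreover have "defect \<alpha> \<psi>' \<Theta>' p = \<Theta>' (inv_into UNIV \<psi>' p, Re (inv_into UNIV \<psi>' p) - e/2) - \<alpha> p (w p)"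
      using defect_eq[OF assms(1) \<psi>' l'[of p]] i by (simp add: w_def)
    ultimately show ?thesis by (simp add: h_def)
  qed
  have ci: "continuous_on B (inv_into UNIV \<psi>)" "continuous_on B (inv_into UNIV \<psi>')"
    using continuous_on_subset[OF chart_inv_continuous] \<psi>(1) \<psi>'(1) B by auto
  have cw: "continuous_on B w" unfolding w_def left_point_def Complex_eq
    by (rule continuous_on_compose2[OF chart_continuous[OF \<psi>'(1)]]) (auto intro!: continuous_intros ci)
  have ciw: "continuous_on B (\<lambda>p. inv_into UNIV \<psi> (w p))"
    by (rule continuous_on_compose2[OF chart_inv_continuous[OF \<psi>(1)] cw]) (use key in auto)
  have "continuous_on B (\<lambda>p. \<Theta> (inv_into UNIV \<psi> p, Re (inv_into UNIV \<psi> (w p))))"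
    by (rule continuous_on_compose2[OF \<psi>(2)]) (use key in \<open>auto intro!: continuous_intros ci ciw\<close>)
  moreover have "continuous_on B (\<lambda>p. \<Theta>' (inv_into UNIV \<psi>' p, Re (inv_into UNIV \<psi>' p) - e/2))"
    by (rule continuous_on_compose2[OF \<psi>'(2)]) (use l' in \<open>auto intro!: continuous_intros ci\<close>)
  ultimately have ch: "continuous_on B h" unfolding h_def by (rule continuous_on_diff)
  have "exp (h p) = 1" if p: "p \<in> B" for p
  proof -
    have pr: "p \<in> range \<psi>" "p \<in> range \<psi>'" using B p by blast+
    show ?thesis
      unfolding eq[OF p, symmetric] exp_diff
      using exp_defect[OF assms(1) \<psi> pr(1)] exp_defect[OF assms(1) \<psi>' pr(2)] by simp
  qed
  then obtain c where "\<And>p. p \<in> B \<Longrightarrow> h p = c" using exp_const_imp_constant[OF cB ch] by metis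
  then have "\<forall>p\<in>B. defect \<alpha> \<psi> \<Theta> p - defect \<alpha> \<psi>' \<Theta>' p = defect \<alpha> \<psi> \<Theta> y - defect \<alpha> \<psi>' \<Theta>' y"
    using eq yB by simp
  then show ?thesis using oB yB eventually_nhds by blast
qed

end

section \<open>The order on the plane\<close>

context charted_leaves
begin

lemma tame_if_defect_locally_constant:
  assumes "branches \<alpha>" "chart \<psi>" "continuous_on leftward \<Theta>"
    "\<And>x. x \<in> leftward \<Longrightarrow> exp (\<Theta> x) = \<psi> (left_point x) - \<psi> (fst x)"
    and const: "\<And>p. p \<in> range \<psi> \<Longrightarrow> \<forall>\<^sub>F q in nhds p. defect \<alpha> \<psi> \<Theta> q = defect \<alpha> \<psi> \<Theta> p"
  shows "tame \<alpha> \<psi>"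
proof -
  have "connected (range \<psi>)"
    by (intro connected_continuous_image chart_continuous assms connected_UNIV)
  then have "defect \<alpha> \<psi> \<Theta> p = defect \<alpha> \<psi> \<Theta> (\<psi> 0)" if "p \<in> range \<psi>" for p
  proof (rule locally_constant_imp_constant[OF _ _ that])
    fix a assume "a \<in> range \<psi>"
    from const[OF this] show "\<forall>\<^sub>F b in nhds a. b \<in> range \<psi> \<longrightarrow> defect \<alpha> \<psi> \<Theta> b = defect \<alpha> \<psi> \<Theta> a"
      by eventually_elim simp
  qed auto
  then have eq: "\<Theta> x - defect \<alpha> \<psi> \<Theta> (\<psi> 0) = \<alpha> (\<psi> (fst x)) (\<psi> (left_point x))" if "x \<in> leftward" for x
    using defect_eq[OF assms(1-4) that] by (metis diff_add_cancel diff_add_eq_diff_diff_swap diff_diff_eq2 rangeI add_diff_cancel_left')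
  have "continuous_on leftward (\<lambda>x. \<Theta> x - defect \<alpha> \<psi> \<Theta> (\<psi> 0))"
    by (intro continuous_intros assms(3))
  then show ?thesis unfolding tame_def by (rule continuous_on_eq) (simp add: eq)
qed

definition tame_branches :: "(complex \<Rightarrow> complex \<Rightarrow> complex) \<Rightarrow> bool" where
  "tame_branches \<alpha> \<longleftrightarrow> branches \<alpha> \<and> (\<forall>\<psi>. chart \<psi> \<longrightarrow> tame \<alpha> \<psi>)"

text \<open>Arbitrary branches \<open>\<alpha>0\<close> have defects that jump with
  \<open>p\<close>. Gluing these produces one function \<open>F\<close> with the same jumps in every
  chart, and adding \<open>F p - F 0\<close> to \<open>\<alpha>0 p\<close> removes them.\<close>

lemma tame_branches_exist: "\<exists>\<alpha>. tame_branches \<alpha>"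
proof -
  obtain \<alpha>0 where \<alpha>0: "branches \<alpha>0" using half_leaf_branch unfolding branches_def by metis
  obtain C where C: "\<And>x. chart (C x)" "\<And>x. x \<in> range (C x)" using chart_exists by metis
  have "\<forall>x. \<exists>\<Theta>. continuous_on leftward \<Theta> \<and> (\<forall>y\<in>leftward. exp (\<Theta> y) = C x (left_point y) - C x (fst y))"
    using chart_log[OF C(1)] by metis
  then obtain T where T: "\<And>x. continuous_on leftward (T x)"
    "\<And>x y. y \<in> leftward \<Longrightarrow> exp (T x y) = C x (left_point y) - C x (fst y)" by metis
  define f where "f x = defect \<alpha>0 (C x) (T x)" for x
  have "\<exists>d>0. \<forall>y\<in>ball x d. \<forall>\<^sub>F z in nhds y. f x z - f y z = f x y - f y y" for x
  proof -
    obtain d where "d > 0" "ball x d \<subseteq> range (C x)"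
      using chart_range_open[OF C(1)] C(2) open_contains_ball by meson
    then show ?thesis
      unfolding f_def by (intro exI[of _ d] conjI ballI defect_compatible \<alpha>0 C T) auto
  qed
  then obtain F where F: "\<And>x. \<forall>\<^sub>F z in nhds x. F z - f x z = F x - f x x"
    using local_sections_glue[of f] by auto
  have ef: "exp (f x p) = 1" if "p \<in> range (C x)" for x p
    unfolding f_def by (rule exp_defect[OF \<alpha>0 C(1) T that])
  \<comment> \<open>The corrected functions are still logarithms only if the correction is a
    multiple of \<open>2 * pi * \<i>\<close>; this is inherited from the defects, whose exponentials
    are \<open>1\<close>.\<close>
  have "exp (F p) = exp (F 0)" for p
  proof (rule locally_constant_imp_constant[OF connected_UNIV, where f = "\<lambda>p. exp (F p)"])
    fix a
    have "\<forall>\<^sub>F b in nhds a. b \<in> range (C a)"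
      using chart_range_open[OF C(1)] C(2) by (intro eventually_nhds_in_open)
    then show "\<forall>\<^sub>F b in nhds a. b \<in> UNIV \<longrightarrow> exp (F b) = exp (F a)"
      using F[of a]
    proof eventually_elim
      case (elim b)
      have "F b = f a b + (F a - f a a)" using elim(2) by (simp add: algebra_simps)
      then show ?case using ef[OF elim(1)] ef[OF C(2)[of a]] by (simp add: exp_add exp_diff)
    qed
  qed auto
  then have eF: "exp (F p - F 0) = 1" for p by (simp add: exp_diff)
  define \<alpha> where "\<alpha> p y = \<alpha>0 p y + (F p - F 0)" for p y
  have \<alpha>: "branches \<alpha>"
    using \<alpha>0 eF unfolding branches_def branch_def \<alpha>_def by (auto intro!: continuous_intros simp: exp_add)
  have "tame \<alpha> \<psi>" if \<psi>: "chart \<psi>" for \<psi>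
  proof -
    obtain \<Theta> where \<Theta>: "continuous_on leftward \<Theta>" "\<And>x. x \<in> leftward \<Longrightarrow> exp (\<Theta> x) = \<psi> (left_point x) - \<psi> (fst x)"
      using chart_log[OF \<psi>] by blast
    have d: "defect \<alpha> \<psi> \<Theta> p = defect \<alpha>0 \<psi> \<Theta> p - (F p - F 0)" for p
      by (simp add: defect_def Let_def \<alpha>_def)
    show ?thesis
    proof (rule tame_if_defect_locally_constant[OF \<alpha> \<psi> \<Theta>])
      fix p assume p: "p \<in> range \<psi>"
      have "\<forall>\<^sub>F q in nhds p. defect \<alpha>0 \<psi> \<Theta> q - f p q = defect \<alpha>0 \<psi> \<Theta> p - f p p"
        unfolding f_def by (rule defect_compatible[OF \<alpha>0 \<psi> \<Theta> C(1) T p C(2)])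
      then show "\<forall>\<^sub>F q in nhds p. defect \<alpha> \<psi> \<Theta> q = defect \<alpha> \<psi> \<Theta> p"
        using F[of p]
      proof eventually_elim
        case (elim q)
        then have "(defect \<alpha>0 \<psi> \<Theta> q - f p q) - (F q - f p q) = (defect \<alpha>0 \<psi> \<Theta> p - f p p) - (F p - f p p)"
          by simp
        then show ?case by (simp add: d algebra_simps)
      qed
    qed
  qed
  then show ?thesis using \<alpha> by (auto simp: tame_branches_def)
qed

section \<open>Differences of branches between two leaves\<close>

lemma chart_leaf_Im_constant:
  assumes "chart \<psi>" "\<gamma> \<in> \<Gamma>" "s < t" "\<gamma> ` {s..t} \<subseteq> range \<psi>"
  shows "Im (inv_into UNIV \<psi> (\<gamma> s)) = Im (inv_into UNIV \<psi> (\<gamma> t))"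
proof -
  obtain a a' b where "\<gamma> s = \<psi> (Complex a b)" "\<gamma> t = \<psi> (Complex a' b)"
    using assms unfolding chart_def by metis
  then show ?thesis using chart_inj[OF assms(1)] by simp
qed

text \<open>Base point and cut both move with \<open>t\<close>. The value at \<open>q\<close> is its
  increment from a point \<open>y\<close> further back on the leaf, continuous by sliding, plus the
  value at \<open>y\<close>, continuous by tameness.\<close>

lemma leaf_slide_continuous:
  assumes \<alpha>: "tame_branches \<alpha>" and \<gamma>: "\<gamma> \<in> \<Gamma>" and q: "q \<notin> range \<gamma>"
  shows "continuous_on UNIV (\<lambda>t. \<alpha> (\<gamma> t) q)"
proof -
  have br: "branches \<alpha>" and tame: "\<And>\<psi>. chart \<psi> \<Longrightarrow> tame \<alpha> \<psi>" using \<alpha> by (auto simp: tame_branches_def)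
  have "isCont (\<lambda>t. \<alpha> (\<gamma> t) q) t0" for t0
  proof -
    obtain \<psi> where \<psi>: "chart \<psi>" "\<gamma> t0 \<in> range \<psi>" using chart_exists by blast
    then obtain z0 where z0: "\<gamma> t0 = \<psi> z0" by auto
    define z where "z t = inv_into UNIV \<psi> (\<gamma> t)" for t
    have zt0: "z t0 = z0" using z0 chart_inj[OF \<psi>(1)] by (simp add: z_def)
    define W where "W = \<gamma> -` range \<psi>"
    have oW: "open W" unfolding W_def
      using leaf_continuous[OF \<gamma>] chart_range_open[OF \<psi>(1)] by (auto simp: continuous_on_open_vimage)
    have cz: "continuous_on W z" unfolding z_def
      by (rule continuous_on_compose2[OF chart_inv_continuous[OF \<psi>(1)]])
         (auto simp: W_def intro: continuous_on_subset[OF leaf_continuous[OF \<gamma>]])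
    have "open (W \<inter> z -` {w. Re z0 - 1 < Re w})"
      by (intro continuous_open_preimage cz oW open_halfspace_Re_gt)
    moreover have "t0 \<in> W \<inter> z -` {w. Re z0 - 1 < Re w}" using \<psi>(2) zt0 by (auto simp: W_def)
    ultimately obtain d where d: "d > 0" "ball t0 d \<subseteq> W \<inter> z -` {w. Re z0 - 1 < Re w}"
      using open_contains_ball by blast
    have Im: "Im (z t) = Im z0" if t: "t \<in> ball t0 d" for t
    proof -
      have "{min t t0..max t t0} \<subseteq> ball t0 d" using t d(1) by (auto simp: dist_real_def)
      then have sub: "\<gamma> ` {min t t0..max t t0} \<subseteq> range \<psi>" using d(2) by (auto simp: W_def)
      consider "t < t0" | "t = t0" | "t0 < t" by linarith
      then show ?thesis
      proof cases
        case 1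
        then show ?thesis using chart_leaf_Im_constant[OF \<psi>(1) \<gamma>, of t t0] sub zt0 by (simp add: z_def)
      next
        case 3
        then show ?thesis using chart_leaf_Im_constant[OF \<psi>(1) \<gamma>, of t0 t] sub zt0 by (simp add: z_def)
      qed (simp add: zt0)
    qed
    define y where "y = \<psi> (Complex (Re z0 - 1) (Im z0))"
    have "before y (\<psi> (Complex (Re z0) (Im z0)))" unfolding y_def by (intro chart_before[OF \<psi>(1)]) simp
    then have yt: "before y (\<gamma> t0)" using z0 by simp
    then have "y \<in> range \<gamma>" using same_leaf_range[OF \<gamma>] before_same_leaf same_leaf_sym by blast
    then obtain s1 where s1: "y = \<gamma> s1" by auto
    then have "s1 < t0" using yt before_iff[OF \<gamma>] by simp
    \<comment> \<open>Start of the sliding ray: after \<open>y\<close>, so that \<open>y\<close> is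
      off the cuts, and before \<open>t0\<close>, so that a full neighbourhood of \<open>t0\<close>
      is covered.\<close>
    define s2 where "s2 = max ((s1 + t0) / 2) (t0 - d / 2)"
    have s2: "s1 < s2" "s2 < t0" "t0 - d < s2" using \<open>s1 < t0\<close> d(1) by (auto simp: s2_def less_max_iff_disj)
    have img: "(\<lambda>u. \<gamma> (u + s2)) ` {t..} = half_leaf (\<gamma> (t + s2))" for t
    proof -
      have "(\<lambda>u. u + s2) ` {t..} = {t + s2..}" by (auto intro!: image_eqI[of x _ "x - s2" for x])
      then show ?thesis unfolding half_leaf_eq[OF \<gamma>] by (metis image_image)
    qed
    have notin: "y \<notin> (\<lambda>u. \<gamma> (u + s2)) ` {0..}" "q \<notin> (\<lambda>u. \<gamma> (u + s2)) ` {0..}"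
      using s1 s2(1) leaf_inj[OF \<gamma>] q by (auto simp: inj_eq)
    have "continuous_on {0..} (\<lambda>u. \<alpha> (\<gamma> (u + s2)) q - \<alpha> (\<gamma> (u + s2)) y)"
    proof (rule ray_slide_continuous[OF leaf_ray[OF \<gamma>] notin(2,1)])
      show "branch (\<gamma> (t + s2)) ((\<lambda>u. \<gamma> (u + s2)) ` {t..}) (\<alpha> (\<gamma> (t + s2)))" for t
        using br unfolding img branches_def by blast
    qed
    then have "continuous_on {s2..} (\<lambda>t. \<alpha> (\<gamma> ((t - s2) + s2)) q - \<alpha> (\<gamma> ((t - s2) + s2)) y)"
      by (rule continuous_on_compose2) (auto intro!: continuous_intros)
    then have c1: "continuous_on {s2<..<t0 + d} (\<lambda>t. \<alpha> (\<gamma> t) q - \<alpha> (\<gamma> t) y)"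
      by (auto intro: continuous_on_subset)
    have I: "{s2<..<t0 + d} \<subseteq> ball t0 d" using s2 by (auto simp: dist_real_def)
    have "continuous_on {s2<..<t0 + d} (\<lambda>t. \<alpha> (\<psi> (fst (z t, Re z0 - 1))) (\<psi> (left_point (z t, Re z0 - 1))))"
    proof (rule continuous_on_compose2[OF tame[OF \<psi>(1), unfolded tame_def]])
      show "continuous_on {s2<..<t0 + d} (\<lambda>t. (z t, Re z0 - 1))"
        by (intro continuous_intros continuous_on_subset[OF cz]) (use I d(2) in blast)
      show "(\<lambda>t. (z t, Re z0 - 1)) ` {s2<..<t0 + d} \<subseteq> leftward"
        using I d(2) by (auto simp: leftward_def)
    qed
    then have c2: "continuous_on {s2<..<t0 + d} (\<lambda>t. \<alpha> (\<gamma> t) y)"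
    proof (rule continuous_on_eq)
      fix t assume "t \<in> {s2<..<t0 + d}"
      then have t: "t \<in> ball t0 d" using I by blast
      then have "\<psi> (z t) = \<gamma> t" using d(2) by (auto simp: W_def z_def f_inv_into_f)
      then show "\<alpha> (\<psi> (fst (z t, Re z0 - 1))) (\<psi> (left_point (z t, Re z0 - 1))) = \<alpha> (\<gamma> t) y"
        using Im[OF t] by (simp add: left_point_def y_def)
    qed
    have "continuous_on {s2<..<t0 + d} (\<lambda>t. \<alpha> (\<gamma> t) q)"
      using continuous_on_add[OF c1 c2] by simp
    then show ?thesis
      using s2 d(1) by (simp add: continuous_on_eq_continuous_at)
  qed
  then show ?thesis by (simp add: continuous_at_imp_continuous_on)
qed

text \<open>On distinct leaves \<open>gap \<alpha> p q\<close> is an odd multiple of \<open>\<i> pi\<close>; it counts how often the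
  half leaf of \<open>q\<close> turns past the half leaf of \<open>p\<close>.\<close>

definition gap :: "(complex \<Rightarrow> complex \<Rightarrow> complex) \<Rightarrow> complex \<Rightarrow> complex \<Rightarrow> complex" where
  "gap \<alpha> p q = \<alpha> p q - \<alpha> q p"

lemma gap_swap: "gap \<alpha> q p = - gap \<alpha> p q"
  by (simp add: gap_def)

lemma exp_gap:
  assumes "branches \<alpha>" "\<not> same_leaf p q"
  shows "exp (gap \<alpha> p q) = -1"
proof -
  have "q \<notin> half_leaf p" "p \<notin> half_leaf q" "p \<noteq> q"
    using assms(2) half_leaf_same_leaf same_leaf_sym same_leaf_refl by blast+
  then have "exp (gap \<alpha> p q) = (q - p) / (p - q)"
    using branchesD(2)[OF assms(1)] by (simp add: gap_def exp_diff)
  also have "\<dots> = -1" using \<open>p \<noteq> q\<close> by (simp add: divide_simps)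
  finally show ?thesis .
qed

lemma gap_bound:
  assumes "branches \<alpha>" "\<not> same_leaf p q"
  shows "pi \<le> \<bar>Im (gap \<alpha> p q)\<bar>"
proof -
  have "exp (gap \<alpha> p q) = exp (\<i> * of_real pi)" using exp_gap[OF assms] by (simp add: exp_pi_i')
  then obtain n :: int where n: "gap \<alpha> p q = \<i> * of_real pi + of_real (of_int (2 * n) * pi) * \<i>"
    using exp_eq[of "gap \<alpha> p q"] by blast
  then have "Im (gap \<alpha> p q) = (2 * of_int n + 1) * pi" by (simp add: algebra_simps)
  moreover have "1 \<le> \<bar>2 * n + 1\<bar>" by presburger
  then have "real_of_int 1 \<le> real_of_int \<bar>2 * n + 1\<bar>" by (simp only: of_int_le_iff)
  then have "1 \<le> \<bar>2 * real_of_int n + 1\<bar>" by simp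
  ultimately show ?thesis by (simp add: abs_mult)
qed

text \<open>Moving \<open>p\<close> along its leaf changes \<open>gap\<close> continuously, while
  the exponential stays \<open>-1\<close>.\<close>

lemma gap_cong_left:
  assumes "tame_branches \<alpha>" "same_leaf p p'" "\<not> same_leaf p q"
  shows "gap \<alpha> p q = gap \<alpha> p' q"
proof -
  obtain \<gamma> s t where \<gamma>: "\<gamma> \<in> \<Gamma>" "\<gamma> s = p" "\<gamma> t = p'" using assms(2) by (auto simp: same_leaf_def)
  have q: "q \<notin> range \<gamma>" using \<gamma> assms(3) same_leaf_range by metis
  have nsl: "\<not> same_leaf (\<gamma> u) q" for u using same_leaf_range[OF \<gamma>(1)] q by simp
  have br: "branches \<alpha>" using assms(1) by (simp add: tame_branches_def)
  have "continuous_on UNIV (\<lambda>u. \<alpha> q (\<gamma> u))"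
    by (rule continuous_on_compose2[OF branchesD(1)[OF br] leaf_continuous[OF \<gamma>(1)]])
       (use nsl half_leaf_same_leaf same_leaf_sym in blast)
  then have "continuous_on UNIV (\<lambda>u. gap \<alpha> (\<gamma> u) q)"
    unfolding gap_def by (intro continuous_on_diff leaf_slide_continuous[OF assms(1) \<gamma>(1) q])
  then obtain c where "\<And>u. u \<in> UNIV \<Longrightarrow> gap \<alpha> (\<gamma> u) q = c"
    using exp_const_imp_constant[OF connected_UNIV, of "\<lambda>u. gap \<alpha> (\<gamma> u) q" "-1"] exp_gap[OF br nsl] by blast
  then show ?thesis using \<gamma> by auto
qed

lemma gap_cong_right:
  assumes "tame_branches \<alpha>" "same_leaf q q'" "\<not> same_leaf p q"
  shows "gap \<alpha> p q = gap \<alpha> p q'"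
  using gap_cong_left[OF assms(1,2), of p] assms(3) gap_swap same_leaf_sym by metis

text \<open>Regrouped by base points, the cyclic sum of gaps is \<open>turn\<close> of the three
  half leaves, which are disjoint because the leaves are.\<close>

lemma gap_triangle:
  assumes "branches \<alpha>" "\<not> same_leaf p q" "\<not> same_leaf q r" "\<not> same_leaf p r"
  shows "\<bar>Im (gap \<alpha> p q + gap \<alpha> q r + gap \<alpha> r p)\<bar> < 3 * pi"
proof -
  obtain \<rho>1 where r1: "ray \<rho>1" "\<rho>1 0 = p" "\<rho>1 ` {0..} = half_leaf p" by (rule half_leaf_ray)
  obtain \<rho>2 where r2: "ray \<rho>2" "\<rho>2 0 = q" "\<rho>2 ` {0..} = half_leaf q" by (rule half_leaf_ray)
  obtain \<rho>3 where r3: "ray \<rho>3" "\<rho>3 0 = r" "\<rho>3 ` {0..} = half_leaf r" by (rule half_leaf_ray)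
  have dis: "half_leaf x \<inter> half_leaf y = {}" if "\<not> same_leaf x y" for x y
    using that half_leaf_same_leaf same_leaf_sym same_leaf_trans by blast
  have out: "y \<notin> half_leaf x" "x \<notin> half_leaf y" if "\<not> same_leaf x y" for x y
    using that half_leaf_same_leaf same_leaf_sym by blast+
  have "\<bar>Im (turn \<rho>1 \<rho>2 \<rho>3)\<bar> < 3 * pi"
    using r1 r2 r3 assms(2-4) dis by (intro turn_bound) (auto simp: disjoint_rays_def)
  moreover have "turn \<rho>1 \<rho>2 \<rho>3 = (\<alpha> p q - \<alpha> p r) + (\<alpha> q r - \<alpha> q p) + (\<alpha> r p - \<alpha> r q)"
    unfolding turn_def r1 r2 r3 using assms out
    by (intro arg_cong2[where f = "(+)"] sweep_eq connected_compl_half_leaf) (auto simp: branches_def)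
  moreover have "\<dots> = gap \<alpha> p q + gap \<alpha> q r + gap \<alpha> r p" by (simp add: gap_def)
  ultimately show ?thesis by simp
qed

definition leaf_less :: "(complex \<Rightarrow> complex \<Rightarrow> complex) \<Rightarrow> complex \<Rightarrow> complex \<Rightarrow> bool" where
  "leaf_less \<alpha> p q \<longleftrightarrow> before p q \<or> \<not> same_leaf p q \<and> 0 < Im (gap \<alpha> p q)"

lemma leaf_less_irrefl: "\<not> leaf_less \<alpha> p p"
proof -
  obtain \<gamma> s where "\<gamma> \<in> \<Gamma>" "\<gamma> s = p" by (rule leaf_obtain)
  then show ?thesis using before_iff[of \<gamma> s s] same_leaf_refl by (auto simp: leaf_less_def)
qed

lemma before_trans: "before p q \<Longrightarrow> before q r \<Longrightarrow> before p r"
proof -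
  assume pq: "before p q" and qr: "before q r"
  obtain \<gamma> s t where g: "\<gamma> \<in> \<Gamma>" "\<gamma> s = p" "\<gamma> t = q" using pq by (auto simp: before_def)
  then have "r \<in> range \<gamma>" using before_same_leaf[OF qr] same_leaf_range by metis
  then obtain u where "r = \<gamma> u" by auto
  then show "before p r" using pq qr g before_iff[OF g(1)] by (metis less_trans)
qed

lemma leaf_less_total:
  assumes "branches \<alpha>" "p \<noteq> q"
  shows "leaf_less \<alpha> p q \<or> leaf_less \<alpha> q p"
proof (cases "same_leaf p q")
  case True
  then obtain \<gamma> s t where g: "\<gamma> \<in> \<Gamma>" "\<gamma> s = p" "\<gamma> t = q" by (auto simp: same_leaf_def)
  then have "s \<noteq> t" using assms(2) by blast
  then have "s < t \<or> t < s" by linarith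
  then show ?thesis using g before_iff[OF g(1)] by (metis leaf_less_def)
next
  case False
  have "0 < Im (gap \<alpha> p q) \<or> Im (gap \<alpha> p q) < 0"
    using gap_bound[OF assms(1) False] pi_gt_zero by linarith
  then have "0 < Im (gap \<alpha> p q) \<or> 0 < Im (gap \<alpha> q p)"
    using gap_swap[of \<alpha> q p] by auto
  then show ?thesis using False same_leaf_sym by (auto simp: leaf_less_def)
qed

text \<open>On three distinct leaves a failure would make all three gaps in cyclic order at least
  \<open>pi\<close>, against the strict bound \<open>3 * pi\<close>. If \<open>p\<close> and
  \<open>r\<close> shared a leaf without \<open>q\<close>, then \<open>gap \<alpha> p q\<close> and
  \<open>gap \<alpha> r q\<close> would agree and yet have opposite signs. Where only one step
  changes the leaf, the gap is carried along the other leaf.\<close>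

lemma leaf_less_trans:
  assumes \<alpha>: "tame_branches \<alpha>" and pq: "leaf_less \<alpha> p q" and qr: "leaf_less \<alpha> q r"
  shows "leaf_less \<alpha> p r"
proof -
  have br: "branches \<alpha>" using \<alpha> by (simp add: tame_branches_def)
  consider "before p q" "before q r" | "before p q" "\<not> same_leaf q r" | "\<not> same_leaf p q" "before q r"
    | "\<not> same_leaf p q" "\<not> same_leaf q r" "same_leaf p r"
    | "\<not> same_leaf p q" "\<not> same_leaf q r" "\<not> same_leaf p r"
    using pq qr by (auto simp: leaf_less_def)
  then show ?thesis
  proof cases
    case 1
    then show ?thesis using before_trans by (auto simp: leaf_less_def)
  next
    case 2
    then have sl: "same_leaf q p" using before_same_leaf same_leaf_sym by blast
    have "\<not> same_leaf p r" using 2(2) same_leaf_trans[OF sl] by blast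
    moreover have "0 < Im (gap \<alpha> q r)" using qr 2(2) before_same_leaf by (auto simp: leaf_less_def)
    ultimately show ?thesis using gap_cong_left[OF \<alpha> sl 2(2)] by (simp add: leaf_less_def)
  next
    case 3
    then have sl: "same_leaf q r" using before_same_leaf by blast
    have "\<not> same_leaf p r" using 3(1) same_leaf_trans same_leaf_sym[OF sl] by blast
    moreover have "0 < Im (gap \<alpha> p q)" using pq 3(1) before_same_leaf by (auto simp: leaf_less_def)
    ultimately show ?thesis using gap_cong_right[OF \<alpha> sl 3(1)] by (simp add: leaf_less_def)
  next
    case 4
    have "0 < Im (gap \<alpha> p q)" "0 < Im (gap \<alpha> q r)"
      using pq qr 4 before_same_leaf by (auto simp: leaf_less_def)
    moreover have "gap \<alpha> p q = gap \<alpha> r q" by (rule gap_cong_left[OF \<alpha> 4(3,1)])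
    ultimately show ?thesis using gap_swap[of \<alpha> r q] by simp
  next
    case 5
    have pos: "0 < Im (gap \<alpha> p q)" "0 < Im (gap \<alpha> q r)"
      using pq qr 5 before_same_leaf by (auto simp: leaf_less_def)
    have "0 < Im (gap \<alpha> p r)"
    proof (rule ccontr)
      assume "\<not> 0 < Im (gap \<alpha> p r)"
      then have "pi \<le> Im (gap \<alpha> r p)"
        using gap_bound[OF br 5(3)] gap_swap[of \<alpha> r p] by simp
      moreover have "pi \<le> Im (gap \<alpha> p q)" "pi \<le> Im (gap \<alpha> q r)"
        using gap_bound[OF br 5(1)] gap_bound[OF br 5(2)] pos by simp_all
      ultimately show False using gap_triangle[OF br 5] by simp
    qed
    then show ?thesis using 5(3) by (simp add: leaf_less_def)
  qed
qed

end

section \<open>Automorphisms\<close>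

context oriented_leaves
begin

definition leaf_automorphism :: "(complex \<Rightarrow> complex) \<Rightarrow> bool" where
  "leaf_automorphism g \<longleftrightarrow> continuous_on UNIV g \<and> bij g \<and> (\<lambda>\<gamma>. g \<circ> \<gamma>) ` \<Gamma> = \<Gamma>"

context
  fixes g
  assumes g: "leaf_automorphism g"
begin

lemma aut_continuous: "continuous_on UNIV g" and aut_inj: "inj g"
  using g by (auto simp: leaf_automorphism_def bij_def)

lemma aut_eq_iff [simp]: "g p = g q \<longleftrightarrow> p = q"
  using aut_inj by (simp add: inj_eq)

lemma aut_leaf: "\<gamma> \<in> \<Gamma> \<Longrightarrow> g \<circ> \<gamma> \<in> \<Gamma>"
  using g by (auto simp: leaf_automorphism_def)

lemma aut_leaf_obtain:
  assumes "\<gamma> \<in> \<Gamma>"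
  obtains \<delta> where "\<delta> \<in> \<Gamma>" "\<gamma> = g \<circ> \<delta>"
  using assms g unfolding leaf_automorphism_def by (metis imageE)

lemma aut_same_leaf [simp]: "same_leaf (g p) (g q) \<longleftrightarrow> same_leaf p q"
proof -
  obtain \<gamma> s where \<gamma>: "\<gamma> \<in> \<Gamma>" "\<gamma> s = p" by (rule leaf_obtain)
  have "same_leaf (g p) (g q) \<longleftrightarrow> g q \<in> range (g \<circ> \<gamma>)"
    using same_leaf_range[OF aut_leaf[OF \<gamma>(1)], of s "g q"] \<gamma>(2) by simp
  also have "\<dots> \<longleftrightarrow> q \<in> range \<gamma>" by auto
  finally show ?thesis using same_leaf_range[OF \<gamma>(1), of s q] \<gamma>(2) by simp
qed

lemma aut_half_leaf: "half_leaf (g p) = g ` half_leaf p"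
proof -
  obtain \<gamma> s where \<gamma>: "\<gamma> \<in> \<Gamma>" "\<gamma> s = p" by (rule leaf_obtain)
  have "half_leaf ((g \<circ> \<gamma>) s) = (g \<circ> \<gamma>) ` {s..}" by (rule half_leaf_eq[OF aut_leaf[OF \<gamma>(1)]])
  then show ?thesis using half_leaf_eq[OF \<gamma>(1), of s] \<gamma>(2) by (simp add: image_image)
qed

lemma aut_before [simp]: "before (g p) (g q) \<longleftrightarrow> before p q"
proof
  assume "before p q"
  then obtain \<gamma> s t where "\<gamma> \<in> \<Gamma>" "s < t" "\<gamma> s = p" "\<gamma> t = q" by (auto simp: before_def)
  then show "before (g p) (g q)" using before_iff[OF aut_leaf, of \<gamma> s t] by simp
next
  assume b: "before (g p) (g q)"
  then have "same_leaf p q" using before_same_leaf[OF b] by simp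
  then obtain \<gamma> s t where \<gamma>: "\<gamma> \<in> \<Gamma>" "\<gamma> s = p" "\<gamma> t = q" by (auto simp: same_leaf_def)
  then show "before p q" using b before_iff[OF aut_leaf[OF \<gamma>(1)], of s t] before_iff[OF \<gamma>(1), of s t] by simp
qed

lemma aut_chart:
  assumes \<psi>: "chart \<psi>"
  shows "chart (g \<circ> \<psi>)"
  unfolding chart_def
proof (intro conjI allI impI ballI)
  show "continuous_on UNIV (g \<circ> \<psi>)"
    using chart_continuous[OF \<psi>] aut_continuous by (intro continuous_on_compose) (auto intro: continuous_on_subset)
  show "inj (g \<circ> \<psi>)" using chart_inj[OF \<psi>] aut_inj by (intro inj_compose)
next
  fix a a' b :: real assume "a < a'"
  then obtain \<gamma> s t where "\<gamma> \<in> \<Gamma>" "s < t" "\<gamma> s = \<psi> (Complex a b)" "\<gamma> t = \<psi> (Complex a' b)" "\<gamma> ` {s..t} = hseg \<psi> a a' b"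
    by (rule chart_hseg[OF \<psi>])
  moreover from this have "(g \<circ> \<gamma>) ` {s..t} = hseg (g \<circ> \<psi>) a a' b"
    by (metis hseg_def image_comp image_image comp_def)
  ultimately show "\<exists>\<gamma>\<in>\<Gamma>. \<exists>s t. s < t \<and> \<gamma> s = (g \<circ> \<psi>) (Complex a b) \<and> \<gamma> t = (g \<circ> \<psi>) (Complex a' b) \<and> \<gamma> ` {s..t} = hseg (g \<circ> \<psi>) a a' b"
    by (intro bexI[of _ "g \<circ> \<gamma>"] exI[of _ s] exI[of _ t]) (auto intro: aut_leaf)
next
  fix \<gamma> and s t :: real assume \<gamma>: "\<gamma> \<in> \<Gamma>" and st: "s < t \<and> \<gamma> ` {s..t} \<subseteq> range (g \<circ> \<psi>)"
  obtain \<delta> where \<delta>: "\<delta> \<in> \<Gamma>" "\<gamma> = g \<circ> \<delta>" by (rule aut_leaf_obtain[OF \<gamma>])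
  have sub: "\<delta> ` {s..t} \<subseteq> range \<psi>"
  proof
    fix y assume "y \<in> \<delta> ` {s..t}"
    then have "g y \<in> \<gamma> ` {s..t}" using \<delta>(2) by auto
    then have "g y \<in> range (g \<circ> \<psi>)" using st by blast
    then show "y \<in> range \<psi>" by auto
  qed
  from st have "s < t" by blast
  then obtain a a' b where "a < a'" "\<delta> s = \<psi> (Complex a b)" "\<delta> t = \<psi> (Complex a' b)"
    by (rule chart_leaf_arc[OF \<psi> \<delta>(1) _ sub])
  then show "\<exists>a a' b. a < a' \<and> \<gamma> s = (g \<circ> \<psi>) (Complex a b) \<and> \<gamma> t = (g \<circ> \<psi>) (Complex a' b)"
    using \<delta>(2) by auto
qed

end

end

context charted_leaves
begin

text \<open>For fixed \<open>p\<close>, \<open>\<alpha> (g p) (g y)\<close> and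
  \<open>k * \<alpha> p y + \<omega> (p, y)\<close> are logarithms of one vector off a connected cut
  complement, so they differ by a constant \<open>M p\<close>. Tameness in the charts
  \<open>\<psi>\<close> and \<open>g \<circ> \<psi>\<close> makes \<open>M\<close> locally constant
  in \<open>p\<close>. In \<open>gap\<close> both \<open>M\<close> and the symmetric
  \<open>\<omega>\<close> cancel.\<close>

lemma gap_automorphism:
  assumes \<alpha>: "tame_branches \<alpha>" and g: "leaf_automorphism g"
    and deg: "degree_with g k \<omega>" and sym: "\<And>u v. u \<noteq> v \<Longrightarrow> \<omega> (u, v) = \<omega> (v, u)"
    and pq: "\<not> same_leaf p q"
  shows "gap \<alpha> (g p) (g q) = of_int k * gap \<alpha> p q"
proof -
  have br: "branches \<alpha>" and tame: "\<And>\<psi>. chart \<psi> \<Longrightarrow> tame \<alpha> \<psi>" using \<alpha> by (auto simp: tame_branches_def)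
  have c\<omega>: "continuous_on {(u, v). u \<noteq> v} \<omega>" using deg by (simp add: degree_with_def)
  have gout: "g y \<notin> half_leaf (g p)" if "y \<notin> half_leaf p" for p y
    using that aut_half_leaf[OF g] aut_eq_iff[OF g] by auto
  have expeq: "exp (\<alpha> (g p) (g y)) = exp (of_int k * \<alpha> p y + \<omega> (p, y))" if y: "y \<notin> half_leaf p" for p y
  proof -
    have "p \<noteq> y" using y by auto
    then show ?thesis
      using branchesD(2)[OF br y] branchesD(2)[OF br gout[OF y]] degree_withD[OF deg, of p y]
      by (simp add: exp_add exp_of_int_mult)
  qed
  have "\<exists>M. \<forall>y. y \<notin> half_leaf p \<longrightarrow> \<alpha> (g p) (g y) - (of_int k * \<alpha> p y + \<omega> (p, y)) = M" for p
  proof -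
    have "continuous_on (- half_leaf p) (\<lambda>y. \<alpha> (g p) (g y))"
      by (rule continuous_on_compose2[OF branchesD(1)[OF br] continuous_on_subset[OF aut_continuous[OF g]]])
         (use gout in auto)
    moreover have "continuous_on (- half_leaf p) (\<lambda>y. of_int k * \<alpha> p y + \<omega> (p, y))"
      by (intro continuous_intros branchesD(1)[OF br] continuous_on_compose2[OF c\<omega>]) auto
    ultimately have c: "continuous_on (- half_leaf p) (\<lambda>y. \<alpha> (g p) (g y) - (of_int k * \<alpha> p y + \<omega> (p, y)))"
      by (rule continuous_on_diff)
    have e1: "exp (\<alpha> (g p) (g y) - (of_int k * \<alpha> p y + \<omega> (p, y))) = 1" if "y \<in> - half_leaf p" for y
    proof -
      have "y \<notin> half_leaf p" using that by simp
      then show ?thesis unfolding exp_diff using expeq by simp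
    qed
    then obtain M where "\<And>y. y \<in> - half_leaf p \<Longrightarrow> \<alpha> (g p) (g y) - (of_int k * \<alpha> p y + \<omega> (p, y)) = M"
      using exp_const_imp_constant[OF connected_compl_half_leaf c, of 1] e1 by blast
    then show ?thesis by (intro exI[of _ M]) auto
  qed
  then obtain M where M: "\<And>p y. y \<notin> half_leaf p \<Longrightarrow> \<alpha> (g p) (g y) - (of_int k * \<alpha> p y + \<omega> (p, y)) = M p"
    by metis
  have local_const: "M x = M (\<psi> 0)" if \<psi>: "chart \<psi>" and "x \<in> range \<psi>" for \<psi> x
  proof -
    \<comment> \<open>Evaluating one unit behind the base point in the chart expresses
      \<open>M (\<psi> z)\<close> through quantities continuous in \<open>z\<close>.\<close>
    define X where "X z = (z, Re z - 1)" for z :: complex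
    have X: "X z \<in> leftward" for z by (simp add: X_def leftward_def)
    have cX: "continuous_on UNIV X" unfolding X_def by (intro continuous_intros)
    have cl: "continuous_on UNIV (\<lambda>z. \<psi> (left_point (X z)))"
      by (rule continuous_on_compose2[OF chart_continuous[OF \<psi>]])
         (auto intro!: continuous_on_compose2[OF continuous_left_point cX])
    have lp: "\<psi> (left_point (X z)) \<notin> half_leaf (\<psi> z)" for z
      using left_point_not_half_leaf[OF \<psi> X] by (simp add: X_def)
    have ne: "\<psi> z \<noteq> \<psi> (left_point (X z))" for z using lp[of z] by (metis self_in_half_leaf)
    have t: "continuous_on UNIV (\<lambda>z. \<alpha> (\<phi> z) (\<phi> (left_point (X z))))" if "chart \<phi>" for \<phi>
      using continuous_on_compose2[OF tame[OF that, unfolded tame_def] cX] X by (auto simp: X_def)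
    define h where "h z = \<alpha> (g (\<psi> z)) (g (\<psi> (left_point (X z)))) - (of_int k * \<alpha> (\<psi> z) (\<psi> (left_point (X z))) + \<omega> (\<psi> z, \<psi> (left_point (X z))))" for z
    have "continuous_on UNIV (\<lambda>z. \<omega> (\<psi> z, \<psi> (left_point (X z))))"
      by (rule continuous_on_compose2[OF c\<omega>]) (use ne in \<open>auto intro!: continuous_intros cl chart_continuous[OF \<psi>]\<close>)
    then have ch: "continuous_on UNIV h"
      unfolding h_def using t[OF aut_chart[OF g \<psi>]] t[OF \<psi>]
      by (intro continuous_on_diff continuous_on_add continuous_on_mult continuous_on_const) (auto simp: comp_def)
    have hM: "h z = M (\<psi> z)" for z unfolding h_def by (rule M[OF lp])
    have "exp (h z) = 1" for z
      unfolding h_def exp_diff using expeq[OF lp] by simp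
    then obtain c where "\<And>z. z \<in> UNIV \<Longrightarrow> h z = c"
      using exp_const_imp_constant[OF connected_UNIV ch, of 1] by blast
    then show ?thesis using hM \<open>x \<in> range \<psi>\<close> by auto
  qed
  have "M q = M p"
  proof (rule locally_constant_imp_constant[OF connected_UNIV, where f = M])
    fix a
    obtain \<psi> where \<psi>: "chart \<psi>" "a \<in> range \<psi>" using chart_exists by blast
    have "\<forall>\<^sub>F b in nhds a. b \<in> range \<psi>" by (rule eventually_nhds_in_open[OF chart_range_open[OF \<psi>(1)] \<psi>(2)])
    then show "\<forall>\<^sub>F b in nhds a. b \<in> UNIV \<longrightarrow> M b = M a"
      by eventually_elim (use local_const[OF \<psi>(1)] \<psi>(2) in metis)
  qed auto
  have out: "q \<notin> half_leaf p" "p \<notin> half_leaf q" using pq half_leaf_same_leaf same_leaf_sym by blast+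
  have "\<alpha> (g p) (g q) = of_int k * \<alpha> p q + \<omega> (p, q) + M p" "\<alpha> (g q) (g p) = of_int k * \<alpha> q p + \<omega> (q, p) + M q"
    using M[OF out(1)] M[OF out(2)] by (simp_all add: algebra_simps)
  moreover have "\<omega> (p, q) = \<omega> (q, p)" using sym[of p q] pq same_leaf_refl by blast
  ultimately show ?thesis using \<open>M q = M p\<close> by (simp add: gap_def algebra_simps)
qed

end

section \<open>Charts for both foliations and the degree of automorphisms\<close>

definition flip :: "complex \<Rightarrow> complex" where
  "flip z = Complex (Im z) (Re z)"

text \<open>A chart that straightens both oriented foliations at once determines an orientation of
  the plane, and this is what the degree detects.\<close>

locale transverse_leaves = F1: oriented_leaves \<Gamma>\<^sub>1 + F2: oriented_leaves \<Gamma>\<^sub>2 for \<Gamma>\<^sub>1 \<Gamma>\<^sub>2 +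
  assumes bichart_exists: "\<exists>\<psi>. F1.chart \<psi> \<and> F2.chart (\<psi> \<circ> flip) \<and> p \<in> range \<psi>"
begin

sublocale F1: charted_leaves \<Gamma>\<^sub>1
proof
  show "\<exists>\<psi>. F1.chart \<psi> \<and> p \<in> range \<psi>" for p using bichart_exists[of p] by metis
qed

definition bichart :: "(complex \<Rightarrow> complex) \<Rightarrow> bool" where
  "bichart \<psi> \<longleftrightarrow> F1.chart \<psi> \<and> F2.chart (\<psi> \<circ> flip)"

text \<open>The transition map \<open>T\<close> preserves oriented horizontal and vertical segments,
  so near \<open>u\<close> it increases each coordinate separately, and \<open>T v - T u\<close> has
  positive inner product with \<open>v - u\<close>. Hence \<open>degree_local\<close>
  applies.\<close>

lemma bichart_degree_eq:
  assumes \<psi>: "bichart \<psi>" "degree_with \<psi> k \<omega>" and \<psi>': "bichart \<psi>'" "degree_with \<psi>' k' \<omega>'"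
    and x: "x \<in> range \<psi>" "x \<in> range \<psi>'"
  shows "k' = k"
proof -
  have c: "F1.chart \<psi>" "F1.chart \<psi>'" "F2.chart (\<psi> \<circ> flip)" "F2.chart (\<psi>' \<circ> flip)"
    using \<psi>(1) \<psi>'(1) by (auto simp: bichart_def)
  define T where "T v = inv_into UNIV \<psi> (\<psi>' v)" for v
  define V where "V = \<psi>' -` range \<psi>"
  have oV: "open V" unfolding V_def
    using F1.chart_continuous[OF c(2)] F1.chart_range_open[OF c(1)] by (auto simp: continuous_on_open_vimage)
  obtain u where u: "x = \<psi>' u" using x(2) by auto
  then have "u \<in> V" using x(1) by (simp add: V_def)
  then obtain r where r: "r > 0" "cball u r \<subseteq> V" using oV open_contains_cball by blast
  have T: "\<psi> (T v) = \<psi>' v" if "v \<in> V" for v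
    using that by (auto simp: T_def V_def f_inv_into_f)
  have Ti: "T v = w" if "\<psi>' v = \<psi> w" for v w
    using that F1.chart_inj[OF c(1)] by (simp add: T_def)
  have hor: "Re (T (Complex a b)) < Re (T (Complex a' b)) \<and> Im (T (Complex a b)) = Im (T (Complex a' b))"
    if ab: "a < a'" "\<And>y. a \<le> y \<Longrightarrow> y \<le> a' \<Longrightarrow> Complex y b \<in> V" for a a' b
  proof -
    have "hseg \<psi>' a a' b \<subseteq> range \<psi>" using ab(2) by (auto simp: hseg_def V_def)
    then obtain e e' d where "e < e'" "\<psi>' (Complex a b) = \<psi> (Complex e d)" "\<psi>' (Complex a' b) = \<psi> (Complex e' d)"
      by (rule F1.chart_transition[OF c(1,2) ab(1)])
    then show ?thesis using Ti by simp
  qed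
  have ver: "Im (T (Complex b a)) < Im (T (Complex b a')) \<and> Re (T (Complex b a)) = Re (T (Complex b a'))"
    if ab: "a < a'" "\<And>y. a \<le> y \<Longrightarrow> y \<le> a' \<Longrightarrow> Complex b y \<in> V" for a a' b
  proof -
    have "hseg (\<psi>' \<circ> flip) a a' b \<subseteq> range (\<psi> \<circ> flip)"
    proof
      fix w assume "w \<in> hseg (\<psi>' \<circ> flip) a a' b"
      then have "w \<in> range \<psi>" using ab(2) by (auto simp: hseg_def V_def flip_def)
      then obtain v where "w = \<psi> v" by auto
      then have "w = (\<psi> \<circ> flip) (flip v)" by (simp add: flip_def)
      then show "w \<in> range (\<psi> \<circ> flip)" by blast
    qed
    then obtain e e' d where "e < e'" "(\<psi>' \<circ> flip) (Complex a b) = (\<psi> \<circ> flip) (Complex e d)" "(\<psi>' \<circ> flip) (Complex a' b) = (\<psi> \<circ> flip) (Complex e' d)"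
      by (rule F2.chart_transition[OF c(3,4) ab(1)])
    then show ?thesis using Ti by (simp add: flip_def)
  qed
  show ?thesis
  proof (rule degree_local[OF \<psi>(2) \<psi>'(2) r(1), of u T])
    show "continuous_on (cball u r) T" unfolding T_def
      by (rule continuous_on_compose2[OF F1.chart_inv_continuous[OF c(1)] continuous_on_subset[OF F1.chart_continuous[OF c(2)]]])
         (use r(2) in \<open>auto simp: V_def\<close>)
    show "\<psi>' v = \<psi> (T v)" if "v \<in> cball u r" for v using T r(2) that by auto
    fix v assume v: "v \<in> sphere u r"
    \<comment> \<open>A corner of the coordinate rectangle spanned by \<open>u\<close> and
      \<open>v\<close>: a horizontal and a vertical side lead from \<open>u\<close> to
      \<open>v\<close> through it without leaving the disc.\<close>
    define w where "w = Complex (Re v) (Im u)"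
    have near: "Complex a b \<in> V" if "\<bar>a - Re u\<bar> \<le> \<bar>Re v - Re u\<bar>" "\<bar>b - Im u\<bar> \<le> \<bar>Im v - Im u\<bar>" for a b
    proof -
      have "cmod (Complex a b - u) \<le> cmod (v - u)"
        unfolding cmod_def using that by (intro real_sqrt_le_mono add_mono) (simp_all add: abs_le_square_iff)
      also have "\<dots> = r" using v by (simp add: dist_norm norm_minus_commute)
      finally show ?thesis using r(2) by (auto simp: dist_norm norm_minus_commute)
    qed
    have Tw: "Im (T w) = Im (T u) \<and> (Re v = Re u \<and> Re (T w) = Re (T u) \<or> 0 < (Re v - Re u) * (Re (T w) - Re (T u)))"
    proof (cases "Re v" "Re u" rule: linorder_cases)
      case less
      have "Re (T (Complex (Re v) (Im u))) < Re (T (Complex (Re u) (Im u))) \<and> Im (T (Complex (Re v) (Im u))) = Im (T (Complex (Re u) (Im u)))"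
        by (rule hor[OF less near]) auto
      then show ?thesis using less by (simp add: w_def mult_neg_neg)
    next
      case equal
      then show ?thesis by (simp add: w_def)
    next
      case greater
      have "Re (T (Complex (Re u) (Im u))) < Re (T (Complex (Re v) (Im u))) \<and> Im (T (Complex (Re u) (Im u))) = Im (T (Complex (Re v) (Im u)))"
        by (rule hor[OF greater near]) auto
      then show ?thesis using greater by (simp add: w_def)
    qed
    have Tv: "Re (T v) = Re (T w) \<and> (Im v = Im u \<and> Im (T v) = Im (T w) \<or> 0 < (Im v - Im u) * (Im (T v) - Im (T w)))"
    proof (cases "Im v" "Im u" rule: linorder_cases)
      case less
      have "Im (T (Complex (Re v) (Im v))) < Im (T (Complex (Re v) (Im u))) \<and> Re (T (Complex (Re v) (Im v))) = Re (T (Complex (Re v) (Im u)))"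
        by (rule ver[OF less near]) auto
      then show ?thesis using less by (simp add: w_def mult_neg_neg)
    next
      case equal
      then show ?thesis unfolding w_def by (simp flip: equal)
    next
      case greater
      have "Im (T (Complex (Re v) (Im u))) < Im (T (Complex (Re v) (Im v))) \<and> Re (T (Complex (Re v) (Im u))) = Re (T (Complex (Re v) (Im v)))"
        by (rule ver[OF greater near]) auto
      then show ?thesis using greater by (simp add: w_def)
    qed
    have "v \<noteq> u" using v r(1) by auto
    then have "Re v \<noteq> Re u \<or> Im v \<noteq> Im u" using complex_eqI by blast
    \<comment> \<open>This inner product is the numerator of the real part of
      \<open>(T v - T u) / (v - u)\<close>.\<close>
    then have "0 < (Re v - Re u) * (Re (T v) - Re (T u)) + (Im v - Im u) * (Im (T v) - Im (T u))"
      using Tw Tv by (auto intro: add_pos_pos)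
    moreover have "0 < (Re (v - u))\<^sup>2 + (Im (v - u))\<^sup>2"
      using \<open>v \<noteq> u\<close> by (simp add: sum_power2_gt_zero_iff complex_eq_iff)
    ultimately show "0 < Re ((T v - T u) / (v - u))"
      unfolding Re_divide by (intro divide_pos_pos) (auto simp: mult.commute)
  qed
qed

text \<open>Chart degrees are locally constant, hence all equal to one odd number; \<open>g\<close>
  turns a chart of degree \<open>d 0\<close> into a chart of degree \<open>k * d 0\<close>. Equality
  of the two and \<open>d 0 \<noteq> 0\<close> give the claim.\<close>

lemma automorphism_degree_one:
  assumes g: "F1.leaf_automorphism g" "F2.leaf_automorphism g" and deg: "degree_with g k \<omega>"
  shows "k = 1"
proof -
  obtain B where B: "\<And>x. bichart (B x)" "\<And>x. x \<in> range (B x)"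
    using bichart_exists unfolding bichart_def by metis
  have ci: "continuous_on UNIV \<psi>" "inj \<psi>" if "bichart \<psi>" for \<psi>
    using that F1.chart_continuous F1.chart_inj by (auto simp: bichart_def)
  have "\<exists>d \<eta>. degree_with (B x) d \<eta> \<and> odd d" for x
    using degree_exists[OF ci[OF B(1)]] by metis
  then obtain d \<eta> where d: "\<And>x. degree_with (B x) (d x) (\<eta> x)" "\<And>x. odd (d x)" by metis
  have "d (g 0) = d 0"
  proof (rule locally_constant_imp_constant[OF connected_UNIV, where f = d])
    fix a
    have "open (range (B a))" using B(1)[of a] F1.chart_range_open by (simp add: bichart_def)
    then have "\<forall>\<^sub>F b in nhds a. b \<in> range (B a)" using B(2) by (intro eventually_nhds_in_open)
    then show "\<forall>\<^sub>F b in nhds a. b \<in> UNIV \<longrightarrow> d b = d a"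
    proof eventually_elim
      case (elim b)
      show ?case using bichart_degree_eq[OF B(1) d(1) B(1) d(1) B(2)[of b] elim] by simp
    qed
  qed auto
  obtain \<zeta> where "degree_with (g \<circ> B 0) (k * d 0) \<zeta>"
    by (rule degree_compose[OF deg d(1) ci[OF B(1)]])
  moreover have "bichart (g \<circ> B 0)"
    using B(1)[of 0] F1.aut_chart[OF g(1), of "B 0"] F2.aut_chart[OF g(2), of "B 0 \<circ> flip"]
    by (simp add: bichart_def comp_assoc)
  moreover have "g 0 \<in> range (g \<circ> B 0)"
  proof -
    have "g 0 \<in> g ` range (B 0)" using B(2)[of 0] by (rule imageI)
    then show ?thesis by (simp only: image_comp)
  qed
  ultimately have "d (g 0) = k * d 0"
    by (intro bichart_degree_eq[OF _ _ B(1) d(1) _ B(2)])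
  then have "(k - 1) * d 0 = 0" using \<open>d (g 0) = d 0\<close> by (simp add: algebra_simps)
  moreover have "d 0 \<noteq> 0" using d(2)[of 0] by auto
  ultimately show ?thesis by simp
qed

lemma invariant_order:
  obtains less where "\<And>p. \<not> less p p" "\<And>p q r. less p q \<Longrightarrow> less q r \<Longrightarrow> less p r"
    "\<And>p q. p \<noteq> q \<Longrightarrow> less p q \<or> less q p"
    "\<And>g p q. F1.leaf_automorphism g \<Longrightarrow> F2.leaf_automorphism g \<Longrightarrow> less p q \<Longrightarrow> less (g p) (g q)"
proof -
  obtain \<alpha> where \<alpha>: "F1.tame_branches \<alpha>" using F1.tame_branches_exist by blast
  then have br: "F1.branches \<alpha>" by (simp add: F1.tame_branches_def)
  have inv: "F1.leaf_less \<alpha> (g p) (g q)" if g: "F1.leaf_automorphism g" "F2.leaf_automorphism g" "F1.leaf_less \<alpha> p q" for g p q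
  proof -
    obtain k \<omega> where k: "degree_with g k \<omega>" "\<And>u v. u \<noteq> v \<Longrightarrow> \<omega> (u, v) = \<omega> (v, u)"
      using degree_exists[OF F1.aut_continuous[OF g(1)] F1.aut_inj[OF g(1)]] by metis
    have "k = 1" by (rule automorphism_degree_one[OF g(1,2) k(1)])
    then have "F1.gap \<alpha> (g p) (g q) = F1.gap \<alpha> p q" if "\<not> F1.same_leaf p q"
      using F1.gap_automorphism[OF \<alpha> g(1) k that] by simp
    then show ?thesis using g(3) F1.aut_before[OF g(1)] F1.aut_same_leaf[OF g(1)]
      by (auto simp: F1.leaf_less_def)
  qed
  show ?thesis
  proof (rule that[of "F1.leaf_less \<alpha>"])
    show "\<not> F1.leaf_less \<alpha> p p" for p by (rule F1.leaf_less_irrefl)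
    show "F1.leaf_less \<alpha> p r" if "F1.leaf_less \<alpha> p q" "F1.leaf_less \<alpha> q r" for p q r
      by (rule F1.leaf_less_trans[OF \<alpha> that])
    show "F1.leaf_less \<alpha> p q \<or> F1.leaf_less \<alpha> q p" if "p \<noteq> q" for p q
      by (rule F1.leaf_less_total[OF br that])
  qed (rule inv)
qed

end

section \<open>Orienting charts\<close>

definition reflect :: "real \<Rightarrow> real \<Rightarrow> complex \<Rightarrow> complex" where
  "reflect c d z = Complex (c * Re z) (d * Im z)"

lemma reflect_reflect: "c \<in> {1, -1} \<Longrightarrow> d \<in> {1, -1} \<Longrightarrow> reflect c d (reflect c d z) = z"
  by (auto simp: reflect_def)

locale embedded_leaves = oriented_leaves +
  assumes leaf_inv_continuous: "\<gamma> \<in> \<Gamma> \<Longrightarrow> continuous_on (range \<gamma>) (inv_into UNIV \<gamma>)"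
begin

text \<open>What a foliated chart provides before its direction is known. A chart adapted to both
  foliations says nothing about orientations, and a chart witnessing one orientation need not be
  adapted to the other foliation; this common form lets them be compared.\<close>

definition unoriented_chart :: "(complex \<Rightarrow> complex) \<Rightarrow> bool" where
  "unoriented_chart \<psi> \<longleftrightarrow> continuous_on UNIV \<psi> \<and> inj \<psi> \<and>
     (\<forall>b. \<exists>\<gamma>\<in>\<Gamma>. \<forall>u. \<psi> (Complex u b) \<in> range \<gamma>) \<and>
     (\<forall>\<gamma>\<in>\<Gamma>. \<forall>s t. s < t \<and> \<gamma> ` {s..t} \<subseteq> range \<psi> \<longrightarrow>
        (\<exists>a a' b. \<gamma> s = \<psi> (Complex a b) \<and> \<gamma> t = \<psi> (Complex a' b)))"

definition rising :: "(complex \<Rightarrow> complex) \<Rightarrow> real \<Rightarrow> bool" where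
  "rising \<psi> b \<longleftrightarrow> (\<forall>a a'. a < a' \<longrightarrow> before (\<psi> (Complex a b)) (\<psi> (Complex a' b)))"

definition falling :: "(complex \<Rightarrow> complex) \<Rightarrow> real \<Rightarrow> bool" where
  "falling \<psi> b \<longleftrightarrow> (\<forall>a a'. a < a' \<longrightarrow> before (\<psi> (Complex a' b)) (\<psi> (Complex a b)))"

lemma before_asym: "before p q \<Longrightarrow> \<not> before q p"
proof
  assume pq: "before p q" and qp: "before q p"
  obtain \<gamma> s t where "\<gamma> \<in> \<Gamma>" "s < t" "\<gamma> s = p" "\<gamma> t = q" using pq by (auto simp: before_def)
  then show False using qp before_iff[of \<gamma> t s] by auto
qed

lemma horizontal_param:
  assumes \<psi>: "unoriented_chart \<psi>"
  obtains \<gamma> \<tau> where "\<gamma> \<in> \<Gamma>" "continuous_on UNIV \<tau>" "inj \<tau>" "\<forall>u. \<psi> (Complex u b) = \<gamma> (\<tau> u)"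
proof -
  obtain \<gamma> where \<gamma>: "\<gamma> \<in> \<Gamma>" "\<And>u. \<psi> (Complex u b) \<in> range \<gamma>"
    using \<psi> unfolding unoriented_chart_def by meson
  define \<tau> where "\<tau> u = inv_into UNIV \<gamma> (\<psi> (Complex u b))" for u
  have eq: "\<psi> (Complex u b) = \<gamma> (\<tau> u)" for u using \<gamma>(2)[of u] by (simp add: \<tau>_def f_inv_into_f)
  have "continuous_on UNIV (\<lambda>u. \<psi> (Complex u b))"
    by (rule continuous_on_compose2[of UNIV \<psi>])
       (use \<psi> in \<open>auto simp: unoriented_chart_def Complex_eq intro!: continuous_intros\<close>)
  then have "continuous_on UNIV \<tau>" unfolding \<tau>_def
    by (rule continuous_on_compose2[OF leaf_inv_continuous[OF \<gamma>(1)]]) (use \<gamma>(2) in auto)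
  moreover have "inj \<tau>"
  proof (rule injI)
    fix u v assume "\<tau> u = \<tau> v"
    then have "\<psi> (Complex u b) = \<psi> (Complex v b)" by (simp add: eq)
    then have "Complex u b = Complex v b" using \<psi> by (auto simp: unoriented_chart_def dest: injD)
    then show "u = v" by simp
  qed
  ultimately show ?thesis using that \<gamma>(1) eq by blast
qed

text \<open>Along a horizontal line the leaf parameter is a continuous injective function of a real
  variable, hence strictly monotone.\<close>

lemma rising_or_falling:
  assumes "unoriented_chart \<psi>"
  shows "rising \<psi> b \<or> falling \<psi> b"
proof -
  obtain \<gamma> \<tau> where \<gamma>: "\<gamma> \<in> \<Gamma>" "continuous_on UNIV \<tau>" "inj \<tau>" "\<forall>u. \<psi> (Complex u b) = \<gamma> (\<tau> u)"
    by (rule horizontal_param[OF assms, of b])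
  have "strict_mono_on UNIV \<tau> \<or> strict_antimono_on UNIV \<tau>"
    using injective_eq_monotone_map[of UNIV \<tau>] \<gamma>(2,3) by simp
  then show ?thesis
    using before_iff[OF \<gamma>(1)] by (auto simp: rising_def falling_def \<gamma>(4) monotone_on_def)
qed

lemma hseg_arc:
  assumes "unoriented_chart \<psi>" "a < a'"
  obtains \<gamma> s t where "\<gamma> \<in> \<Gamma>" "s < t" "\<gamma> ` {s..t} = hseg \<psi> a a' b"
proof -
  obtain \<gamma> \<tau> where \<gamma>: "\<gamma> \<in> \<Gamma>" "continuous_on UNIV \<tau>" "inj \<tau>" "\<forall>u. \<psi> (Complex u b) = \<gamma> (\<tau> u)"
    by (rule horizontal_param[OF assms(1), of b])
  obtain s t where st: "\<tau> ` {a..a'} = {s..t}" "s \<le> t"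
    using continuous_image_closed_interval[of a a' \<tau>] assms(2) continuous_on_subset[OF \<gamma>(2)] by auto
  have "\<tau> a \<noteq> \<tau> a'" using \<gamma>(3) assms(2) by (auto dest: injD)
  moreover have "\<tau> a \<in> {s..t}" "\<tau> a' \<in> {s..t}" unfolding st(1)[symmetric] using assms(2) by auto
  ultimately have "s < t" using st(2) by auto
  moreover have "\<gamma> ` {s..t} = hseg \<psi> a a' b"
    unfolding st(1)[symmetric] hseg_def image_image by (simp add: \<gamma>(4))
  ultimately show ?thesis using that \<gamma>(1) by blast
qed

lemma unoriented_chart_arc:
  assumes "unoriented_chart \<psi>" "\<gamma> \<in> \<Gamma>" "s < t" "\<gamma> ` {s..t} \<subseteq> range \<psi>"
  obtains a a' b where "\<gamma> s = \<psi> (Complex a b)" "\<gamma> t = \<psi> (Complex a' b)"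
  using assms unfolding unoriented_chart_def by metis

lemma chart_if_rising:
  assumes \<psi>: "unoriented_chart \<psi>" and ris: "\<And>b. rising \<psi> b"
  shows "chart \<psi>"
  unfolding chart_def
proof (intro conjI allI impI ballI)
  show "continuous_on UNIV \<psi>" "inj \<psi>" using \<psi> by (auto simp: unoriented_chart_def)
next
  fix a a' b :: real assume aa: "a < a'"
  obtain \<gamma> s t where \<gamma>: "\<gamma> \<in> \<Gamma>" "s < t" "\<gamma> ` {s..t} = hseg \<psi> a a' b"
    by (rule hseg_arc[OF \<psi> aa])
  have mono: "u \<le> v" if "\<gamma> x = \<psi> (Complex u b)" "\<gamma> y = \<psi> (Complex v b)" "x \<le> y" for x y u v
  proof (rule ccontr)
    assume "\<not> u \<le> v"
    then have "before (\<psi> (Complex v b)) (\<psi> (Complex u b))" using ris by (auto simp: rising_def)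
    then show False using that before_iff[OF \<gamma>(1), of y x] by simp
  qed
  have "\<gamma> s \<in> hseg \<psi> a a' b" "\<gamma> t \<in> hseg \<psi> a a' b" unfolding \<gamma>(3)[symmetric] using \<gamma>(2) by auto
  then obtain u v where u: "\<gamma> s = \<psi> (Complex u b)" "a \<le> u" and v: "\<gamma> t = \<psi> (Complex v b)" "v \<le> a'"
    by (auto simp: hseg_def)
  have "\<psi> (Complex a b) \<in> \<gamma> ` {s..t}" "\<psi> (Complex a' b) \<in> \<gamma> ` {s..t}"
    unfolding \<gamma>(3) hseg_def using aa by auto
  then obtain x y where x: "\<psi> (Complex a b) = \<gamma> x" "s \<le> x" and y: "\<psi> (Complex a' b) = \<gamma> y" "y \<le> t"
    by auto
  \<comment> \<open>For each end one inequality comes from its place in the segment, the opposite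
    one from monotonicity along the leaf.\<close>
  have "u = a" "v = a'"
    using mono[OF u(1) x(1)[symmetric] x(2)] mono[OF y(1)[symmetric] v(1) y(2)] u(2) v(2) by auto
  then show "\<exists>\<gamma>\<in>\<Gamma>. \<exists>s t. s < t \<and> \<gamma> s = \<psi> (Complex a b) \<and> \<gamma> t = \<psi> (Complex a' b) \<and> \<gamma> ` {s..t} = hseg \<psi> a a' b"
    using \<gamma> u(1) v(1) by (intro bexI[of _ \<gamma>] exI[of _ s] exI[of _ t]) auto
next
  fix \<gamma> and s t :: real assume \<gamma>: "\<gamma> \<in> \<Gamma>" and st: "s < t \<and> \<gamma> ` {s..t} \<subseteq> range \<psi>"
  then obtain a a' b where ab: "\<gamma> s = \<psi> (Complex a b)" "\<gamma> t = \<psi> (Complex a' b)"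
    using unoriented_chart_arc[OF \<psi> \<gamma>] by metis
  have "before (\<gamma> s) (\<gamma> t)" using st before_iff[OF \<gamma>] by simp
  have "a < a'"
  proof (rule ccontr)
    assume "\<not> a < a'"
    then consider "a = a'" | "a' < a" by linarith
    then show False
    proof cases
      case 1
      then show False using ab st injD[OF leaf_inj[OF \<gamma>], of s t] by simp
    next
      case 2
      then have "before (\<gamma> t) (\<gamma> s)" using ris ab by (simp add: rising_def)
      then show False using before_asym \<open>before (\<gamma> s) (\<gamma> t)\<close> by blast
    qed
  qed
  then show "\<exists>a a' b. a < a' \<and> \<gamma> s = \<psi> (Complex a b) \<and> \<gamma> t = \<psi> (Complex a' b)" using ab by blast
qed

lemma horizontal_transition:
  assumes \<psi>: "unoriented_chart \<psi>" and \<phi>: "unoriented_chart \<phi>" and "a < a'" "hseg \<psi> a a' b \<subseteq> range \<phi>"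
  shows "Im (inv_into UNIV \<phi> (\<psi> (Complex a b))) = Im (inv_into UNIV \<phi> (\<psi> (Complex a' b)))"
proof -
  have i: "inj \<phi>" using \<phi> by (simp add: unoriented_chart_def)
  obtain \<gamma> s t where \<gamma>: "\<gamma> \<in> \<Gamma>" "s < t" "\<gamma> ` {s..t} = hseg \<psi> a a' b"
    by (rule hseg_arc[OF \<psi> \<open>a < a'\<close>])
  have le: "Im (inv_into UNIV \<phi> (\<gamma> x)) = Im (inv_into UNIV \<phi> (\<gamma> y))" if xy: "s \<le> x" "x < y" "y \<le> t" for x y
  proof -
    have "\<gamma> ` {x..y} \<subseteq> \<gamma> ` {s..t}" using xy by (intro image_mono) auto
    then have "\<gamma> ` {x..y} \<subseteq> range \<phi>" using \<gamma>(3) assms(4) by simp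
    then obtain c c' d where "\<gamma> x = \<phi> (Complex c d)" "\<gamma> y = \<phi> (Complex c' d)"
      by (rule unoriented_chart_arc[OF \<phi> \<gamma>(1) xy(2)])
    then show ?thesis using i by simp
  qed
  have "\<psi> (Complex a b) \<in> \<gamma> ` {s..t}" "\<psi> (Complex a' b) \<in> \<gamma> ` {s..t}"
    unfolding \<gamma>(3) hseg_def using assms(3) by auto
  then obtain x y where xy: "\<psi> (Complex a b) = \<gamma> x" "\<psi> (Complex a' b) = \<gamma> y" "x \<in> {s..t}" "y \<in> {s..t}"
    by blast
  have "Im (inv_into UNIV \<phi> (\<gamma> x)) = Im (inv_into UNIV \<phi> (\<gamma> y))"
  proof (cases x y rule: linorder_cases)
    case less
    then show ?thesis using xy(3,4) by (intro le) simp_all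
  next
    case greater
    then have "Im (inv_into UNIV \<phi> (\<gamma> y)) = Im (inv_into UNIV \<phi> (\<gamma> x))" using xy(3,4) by (intro le) simp_all
    then show ?thesis by (rule sym)
  qed simp
  then show ?thesis by (simp only: xy(1,2))
qed

text \<open>The direction could still vary with the height. Comparison with a rising chart
  \<open>\<phi>\<close> excludes this: the displacement of a short horizontal segment, read in
  \<open>\<phi>\<close>, is continuous in the height and never zero, so its sign is locally
  constant.\<close>

lemma rising_constant:
  assumes \<psi>: "unoriented_chart \<psi>"
    and orient: "\<And>p. \<exists>\<phi>. unoriented_chart \<phi> \<and> (\<forall>b. rising \<phi> b) \<and> p \<in> range \<phi>"
  shows "(\<forall>b. rising \<psi> b) \<or> (\<forall>b. falling \<psi> b)"
proof -
  have c\<psi>: "continuous_on UNIV \<psi>" and i\<psi>: "inj \<psi>" using \<psi> by (auto simp: unoriented_chart_def)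
  have "rising \<psi> b = rising \<psi> 0" for b
  proof (rule locally_constant_imp_constant[OF connected_UNIV, where f = "rising \<psi>"])
    fix b0 :: real
    obtain \<phi> where \<phi>: "unoriented_chart \<phi>" "\<And>b. rising \<phi> b" "\<psi> (Complex 0 b0) \<in> range \<phi>"
      using orient by blast
    have ch: "chart \<phi>" by (rule chart_if_rising[OF \<phi>(1,2)])
    have "open (\<psi> -` range \<phi>)" using c\<psi> chart_range_open[OF ch] by (auto simp: continuous_on_open_vimage)
    moreover have "Complex 0 b0 \<in> \<psi> -` range \<phi>" using \<phi>(3) by simp
    ultimately obtain e where e: "e > 0" "ball (Complex 0 b0) e \<subseteq> \<psi> -` range \<phi>" using open_contains_ball by blast
    define \<eta> where "\<eta> = e / 2"
    have \<eta>: "\<eta> > 0" using e(1) by (simp add: \<eta>_def)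
    define I where "I = {b0 - \<eta> <..< b0 + \<eta>}"
    have box: "\<psi> (Complex u b) \<in> range \<phi>" if "0 \<le> u" "u \<le> \<eta>" "b \<in> I" for u b
    proof -
      have "\<bar>u\<bar> + \<bar>b - b0\<bar> < e" using that by (auto simp: I_def \<eta>_def)
      then have "cmod (Complex u b - Complex 0 b0) < e"
        using cmod_le[of "Complex u b - Complex 0 b0"] by simp
      then have "Complex u b \<in> ball (Complex 0 b0) e" by (simp only: mem_ball dist_norm norm_minus_commute)
      then show ?thesis using e(2) by blast
    qed
    \<comment> \<open>The ends of the segment have the same height in \<open>\<phi>\<close> and are
      distinct, so this difference of abscissas cannot vanish.\<close>
    define D where "D b = Re (inv_into UNIV \<phi> (\<psi> (Complex \<eta> b))) - Re (inv_into UNIV \<phi> (\<psi> (Complex 0 b)))" for b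
    have ci: "continuous_on I (\<lambda>b. inv_into UNIV \<phi> (\<psi> (Complex u b)))" if "0 \<le> u" "u \<le> \<eta>" for u
    proof (rule continuous_on_compose2[OF chart_inv_continuous[OF ch]])
      show "continuous_on I (\<lambda>b. \<psi> (Complex u b))"
        unfolding Complex_eq by (rule continuous_on_compose2[OF c\<psi>]) (auto intro!: continuous_intros)
    qed (use box[OF that] in auto)
    have cD: "continuous_on I D" unfolding D_def using \<eta>
      by (intro continuous_intros ci) auto
    have sgnD: "(rising \<psi> b \<longleftrightarrow> 0 < D b) \<and> D b \<noteq> 0" if b: "b \<in> I" for b
    proof -
      define z where "z u = inv_into UNIV \<phi> (\<psi> (Complex u b))" for u
      have pz: "\<psi> (Complex u b) = \<phi> (z u)" if "0 \<le> u" "u \<le> \<eta>" for u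
        using box[OF that b] by (simp add: z_def f_inv_into_f)
      have Im: "Im (z 0) = Im (z \<eta>)" unfolding z_def
        using box b by (intro horizontal_transition[OF \<psi> \<phi>(1) \<eta>]) (auto simp: hseg_def)
      have z: "z 0 = Complex (Re (z 0)) (Im (z 0))" "z \<eta> = Complex (Re (z \<eta>)) (Im (z 0))"
        using Im by (simp_all add: complex_eq_iff)
      have lt: "before (\<phi> (z 0)) (\<phi> (z \<eta>))" if "Re (z 0) < Re (z \<eta>)"
        using \<phi>(2) that z unfolding rising_def by metis
      have gt: "before (\<phi> (z \<eta>)) (\<phi> (z 0))" if "Re (z \<eta>) < Re (z 0)"
        using \<phi>(2) that z unfolding rising_def by metis
      have "\<psi> (Complex \<eta> b) \<noteq> \<psi> (Complex 0 b)" using i\<psi> \<eta> by (simp add: inj_eq)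
      then have "z \<eta> \<noteq> z 0" using pz[of 0] pz[of \<eta>] \<eta> by auto
      then have "Re (z \<eta>) \<noteq> Re (z 0)" using Im complex_eqI by metis
      moreover have D: "D b = Re (z \<eta>) - Re (z 0)" by (simp add: D_def z_def)
      moreover have "before (\<phi> (z 0)) (\<phi> (z \<eta>))" if "rising \<psi> b"
        using that \<eta> pz[of 0] pz[of \<eta>] unfolding rising_def by (metis less_imp_le order_refl)
      moreover have "before (\<phi> (z \<eta>)) (\<phi> (z 0))" if "falling \<psi> b"
        using that \<eta> pz[of 0] pz[of \<eta>] unfolding falling_def by (metis less_imp_le order_refl)
      ultimately show ?thesis
        using lt gt before_asym rising_or_falling[OF \<psi>, of b]
        by (metis diff_gt_0_iff_gt linorder_neqE_linordered_idom right_minus_eq)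
    qed
    have oI: "open I" "b0 \<in> I" using \<eta> by (auto simp: I_def)
    have "\<forall>\<^sub>F b in nhds b0. (0 < D b) = (0 < D b0) \<and> b \<in> I"
    proof -
      have "isCont D b0" using cD oI by (simp add: continuous_on_eq_continuous_at)
      then have lim: "(D \<longlongrightarrow> D b0) (nhds b0)" by (simp add: isCont_def tendsto_nhds_iff)
      have "D b0 \<noteq> 0" using sgnD[OF oI(2)] by simp
      then consider "0 < D b0" | "D b0 < 0" by linarith
      then have "\<forall>\<^sub>F b in nhds b0. (0 < D b) = (0 < D b0)"
      proof cases
        case 1
        show ?thesis using order_tendstoD(1)[OF lim 1] by eventually_elim (use 1 in simp)
      next
        case 2
        show ?thesis using order_tendstoD(2)[OF lim 2] by eventually_elim (use 2 in simp)
      qed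
      then show ?thesis using eventually_nhds_in_open[OF oI] by eventually_elim simp
    qed
    then show "\<forall>\<^sub>F b in nhds b0. b \<in> UNIV \<longrightarrow> rising \<psi> b = rising \<psi> b0"
      by eventually_elim (use sgnD oI(2) in metis)
  qed auto
  then show ?thesis using rising_or_falling[OF \<psi>] by metis
qed

lemma unoriented_chart_reflect:
  assumes "unoriented_chart \<psi>" "c \<in> {1, -1}" "d \<in> {1, -1}"
  shows "unoriented_chart (\<psi> \<circ> reflect c d)"
proof -
  have rr: "reflect c d (reflect c d z) = z" for z by (rule reflect_reflect[OF assms(2,3)])
  have ran: "range (\<psi> \<circ> reflect c d) = range \<psi>"
  proof (intro equalityI subsetI)
    fix y assume "y \<in> range \<psi>"
    then obtain z where "y = \<psi> z" by auto
    then have "y = (\<psi> \<circ> reflect c d) (reflect c d z)" by (simp add: rr)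
    then show "y \<in> range (\<psi> \<circ> reflect c d)" by blast
  qed auto
  have "continuous_on UNIV (reflect c d)" unfolding reflect_def Complex_eq by (intro continuous_intros)
  then have c1: "continuous_on UNIV (\<psi> \<circ> reflect c d)"
    using assms(1) by (intro continuous_on_compose) (auto simp: unoriented_chart_def intro: continuous_on_subset)
  have "inj (reflect c d)" by (rule inj_on_inverseI[of _ "reflect c d"]) (rule rr)
  then have c2: "inj (\<psi> \<circ> reflect c d)" using assms(1) by (intro inj_compose) (auto simp: unoriented_chart_def)
  have c3: "\<exists>\<gamma>\<in>\<Gamma>. \<forall>u. (\<psi> \<circ> reflect c d) (Complex u b) \<in> range \<gamma>" for b
  proof -
    obtain \<gamma> where "\<gamma> \<in> \<Gamma>" "\<And>u. \<psi> (Complex u (d * b)) \<in> range \<gamma>"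
      using assms(1) unfolding unoriented_chart_def by meson
    then show ?thesis by (intro bexI[of _ \<gamma>]) (auto simp: reflect_def)
  qed
  have c4: "\<exists>a a' b. \<gamma> s = (\<psi> \<circ> reflect c d) (Complex a b) \<and> \<gamma> t = (\<psi> \<circ> reflect c d) (Complex a' b)"
    if g: "\<gamma> \<in> \<Gamma>" "s < t" "\<gamma> ` {s..t} \<subseteq> range (\<psi> \<circ> reflect c d)" for \<gamma> s t
  proof -
    obtain a a' b where "\<gamma> s = \<psi> (Complex a b)" "\<gamma> t = \<psi> (Complex a' b)"
      using unoriented_chart_arc[OF assms(1) g(1,2)] g(3) ran by metis
    moreover have "\<psi> (Complex x b) = (\<psi> \<circ> reflect c d) (Complex (c * x) (d * b))" for x
    proof -
      have "Complex (c * x) (d * b) = reflect c d (Complex x b)" by (simp add: reflect_def)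
      then show ?thesis by (simp add: rr)
    qed
    ultimately show ?thesis by metis
  qed
  show ?thesis
    unfolding unoriented_chart_def
  proof (intro conjI allI ballI impI c1 c2 c3)
    fix \<gamma> s t assume "\<gamma> \<in> \<Gamma>" "s < t \<and> \<gamma> ` {s..t} \<subseteq> range (\<psi> \<circ> reflect c d)"
    then show "\<exists>a a' b. \<gamma> s = (\<psi> \<circ> reflect c d) (Complex a b) \<and> \<gamma> t = (\<psi> \<circ> reflect c d) (Complex a' b)"
      using c4 by simp
  qed
qed

text \<open>The sign \<open>c\<close> is fixed by this foliation alone; admitting both values of
  \<open>d\<close> leaves the reversal of the other coordinate to the other foliation.\<close>

lemma rising_reflect:
  assumes "unoriented_chart \<psi>"
    and orient: "\<And>p. \<exists>\<phi>. unoriented_chart \<phi> \<and> (\<forall>b. rising \<phi> b) \<and> p \<in> range \<phi>"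
  obtains c where "c \<in> {1, -1}" "\<forall>d\<in>{1, -1}. chart (\<psi> \<circ> reflect c d)"
proof -
  from rising_constant[OF assms] obtain c where c: "c \<in> {1, -1}" "\<And>d b. rising (\<psi> \<circ> reflect c d) b"
  proof
    assume "\<forall>b. rising \<psi> b"
    then show ?thesis by (intro that[of 1]) (auto simp: rising_def reflect_def)
  next
    assume "\<forall>b. falling \<psi> b"
    then show ?thesis by (intro that[of "-1"]) (auto simp: rising_def falling_def reflect_def)
  qed
  have "chart (\<psi> \<circ> reflect c d)" if "d \<in> {1, -1}" for d
    by (rule chart_if_rising[OF unoriented_chart_reflect[OF assms(1) c(1) that] c(2)])
  then show ?thesis using that c(1) by blast
qed

end

text \<open>The reversals demanded by the two foliations act on different coordinates, so one
  transverse chart can undergo both. Under \<open>flip\<close> the coordinates change roles, hence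
  \<open>reflect c d\<close> against \<open>reflect d c\<close>.\<close>

lemma bichart_from_unoriented:
  assumes E1: "embedded_leaves \<Gamma>\<^sub>1" and E2: "embedded_leaves \<Gamma>\<^sub>2"
    and orient1: "\<And>p. \<exists>\<phi>. embedded_leaves.unoriented_chart \<Gamma>\<^sub>1 \<phi> \<and> (\<forall>b. embedded_leaves.rising \<Gamma>\<^sub>1 \<phi> b) \<and> p \<in> range \<phi>"
    and orient2: "\<And>p. \<exists>\<phi>. embedded_leaves.unoriented_chart \<Gamma>\<^sub>2 \<phi> \<and> (\<forall>b. embedded_leaves.rising \<Gamma>\<^sub>2 \<phi> b) \<and> p \<in> range \<phi>"
    and trans: "\<And>p. \<exists>\<psi>. embedded_leaves.unoriented_chart \<Gamma>\<^sub>1 \<psi> \<and> embedded_leaves.unoriented_chart \<Gamma>\<^sub>2 (\<psi> \<circ> flip) \<and> p \<in> range \<psi>"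
  shows "transverse_leaves \<Gamma>\<^sub>1 \<Gamma>\<^sub>2"
proof -
  interpret E1: embedded_leaves \<Gamma>\<^sub>1 by fact
  interpret E2: embedded_leaves \<Gamma>\<^sub>2 by fact
  show ?thesis
  proof
    fix p
    obtain \<psi> where \<psi>: "E1.unoriented_chart \<psi>" "E2.unoriented_chart (\<psi> \<circ> flip)" "p \<in> range \<psi>"
      using trans by blast
    obtain c where c: "c \<in> {1, -1}" "\<forall>d\<in>{1, -1}. E1.chart (\<psi> \<circ> reflect c d)"
      by (rule E1.rising_reflect[OF \<psi>(1) orient1])
    obtain d where d: "d \<in> {1, -1}" "\<forall>c\<in>{1, -1}. E2.chart (\<psi> \<circ> flip \<circ> reflect d c)"
      by (rule E2.rising_reflect[OF \<psi>(2) orient2])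
    have "(\<psi> \<circ> reflect c d) \<circ> flip = \<psi> \<circ> flip \<circ> reflect d c"
      by (auto simp: flip_def reflect_def)
    then have "E2.chart ((\<psi> \<circ> reflect c d) \<circ> flip)" using bspec[OF d(2) c(1)] by simp
    moreover obtain z where "p = \<psi> z" using \<psi>(3) by auto
    then have "p = (\<psi> \<circ> reflect c d) (reflect c d z)" using reflect_reflect[OF c(1) d(1)] by simp
    ultimately show "\<exists>\<psi>. E1.chart \<psi> \<and> E2.chart (\<psi> \<circ> flip) \<and> p \<in> range \<psi>"
      using bspec[OF c(2) d(1)] by blast
  qed
qed

section \<open>Groups acting on a totally ordered set\<close>

lemma left_orderable_BijGroup_subgroup:
  fixes less :: "'a \<Rightarrow> 'a \<Rightarrow> bool"
  assumes H: "subgroup H (BijGroup S)"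
    and irrefl: "\<And>x. x \<in> S \<Longrightarrow> \<not> less x x"
    and trans: "\<And>x y z. x \<in> S \<Longrightarrow> y \<in> S \<Longrightarrow> z \<in> S \<Longrightarrow> less x y \<Longrightarrow> less y z \<Longrightarrow> less x z"
    and total: "\<And>x y. x \<in> S \<Longrightarrow> y \<in> S \<Longrightarrow> x \<noteq> y \<Longrightarrow> less x y \<or> less y x"
    and inv: "\<And>f x y. f \<in> H \<Longrightarrow> x \<in> S \<Longrightarrow> y \<in> S \<Longrightarrow> less x y \<Longrightarrow> less (f x) (f y)"
  shows "left_orderable (BijGroup S\<lparr>carrier := H\<rparr>)"
proof -
  have sub: "H \<subseteq> Bij S" using subgroup.subset[OF H] by (simp add: BijGroup_def)
  have fS: "f x \<in> S" if "f \<in> H" "x \<in> S" for f x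
    using sub that Bij_imp_funcset by blast
  obtain W where W: "well_order_on (UNIV :: 'a set) W" using well_order_on by blast
  define lt where "lt x y \<longleftrightarrow> (x, y) \<in> W - Id" for x y
  have "{(x, y). lt x y} = W - Id" by (auto simp: lt_def)
  then have wf: "wf {(x, y). lt x y}" using W by (simp add: well_order_on_def)
  have Wlin: "Relation.trans W" "antisym W" "total_on UNIV W"
    using W by (auto simp: well_order_on_def linear_order_on_def partial_order_on_def preorder_on_def)
  have lt_trans: "lt x z" if "lt x y" "lt y z" for x y z
    using that transD[OF Wlin(1), of x y z] antisymD[OF Wlin(2), of x y] by (auto simp: lt_def)
  have lt_total: "lt x y \<or> x = y \<or> lt y x" for x y
    using Wlin(3) by (auto simp: lt_def total_on_def)
  define fless where "fless f g \<longleftrightarrow> (\<exists>x\<in>S. less (f x) (g x) \<and> (\<forall>y\<in>S. lt y x \<longrightarrow> f y = g y))" for f g :: "'a \<Rightarrow> 'a"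
  have fless_irrefl: "\<not> fless f f" if "f \<in> H" for f using irrefl fS[OF that] by (auto simp: fless_def)
  have fless_trans: "fless f k" if fH: "f \<in> H" "g \<in> H" "k \<in> H" and "fless f g" "fless g k" for f g k
  proof -
    obtain x where x: "x \<in> S" "less (f x) (g x)" "\<And>y. y \<in> S \<Longrightarrow> lt y x \<Longrightarrow> f y = g y"
      using \<open>fless f g\<close> by (auto simp: fless_def)
    obtain z where z: "z \<in> S" "less (g z) (k z)" "\<And>y. y \<in> S \<Longrightarrow> lt y z \<Longrightarrow> g y = k y"
      using \<open>fless g k\<close> by (auto simp: fless_def)
    consider "lt x z" | "x = z" | "lt z x" using lt_total by blast
    then show ?thesis
    proof cases
      case 1
      then have "less (f x) (k x)" using x z by auto
      moreover have "f y = k y" if "y \<in> S" "lt y x" for y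
        using x(3)[OF that] z(3)[OF that(1) lt_trans[OF that(2) 1]] by simp
      ultimately show ?thesis using x(1) by (auto simp: fless_def)
    next
      case 2
      then have "less (f x) (k x)" using trans[OF fS[OF fH(1) x(1)] fS[OF fH(2) x(1)] fS[OF fH(3) x(1)]] x z by simp
      moreover have "f y = k y" if "y \<in> S" "lt y x" for y
        using x(3)[OF that] z(3)[OF that(1)] that 2 by simp
      ultimately show ?thesis using x(1) by (auto simp: fless_def)
    next
      case 3
      then have "less (f z) (k z)" using x z by auto
      moreover have "f y = k y" if "y \<in> S" "lt y z" for y
        using z(3)[OF that] x(3)[OF that(1) lt_trans[OF that(2) 3]] by simp
      ultimately show ?thesis using z(1) by (auto simp: fless_def)
    qed
  qed
  have fless_total: "fless f g \<or> fless g f" if fg: "f \<in> H" "g \<in> H" "f \<noteq> g" for f g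
  proof -
    \<comment> \<open>Elements of \<open>Bij S\<close> are extensional, so distinct ones already
      differ on \<open>S\<close>.\<close>
    have "\<exists>x. x \<in> {x \<in> S. f x \<noteq> g x}"
    proof (rule ccontr)
      assume "\<not> ?thesis"
      then have "f = g" using fg sub by (intro extensionalityI[of f S g]) (auto simp: Bij_def)
      then show False using fg by simp
    qed
    then obtain x where x: "x \<in> {x \<in> S. f x \<noteq> g x}" "\<forall>y. lt y x \<longrightarrow> y \<notin> {x \<in> S. f x \<noteq> g x}"
      using wf[unfolded wf_eq_minimal, rule_format, of _ "{x \<in> S. f x \<noteq> g x}"] by blast
    have eq: "f y = g y" "g y = f y" if "y \<in> S" "lt y x" for y using x(2) that by auto
    have "less (f x) (g x) \<or> less (g x) (f x)" using x(1) fS fg total by auto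
    then show ?thesis using x(1) eq unfolding fless_def by blast
  qed
  have mult: "(g \<otimes>\<^bsub>BijGroup S\<lparr>carrier := H\<rparr>\<^esub> f) x = g (f x)" if "g \<in> H" "f \<in> H" "x \<in> S" for g f x
    using that sub by (auto simp: BijGroup_def compose_def)
  have closed: "g \<otimes>\<^bsub>BijGroup S\<lparr>carrier := H\<rparr>\<^esub> f \<in> H" if "g \<in> H" "f \<in> H" for g f
    using subgroup.m_closed[OF H that] by simp
  define r where "r = {(f, g). f \<in> H \<and> g \<in> H \<and> (f = g \<or> fless f g)}"
  have "linear_order_on H r"
    unfolding linear_order_on_def partial_order_on_def preorder_on_def
  proof (intro conjI)
    show "r \<subseteq> H \<times> H" by (auto simp: r_def)
    show "refl_on H r" by (auto simp: r_def refl_on_def)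
    show "Relation.trans r"
      by (rule transI) (use fless_trans in \<open>unfold r_def, blast\<close>)
    show "antisym r"
      by (rule antisymI) (use fless_trans fless_irrefl in \<open>unfold r_def, blast\<close>)
    show "total_on H r" using fless_total by (auto simp: r_def total_on_def)
  qed
  moreover have "(k \<otimes>\<^bsub>BijGroup S\<lparr>carrier := H\<rparr>\<^esub> f, k \<otimes>\<^bsub>BijGroup S\<lparr>carrier := H\<rparr>\<^esub> g) \<in> r"
    if k: "k \<in> H" and fg: "(f, g) \<in> r" for k f g
  proof -
    have fgH: "f \<in> H" "g \<in> H" using fg by (auto simp: r_def)
    \<comment> \<open>Left multiplication applies \<open>k\<close> to the values only, so the first
      point of disagreement remains a witness.\<close>
    have "fless (k \<otimes>\<^bsub>BijGroup S\<lparr>carrier := H\<rparr>\<^esub> f) (k \<otimes>\<^bsub>BijGroup S\<lparr>carrier := H\<rparr>\<^esub> g)" if "fless f g"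
    proof -
      obtain x where x: "x \<in> S" "less (f x) (g x)" "\<And>y. y \<in> S \<Longrightarrow> lt y x \<Longrightarrow> f y = g y"
        using \<open>fless f g\<close> by (auto simp: fless_def)
      have "less (k (f x)) (k (g x))" by (rule inv[OF k fS[OF fgH(1) x(1)] fS[OF fgH(2) x(1)] x(2)])
      then show ?thesis unfolding fless_def
        using x mult[OF k fgH(1)] mult[OF k fgH(2)] by (intro bexI[of _ x]) auto
    qed
    then show ?thesis using fg closed[OF k] fgH by (auto simp: r_def)
  qed
  moreover have "group (BijGroup S\<lparr>carrier := H\<rparr>)"
    by (rule subgroup.subgroup_is_group[OF H group_BijGroup])
  ultimately show ?thesis unfolding left_orderable_def by auto
qed

section \<open>The automorphisms form a subgroup\<close>

lemma image_eq_compose: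
  assumes "\<Phi> ` A = A" "\<Psi> ` A = A" "\<And>x. x \<in> A \<Longrightarrow> \<Xi> x = \<Phi> (\<Psi> x)"
  shows "\<Xi> ` A = A"
proof -
  have "\<Xi> ` A = \<Phi> ` (\<Psi> ` A)" using assms(3) by (auto simp: image_image intro!: image_cong)
  then show ?thesis using assms by simp
qed

lemma image_eq_inverse:
  assumes "\<Phi> ` A = A" "\<And>x. x \<in> A \<Longrightarrow> \<Psi> (\<Phi> x) = x"
  shows "\<Psi> ` A = A"
proof -
  have "\<Psi> ` (\<Phi> ` A) = A" using assms(2) by (simp add: image_image)
  then show ?thesis using assms(1) by simp
qed

lemma preserves_compose:
  assumes "f \<in> Bij S" "g \<in> Bij S" "\<And>L. L \<in> F \<Longrightarrow> L \<subseteq> S" "\<And>\<gamma>. \<gamma> \<in> Or \<Longrightarrow> range \<gamma> \<subseteq> S"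
  shows "preserves_foliation f F \<Longrightarrow> preserves_foliation g F \<Longrightarrow> preserves_foliation (compose S f g) F"
    and "preserves_orientation f Or \<Longrightarrow> preserves_orientation g Or \<Longrightarrow> preserves_orientation (compose S f g) Or"
proof -
  assume "preserves_foliation f F" "preserves_foliation g F"
  then show "preserves_foliation (compose S f g) F"
    unfolding preserves_foliation_def
  proof (rule image_eq_compose)
    fix L assume "L \<in> F"
    then have "L \<subseteq> S" using assms(3) by blast
    then show "compose S f g ` L = f ` (g ` L)" by (auto simp: compose_def image_image intro!: image_cong)
  qed
next
  assume "preserves_orientation f Or" "preserves_orientation g Or"
  then show "preserves_orientation (compose S f g) Or"
    unfolding preserves_orientation_def
  proof (rule image_eq_compose)
    fix \<gamma> assume "\<gamma> \<in> Or"
    then have "\<gamma> t \<in> S" for t using assms(4) by blast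
    then show "compose S f g \<circ> \<gamma> = f \<circ> (g \<circ> \<gamma>)" by (auto simp: compose_def)
  qed
qed

lemma preserves_inverse:
  assumes "f \<in> Bij S" "\<And>L. L \<in> F \<Longrightarrow> L \<subseteq> S" "\<And>\<gamma>. \<gamma> \<in> Or \<Longrightarrow> range \<gamma> \<subseteq> S"
  shows "preserves_foliation f F \<Longrightarrow> preserves_foliation (\<lambda>x\<in>S. inv_into S f x) F"
    and "preserves_orientation f Or \<Longrightarrow> preserves_orientation (\<lambda>x\<in>S. inv_into S f x) Or"
proof -
  have bij: "bij_betw f S S" using assms(1) by (simp add: Bij_def)
  have i: "(\<lambda>x\<in>S. inv_into S f x) (f x) = x" if "x \<in> S" for x
    using that bij by (simp add: bij_betw_apply bij_betw_inv_into_left)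
  show "preserves_foliation f F \<Longrightarrow> preserves_foliation (\<lambda>x\<in>S. inv_into S f x) F"
    unfolding preserves_foliation_def
  proof (erule image_eq_inverse)
    fix L assume "L \<in> F"
    then have "L \<subseteq> S" using assms(2) by blast
    then have "(\<lambda>x. (\<lambda>x\<in>S. inv_into S f x) (f x)) ` L = (\<lambda>x. x) ` L"
      by (intro image_cong refl i) blast
    then show "(\<lambda>x\<in>S. inv_into S f x) ` (f ` L) = L" by (simp only: image_image image_ident)
  qed
  show "preserves_orientation f Or \<Longrightarrow> preserves_orientation (\<lambda>x\<in>S. inv_into S f x) Or"
    unfolding preserves_orientation_def
  proof (erule image_eq_inverse)
    fix \<gamma> assume "\<gamma> \<in> Or"
    then have "\<gamma> t \<in> S" for t using assms(3) by blast
    then show "(\<lambda>x\<in>S. inv_into S f x) \<circ> (f \<circ> \<gamma>) = \<gamma>" using i by (simp add: fun_eq_iff)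
  qed
qed

lemma homeomorphic_map_inverse:
  assumes "f \<in> Bij (topspace P)" "homeomorphic_map P P f"
  shows "homeomorphic_map P P (\<lambda>x\<in>topspace P. inv_into (topspace P) f x)"
proof -
  obtain g where g: "homeomorphic_maps P P f g" using assms(2) homeomorphic_map_maps by blast
  have bij: "bij_betw f (topspace P) (topspace P)" using assms(1) by (simp add: Bij_def)
  have "homeomorphic_map P P g" using g homeomorphic_maps_sym homeomorphic_maps_imp_map by blast
  moreover have "g x = (\<lambda>x\<in>topspace P. inv_into (topspace P) f x) x" if x: "x \<in> topspace P" for x
  proof -
    have "g x \<in> topspace P" "f (g x) = x"
      using g x by (auto simp: homeomorphic_maps_def continuous_map_def)
    then show ?thesis using x bij by (metis bij_betw_inv_into_left restrict_apply')
  qed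
  ultimately show ?thesis using homeomorphic_map_eq by blast
qed

lemma Aut_plus_subgroup:
  assumes "\<And>L. L \<in> F\<^sub>1 \<Longrightarrow> L \<subseteq> topspace P" "\<And>\<gamma>. \<gamma> \<in> Or\<^sub>1 \<Longrightarrow> range \<gamma> \<subseteq> topspace P"
    and "\<And>L. L \<in> F\<^sub>2 \<Longrightarrow> L \<subseteq> topspace P" "\<And>\<gamma>. \<gamma> \<in> Or\<^sub>2 \<Longrightarrow> range \<gamma> \<subseteq> topspace P"
  shows "subgroup (carrier (Aut_plus P F\<^sub>1 Or\<^sub>1 F\<^sub>2 Or\<^sub>2)) (BijGroup (topspace P))"
proof (rule group.subgroupI[OF group_BijGroup])
  let ?S = "topspace P"
  let ?H = "carrier (Aut_plus P F\<^sub>1 Or\<^sub>1 F\<^sub>2 Or\<^sub>2)"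
  have H: "f \<in> ?H \<longleftrightarrow> f \<in> Bij ?S \<and> homeomorphic_map P P f \<and>
        preserves_foliation f F\<^sub>1 \<and> preserves_orientation f Or\<^sub>1 \<and>
        preserves_foliation f F\<^sub>2 \<and> preserves_orientation f Or\<^sub>2" for f
    by (auto simp: Aut_plus_def)
  show "?H \<subseteq> carrier (BijGroup ?S)" using H by (auto simp: BijGroup_def)
  show "?H \<noteq> {}"
  proof -
    have h: "homeomorphic_map P P (\<lambda>x\<in>?S. x)"
      using homeomorphic_map_eq[of P P id "\<lambda>x\<in>?S. x"] by simp
    have idF: "preserves_foliation (\<lambda>x\<in>?S. x) F" if "\<And>L. L \<in> F \<Longrightarrow> L \<subseteq> ?S" for F
    proof -
      have "(\<lambda>x\<in>?S. x) ` L = L" if "L \<in> F" for L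
      proof -
        have "(\<lambda>x\<in>?S. x) ` L = (\<lambda>x. x) ` L" using \<open>\<And>L. L \<in> F \<Longrightarrow> L \<subseteq> ?S\<close>[OF that] by (intro image_cong) auto
        then show ?thesis by simp
      qed
      then show ?thesis by (simp add: preserves_foliation_def)
    qed
    have idO: "preserves_orientation (\<lambda>x\<in>?S. x) Or" if "\<And>\<gamma>. \<gamma> \<in> Or \<Longrightarrow> range \<gamma> \<subseteq> ?S" for Or
    proof -
      have "(\<lambda>x\<in>?S. x) \<circ> \<gamma> = \<gamma>" if "\<gamma> \<in> Or" for \<gamma>
      proof -
        have "\<gamma> t \<in> ?S" for t using \<open>\<And>\<gamma>. \<gamma> \<in> Or \<Longrightarrow> range \<gamma> \<subseteq> ?S\<close>[OF that] by blast
        then show ?thesis by (simp add: fun_eq_iff)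
      qed
      then show ?thesis by (simp add: preserves_orientation_def)
    qed
    have "(\<lambda>x\<in>?S. x) \<in> ?H"
      unfolding H by (intro conjI id_Bij h idF idO; erule assms)
    then show ?thesis by blast
  qed
  fix f assume f: "f \<in> ?H"
  then have fB: "f \<in> Bij ?S" by (simp add: H)
  have "(\<lambda>x\<in>?S. inv_into ?S f x) \<in> ?H"
    unfolding H using f[unfolded H]
    by (intro conjI restrict_inv_into_Bij[OF fB] homeomorphic_map_inverse[OF fB]
        preserves_inverse[OF fB, of F\<^sub>1 Or\<^sub>1, OF assms(1,2)] preserves_inverse[OF fB, of F\<^sub>2 Or\<^sub>2, OF assms(3,4)]) simp_all
  then show "inv\<^bsub>BijGroup ?S\<^esub> f \<in> ?H" using inv_BijGroup[OF fB] by simp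
  fix g assume g: "g \<in> ?H"
  then have gB: "g \<in> Bij ?S" by (simp add: H)
  have "homeomorphic_map P P (f \<circ> g)"
    using f g by (intro homeomorphic_map_compose[of P P]) (auto simp: H)
  then have "homeomorphic_map P P (compose ?S f g)"
    by (rule homeomorphic_map_eq) (simp add: compose_def)
  then have "compose ?S f g \<in> ?H"
    unfolding H using f[unfolded H] g[unfolded H]
    by (intro conjI compose_Bij[OF fB gB]
        preserves_compose[OF fB gB, of F\<^sub>1 Or\<^sub>1, OF assms(1,2)] preserves_compose[OF fB gB, of F\<^sub>2 Or\<^sub>2, OF assms(3,4)]) simp_all
  then show "f \<otimes>\<^bsub>BijGroup ?S\<^esub> g \<in> ?H" using fB gB by (simp add: BijGroup_def)
qed

section \<open>Transport to the complex plane\<close>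

lemma plane_coordinates:
  assumes "topological_plane P"
  obtains h :: "'a \<Rightarrow> complex" and k where "homeomorphic_maps P euclidean h k"
proof -
  obtain f g where fg: "homeomorphic_maps P (euclidean :: (real \<times> real) topology) f g"
    using assms unfolding topological_plane_def homeomorphic_space_def by blast
  have "homeomorphic_maps (euclidean :: (real \<times> real) topology) euclidean
      (\<lambda>x. Complex (fst x) (snd x)) (\<lambda>z. (Re z, Im z))"
    unfolding homeomorphic_maps_def Complex_eq
    by (auto simp: continuous_map_iff_continuous2 complex_eq_iff intro!: continuous_intros)
  from homeomorphic_maps_compose[OF conjI[OF fg this]] show ?thesis using that by blast
qed

locale oriented_plane_foliation =
  fixes P :: "'a topology" and F :: "'a set set" and Or :: "(real \<Rightarrow> 'a) set"
    and h :: "'a \<Rightarrow> complex" and k :: "complex \<Rightarrow> 'a"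
  assumes hk: "homeomorphic_maps P euclidean h k"
    and fol: "foliation P F"
    and ori: "foliation_orientation P F Or"
begin

abbreviation leaf_params :: "(real \<Rightarrow> complex) set" where
  "leaf_params \<equiv> (\<lambda>\<gamma>. h \<circ> \<gamma>) ` Or"

lemma h_continuous: "continuous_map P euclidean h" and k_continuous: "continuous_map euclidean P k"
  and kh: "x \<in> topspace P \<Longrightarrow> k (h x) = x" and hk_eq: "h (k z) = z" and k_in: "k z \<in> topspace P"
  using hk by (auto simp: homeomorphic_maps_def continuous_map_def)

lemma h_inj: "x \<in> topspace P \<Longrightarrow> y \<in> topspace P \<Longrightarrow> h x = h y \<longleftrightarrow> x = y"
  using kh by metis

lemma partition: "partition_on (topspace P) F"
  using fol by (simp add: foliation_def)

lemma leaf_subset: "L \<in> F \<Longrightarrow> L \<subseteq> topspace P"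
  using partition by (auto simp: partition_on_def)

lemma param_leaf: "\<gamma> \<in> Or \<Longrightarrow> range \<gamma> \<in> F"
  using ori by (auto simp: foliation_orientation_def)

lemma param_in: "\<gamma> \<in> Or \<Longrightarrow> \<gamma> t \<in> topspace P"
  using leaf_subset[OF param_leaf] by blast

lemma param_of_leaf: "L \<in> F \<Longrightarrow> \<exists>\<gamma>\<in>Or. range \<gamma> = L"
  using ori by (auto simp: foliation_orientation_def)

lemma param_embedding: "\<gamma> \<in> Or \<Longrightarrow> embedding_map euclideanreal P \<gamma>"
  and param_proper: "\<gamma> \<in> Or \<Longrightarrow> proper_map euclideanreal P \<gamma>"
  using ori by (auto simp: foliation_orientation_def proper_embedding_def)

lemma param_continuous: "\<gamma> \<in> Or \<Longrightarrow> continuous_map euclideanreal P \<gamma>"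
  using param_embedding homeomorphic_imp_continuous_map continuous_map_in_subtopology
  unfolding embedding_map_def by metis

lemma param_reparam:
  assumes "\<gamma> \<in> Or" "\<delta> \<in> Or" "\<gamma> s = \<delta> t"
  shows "\<exists>j. strict_mono j \<and> surj j \<and> \<delta> = \<gamma> \<circ> j"
proof -
  have "range \<gamma> \<inter> range \<delta> \<noteq> {}" using assms(3) by blast
  then have "range \<delta> = range \<gamma>"
    using partition_onD2[OF partition] param_leaf[OF assms(1)] param_leaf[OF assms(2)]
    by (metis disjointD inf_commute)
  then have "\<delta> \<in> {\<delta>\<in>Or. range \<delta> = range \<gamma>}" using assms(2) by blast
  also have "\<dots> = {\<gamma> \<circ> j | j. strict_mono j \<and> homeomorphic_map euclideanreal euclideanreal j}"
    using ori assms(1) by (simp add: foliation_orientation_def)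
  finally obtain j where "\<delta> = \<gamma> \<circ> j" "strict_mono j" "homeomorphic_map euclideanreal euclideanreal j" by blast
  then show ?thesis using homeomorphic_imp_surjective_map by fastforce
qed

lemma param_embedding_complex:
  assumes "\<gamma> \<in> Or"
  shows "continuous_on UNIV (h \<circ> \<gamma>)" "inj (h \<circ> \<gamma>)" "continuous_on (range (h \<circ> \<gamma>)) (inv_into UNIV (h \<circ> \<gamma>))"
proof -
  have "homeomorphic_map P euclidean h" using hk homeomorphic_maps_imp_map by blast
  then have "embedding_map P euclidean h" using surjective_embedding_map by blast
  then have "embedding_map euclideanreal euclidean (h \<circ> \<gamma>)"
    using embedding_map_compose param_embedding[OF assms] by blast
  then have "homeomorphic_map euclideanreal (top_of_set (range (h \<circ> \<gamma>))) (h \<circ> \<gamma>)"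
    by (simp add: embedding_map_def)
  then obtain g where g: "homeomorphic_maps euclideanreal (top_of_set (range (h \<circ> \<gamma>))) (h \<circ> \<gamma>) g"
    using homeomorphic_map_maps by blast
  show c: "continuous_on UNIV (h \<circ> \<gamma>)"
    using continuous_map_compose[OF param_continuous[OF assms] h_continuous] by simp
  have gi: "g ((h \<circ> \<gamma>) t) = t" for t using g by (simp add: homeomorphic_maps_def)
  show i: "inj (h \<circ> \<gamma>)" by (rule inj_on_inverseI[of _ g]) (rule gi)
  have "continuous_on (range (h \<circ> \<gamma>)) g" using g by (simp add: homeomorphic_maps_def)
  then show "continuous_on (range (h \<circ> \<gamma>)) (inv_into UNIV (h \<circ> \<gamma>))"
  proof (rule continuous_on_eq)
    fix y assume "y \<in> range (h \<circ> \<gamma>)"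
    then obtain t where "y = (h \<circ> \<gamma>) t" by blast
    then show "g y = inv_into UNIV (h \<circ> \<gamma>) y" using gi[of t] inv_f_f[OF i, of t] by simp
  qed
qed

lemma param_proper_complex:
  assumes "\<gamma> \<in> Or"
  shows "filterlim (h \<circ> \<gamma>) at_infinity at_top"
proof -
  have "homeomorphic_map P euclidean h" using hk homeomorphic_maps_imp_map by blast
  then have "proper_map P euclidean h" by (rule homeomorphic_imp_proper_map)
  then have pr: "proper_map euclideanreal euclidean (h \<circ> \<gamma>)"
    using proper_map_compose[OF param_proper[OF assms]] by blast
  have "\<forall>\<^sub>F t in at_top. B \<le> cmod ((h \<circ> \<gamma>) t)" for B
  proof -
    have "compactin euclideanreal {t \<in> topspace euclideanreal. (h \<circ> \<gamma>) t \<in> cball 0 B}"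
      by (rule compactin_proper_map_preimage[OF pr]) simp
    then have "bounded {t. (h \<circ> \<gamma>) t \<in> cball 0 B}" by (simp add: compact_imp_bounded)
    then obtain M where M: "\<And>t. (h \<circ> \<gamma>) t \<in> cball 0 B \<Longrightarrow> \<bar>t\<bar> \<le> M"
      unfolding bounded_iff by auto
    show ?thesis
    proof (rule eventually_mono[OF eventually_gt_at_top[of M]])
      fix t assume "M < t"
      then have "(h \<circ> \<gamma>) t \<notin> cball 0 B" using M[of t] by linarith
      then show "B \<le> cmod ((h \<circ> \<gamma>) t)" by simp
    qed
  qed
  then show ?thesis
    by (simp add: filterlim_at_infinity_conv_norm_at_top filterlim_at_top)
qed

lemma embedded_leaves: "embedded_leaves leaf_params"
proof
  show "continuous_on UNIV \<gamma>" "inj \<gamma>" "continuous_on (range \<gamma>) (inv_into UNIV \<gamma>)" "filterlim \<gamma> at_infinity at_top"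
    if "\<gamma> \<in> leaf_params" for \<gamma>
    using that param_embedding_complex param_proper_complex by auto
  show "\<exists>\<gamma>\<in>leaf_params. z \<in> range \<gamma>" for z
  proof -
    obtain L where "L \<in> F" "k z \<in> L" using partition k_in[of z] by (auto simp: partition_on_def)
    then obtain \<gamma> where "\<gamma> \<in> Or" "k z \<in> range \<gamma>" using param_of_leaf by metis
    then obtain t where "k z = \<gamma> t" by auto
    then have "z = (h \<circ> \<gamma>) t" using hk_eq[of z] by simp
    then show ?thesis using \<open>\<gamma> \<in> Or\<close> by auto
  qed
  show "\<exists>j. strict_mono j \<and> surj j \<and> \<delta> = \<gamma> \<circ> j"
    if gd0: "\<gamma> \<in> leaf_params" "\<delta> \<in> leaf_params" "\<gamma> s = \<delta> t" for \<gamma> \<delta> s t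
  proof -
    obtain \<gamma>' \<delta>' where gd: "\<gamma>' \<in> Or" "\<delta>' \<in> Or" "\<gamma> = h \<circ> \<gamma>'" "\<delta> = h \<circ> \<delta>'" using gd0(1,2) by auto
    then have "\<gamma>' s = \<delta>' t" using gd0(3) h_inj param_in by auto
    then obtain j where "strict_mono j" "surj j" "\<delta>' = \<gamma>' \<circ> j" using param_reparam gd(1,2) by blast
    then show ?thesis using gd(3,4) by (auto simp: comp_assoc)
  qed
qed

sublocale embedded_leaves leaf_params
  by (rule embedded_leaves)

definition coordinate :: "(real \<times> real \<Rightarrow> 'a) \<Rightarrow> complex \<Rightarrow> complex" where
  "coordinate \<sigma> z = h (\<sigma> (Re z, Im z))"

context
  fixes U \<phi> \<sigma>
  assumes fc: "foliated_chart P F U \<phi>"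
    and inverse: "homeomorphic_maps (subtopology P U) euclidean \<phi> \<sigma>"
begin

lemma chart_domain: "U \<subseteq> topspace P"
  using fc openin_subset by (auto simp: foliated_chart_def plane_chart_def)

lemma sigma_in: "\<sigma> x \<in> U" and sigma_phi: "y \<in> U \<Longrightarrow> \<sigma> (\<phi> y) = y"
  using inverse chart_domain by (auto simp: homeomorphic_maps_def continuous_map_def inf.absorb2)

lemma phi_sigma: "\<phi> (\<sigma> x) = x"
proof -
  have "\<forall>x\<in>topspace euclidean. \<phi> (\<sigma> x) = x" using inverse unfolding homeomorphic_maps_def by blast
  from bspec[OF this, of x] show ?thesis by simp
qed

lemma plaque_level: "C \<in> plaques P F U \<Longrightarrow> \<exists>c. \<phi> ` C = UNIV \<times> {c}"
  using fc by (auto simp: foliated_chart_def)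

text \<open>An arc is connected, so it stays in a single component of the trace of its leaf on
  \<open>U\<close>.\<close>

lemma plaque_obtain:
  assumes "\<gamma> \<in> Or" "\<gamma> ` {s..t} \<subseteq> U" "s \<le> t"
  obtains C where "C \<in> plaques P F U" "\<gamma> ` {s..t} \<subseteq> C" "C \<subseteq> range \<gamma> \<inter> U"
proof -
  let ?X = "subtopology P (range \<gamma> \<inter> U)"
  let ?C = "connected_component_of_set ?X (\<gamma> s)"
  have "connectedin euclideanreal {s..t}" by simp
  then have "connectedin P (\<gamma> ` {s..t})"
    by (rule connectedin_continuous_map_image[OF param_continuous[OF assms(1)]])
  then have cn: "connectedin ?X (\<gamma> ` {s..t})" using assms(2) by (auto simp: connectedin_subtopology)
  have top: "topspace ?X = range \<gamma> \<inter> U" using chart_domain by auto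
  have "\<gamma> s \<in> topspace ?X" unfolding top using assms(2,3) by auto
  then have "?C \<in> connected_components_of ?X" by (auto simp: connected_components_of_def)
  then have "?C \<in> plaques P F U" using param_leaf[OF assms(1)] by (auto simp: plaques_def)
  moreover have "\<gamma> ` {s..t} \<subseteq> ?C" using assms(3) by (intro connected_component_of_maximal[OF cn]) auto
  moreover have "?C \<subseteq> range \<gamma> \<inter> U" using connected_component_of_subset_topspace[of ?X "\<gamma> s"] top by simp
  ultimately show ?thesis using that by blast
qed

text \<open>The plaque through \<open>\<sigma> (0, b)\<close> fills a complete horizontal line by
  the definition of a foliated chart, and this point shows that the line has height
  \<open>b\<close>.\<close>

lemma horizontal_plaque:
  obtains C \<gamma> where "C \<in> plaques P F U" "\<gamma> \<in> Or" "C \<subseteq> range \<gamma>" "\<forall>u. \<sigma> (u, b) \<in> C"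
proof -
  have "\<sigma> (0, b) \<in> topspace P" using sigma_in chart_domain by blast
  then obtain L where L: "L \<in> F" "\<sigma> (0, b) \<in> L" using partition by (auto simp: partition_on_def)
  then obtain \<gamma> t where \<gamma>: "\<gamma> \<in> Or" "\<gamma> t = \<sigma> (0, b)" using param_of_leaf by (metis imageE)
  then have "\<gamma> ` {t..t} \<subseteq> U" using sigma_in by auto
  then obtain C where C: "C \<in> plaques P F U" "\<gamma> ` {t..t} \<subseteq> C" "C \<subseteq> range \<gamma> \<inter> U"
    by (rule plaque_obtain[OF \<gamma>(1) _ order_refl])
  obtain c where c: "\<phi> ` C = UNIV \<times> {c}" using plaque_level[OF C(1)] by blast
  have "\<sigma> (0, b) \<in> C" using C(2) \<gamma>(2) by auto
  then have "\<phi> (\<sigma> (0, b)) \<in> UNIV \<times> {c}" using c by blast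
  then have "c = b" by (simp add: phi_sigma)
  have "\<sigma> (u, b) \<in> C" for u
  proof -
    have "(u, b) \<in> \<phi> ` C" using c \<open>c = b\<close> by simp
    then obtain y where "y \<in> C" "\<phi> y = (u, b)" by auto
    then show ?thesis using sigma_phi[of y] C(3) by auto
  qed
  then show ?thesis using that C(1,3) \<gamma>(1) by blast
qed

lemma coordinate_range: "range (coordinate \<sigma>) = h ` U"
proof (intro equalityI subsetI)
  fix w assume "w \<in> h ` U"
  then obtain y where y: "y \<in> U" "w = h y" by blast
  then have "w = coordinate \<sigma> (Complex (fst (\<phi> y)) (snd (\<phi> y)))" by (simp add: coordinate_def sigma_phi)
  then show "w \<in> range (coordinate \<sigma>)" by blast
qed (auto simp: coordinate_def sigma_in)

lemma unoriented_chart_coordinate: "unoriented_chart (coordinate \<sigma>)"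
  unfolding unoriented_chart_def
proof (intro conjI allI ballI impI)
  have "continuous_map euclidean (subtopology P U) \<sigma>" using inverse by (simp add: homeomorphic_maps_def)
  then have "continuous_map euclidean P \<sigma>" using continuous_map_in_subtopology by blast
  then have "continuous_map euclidean euclidean (h \<circ> \<sigma>)" using continuous_map_compose h_continuous by blast
  then have c: "continuous_on UNIV (h \<circ> \<sigma>)" by simp
  show "continuous_on UNIV (coordinate \<sigma>)"
  proof -
    have "continuous_on UNIV (\<lambda>z. (Re z, Im z))" by (intro continuous_intros)
    from continuous_on_compose2[OF c this] show ?thesis by (simp add: coordinate_def[abs_def])
  qed
  show "inj (coordinate \<sigma>)"
  proof (rule injI)
    fix z w assume "coordinate \<sigma> z = coordinate \<sigma> w"
    then have "\<sigma> (Re z, Im z) = \<sigma> (Re w, Im w)"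
      using h_inj sigma_in chart_domain unfolding coordinate_def by blast
    then have "(Re z, Im z) = (Re w, Im w)" by (metis phi_sigma)
    then show "z = w" by (simp add: complex_eq_iff)
  qed
next
  fix b
  obtain C \<gamma> where C: "C \<in> plaques P F U" "\<gamma> \<in> Or" "C \<subseteq> range \<gamma>" "\<forall>u. \<sigma> (u, b) \<in> C"
    by (rule horizontal_plaque)
  have "coordinate \<sigma> (Complex u b) \<in> range (h \<circ> \<gamma>)" for u
  proof -
    have "\<sigma> (u, b) \<in> range \<gamma>" using C by blast
    then have "h (\<sigma> (u, b)) \<in> h ` range \<gamma>" by (rule imageI)
    then show ?thesis by (simp add: coordinate_def image_comp)
  qed
  then show "\<exists>\<gamma>\<in>leaf_params. \<forall>u. coordinate \<sigma> (Complex u b) \<in> range \<gamma>" using C(2) by blast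
next
  fix \<gamma>' and s t :: real assume "\<gamma>' \<in> leaf_params" and st: "s < t \<and> \<gamma>' ` {s..t} \<subseteq> range (coordinate \<sigma>)"
  then obtain \<gamma> where \<gamma>: "\<gamma> \<in> Or" "\<gamma>' = h \<circ> \<gamma>" by blast
  have "\<gamma> ` {s..t} \<subseteq> U"
  proof
    fix y assume y: "y \<in> \<gamma> ` {s..t}"
    then have "h y \<in> h ` U" using st \<gamma>(2) unfolding coordinate_range by (auto simp: image_subset_iff)
    then obtain y' where "y' \<in> U" "h y = h y'" by blast
    moreover have "y \<in> topspace P" using y param_in[OF \<gamma>(1)] by blast
    ultimately show "y \<in> U" using h_inj chart_domain by blast
  qed
  moreover have "s \<le> t" using st by simp
  ultimately obtain C where C: "C \<in> plaques P F U" "\<gamma> ` {s..t} \<subseteq> C" "C \<subseteq> range \<gamma> \<inter> U"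
    by (rule plaque_obtain[OF \<gamma>(1)])
  obtain c where c: "\<phi> ` C = UNIV \<times> {c}" using plaque_level[OF C(1)] by blast
  have co: "\<exists>a. \<gamma>' u = coordinate \<sigma> (Complex a c)" if "u \<in> {s..t}" for u
  proof -
    have "\<gamma> u \<in> C" using C(2) that by blast
    then have "\<phi> (\<gamma> u) \<in> UNIV \<times> {c}" "\<gamma> u \<in> U" using c C(3) by blast+
    then have "\<gamma>' u = coordinate \<sigma> (Complex (fst (\<phi> (\<gamma> u))) c)"
      using sigma_phi[of "\<gamma> u"] \<gamma>(2) by (auto simp: coordinate_def)
    then show ?thesis by blast
  qed
  show "\<exists>a a' b. \<gamma>' s = coordinate \<sigma> (Complex a b) \<and> \<gamma>' t = coordinate \<sigma> (Complex a' b)"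
    using co[of s] co[of t] st by auto
qed

lemma coordinate_rising:
  assumes mono: "\<forall>\<gamma>\<in>Or. \<forall>s t. \<forall>C \<in> plaques P F U.
      s < t \<and> \<gamma> s \<in> C \<and> \<gamma> t \<in> C \<longrightarrow> fst (\<phi> (\<gamma> s)) < fst (\<phi> (\<gamma> t))"
  shows "rising (coordinate \<sigma>) b"
  unfolding rising_def
proof (intro allI impI)
  fix a a' :: real assume aa: "a < a'"
  obtain C \<gamma> where C: "C \<in> plaques P F U" "\<gamma> \<in> Or" "C \<subseteq> range \<gamma>" "\<forall>u. \<sigma> (u, b) \<in> C"
    by (rule horizontal_plaque)
  then obtain s t where s: "\<sigma> (a, b) = \<gamma> s" and t: "\<sigma> (a', b) = \<gamma> t" by blast
  have "fst (\<phi> (\<gamma> s)) = a" "fst (\<phi> (\<gamma> t)) = a'" using phi_sigma s t by (metis fst_conv)+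
  moreover have "\<gamma> s \<in> C" "\<gamma> t \<in> C" using C(4) s t by metis+
  \<comment> \<open>With \<open>t < s\<close>, monotonicity on the plaque would give
    \<open>a' < a\<close>.\<close>
  ultimately have "s \<noteq> t" "\<not> t < s" using mono C(1,2) aa by force+
  then have "s < t" by simp
  moreover have "h \<circ> \<gamma> \<in> leaf_params" using C(2) by blast
  ultimately have "before ((h \<circ> \<gamma>) s) ((h \<circ> \<gamma>) t)" using before_iff[of "h \<circ> \<gamma>" s t] by blast
  then show "before (coordinate \<sigma> (Complex a b)) (coordinate \<sigma> (Complex a' b))"
    using s t by (simp add: coordinate_def)
qed

end

lemma oriented_chart_exists: "\<exists>\<psi>. unoriented_chart \<psi> \<and> (\<forall>b. rising \<psi> b) \<and> z \<in> range \<psi>"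
proof -
  obtain U \<phi> where U: "k z \<in> U" "foliated_chart P F U \<phi>" and
    mono: "\<forall>\<gamma>\<in>Or. \<forall>s t. \<forall>C \<in> plaques P F U.
      s < t \<and> \<gamma> s \<in> C \<and> \<gamma> t \<in> C \<longrightarrow> fst (\<phi> (\<gamma> s)) < fst (\<phi> (\<gamma> t))"
    using ori[unfolded foliation_orientation_def, THEN conjunct2, THEN conjunct2, THEN conjunct2, THEN bspec, OF k_in[of z]]
    by (elim exE conjE) (rule that)
  obtain \<sigma> where \<sigma>: "homeomorphic_maps (subtopology P U) euclidean \<phi> \<sigma>"
    using U(2) homeomorphic_map_maps unfolding foliated_chart_def plane_chart_def by blast
  have "z \<in> range (coordinate \<sigma>)"
    using coordinate_range[OF U(2) \<sigma>] U(1) hk_eq[of z] by force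
  then show ?thesis
    using unoriented_chart_coordinate[OF U(2) \<sigma>] coordinate_rising[OF U(2) \<sigma> mono] by blast
qed

text \<open>Conjugation by the coordinates turns an extensional function on
  \<open>topspace P\<close> into a bijection of the whole type \<open>complex\<close>; on
  parametrizations it acts as \<open>f\<close> does, since \<open>k\<close> undoes \<open>h\<close>
  on \<open>topspace P\<close>.\<close>

lemma automorphism_complex:
  assumes "f \<in> Bij (topspace P)" "homeomorphic_map P P f" "preserves_orientation f Or"
  shows "leaf_automorphism (h \<circ> f \<circ> k)"
  unfolding leaf_automorphism_def
proof (intro conjI)
  have "continuous_map euclidean euclidean (h \<circ> f \<circ> k)"
    by (rule continuous_map_compose[OF k_continuous
        continuous_map_compose[OF homeomorphic_imp_continuous_map[OF assms(2)] h_continuous]])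
  then show "continuous_on UNIV (h \<circ> f \<circ> k)" by simp
  have bk: "bij_betw k UNIV (topspace P)"
    by (rule bij_betw_byWitness[of _ h]) (auto simp: hk_eq kh k_in)
  have bh: "bij_betw h (topspace P) UNIV"
    by (rule bij_betw_byWitness[of _ k]) (auto simp: hk_eq kh k_in)
  have "bij_betw f (topspace P) (topspace P)" using assms(1) by (simp add: Bij_def)
  then show "bij (h \<circ> f \<circ> k)" by (rule bij_betw_trans[OF bk bij_betw_trans[OF _ bh]])
  have "(h \<circ> f \<circ> k) \<circ> (h \<circ> \<gamma>) = h \<circ> (f \<circ> \<gamma>)" if "\<gamma> \<in> Or" for \<gamma>
    using kh[OF param_in[OF that]] by (simp add: fun_eq_iff)
  then have "(\<lambda>\<gamma>. (h \<circ> f \<circ> k) \<circ> \<gamma>) ` leaf_params = (\<lambda>\<gamma>. h \<circ> \<gamma>) ` ((\<lambda>\<gamma>. f \<circ> \<gamma>) ` Or)"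
    unfolding image_image by (intro image_cong) auto
  then show "(\<lambda>\<gamma>. (h \<circ> f \<circ> k) \<circ> \<gamma>) ` leaf_params = leaf_params"
    using assms(3) by (simp add: preserves_orientation_def)
qed

end

theorem theorem1p2:
  fixes P :: "'a topology"
    and F\<^sub>1 F\<^sub>2 :: "'a set set"
    and Or\<^sub>1 Or\<^sub>2 :: "(real \<Rightarrow> 'a) set"
  assumes "bifoliated_plane P F\<^sub>1 F\<^sub>2"
    and "foliation_orientation P F\<^sub>1 Or\<^sub>1"
    and "foliation_orientation P F\<^sub>2 Or\<^sub>2"
  shows "left_orderable (Aut_plus P F\<^sub>1 Or\<^sub>1 F\<^sub>2 Or\<^sub>2)"
proof -
  obtain h k where hk: "homeomorphic_maps P (euclidean :: complex topology) h k"
    using assms(1) plane_coordinates unfolding bifoliated_plane_def by metis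
  interpret F1: oriented_plane_foliation P F\<^sub>1 Or\<^sub>1 h k
    by unfold_locales (use assms(1,2) hk in \<open>auto simp: bifoliated_plane_def foliation_by_proper_lines_def\<close>)
  interpret F2: oriented_plane_foliation P F\<^sub>2 Or\<^sub>2 h k
    by unfold_locales (use assms(1,3) hk in \<open>auto simp: bifoliated_plane_def foliation_by_proper_lines_def\<close>)
  have "\<exists>\<psi>. F1.unoriented_chart \<psi> \<and> F2.unoriented_chart (\<psi> \<circ> flip) \<and> z \<in> range \<psi>" for z
  proof -
    obtain U \<phi> where U: "k z \<in> U" "foliated_chart P F\<^sub>1 U \<phi>" "foliated_chart P F\<^sub>2 U (prod.swap \<circ> \<phi>)"
      using assms(1) F1.k_in[of z] unfolding bifoliated_plane_def transverse_foliations_def by metis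
    obtain \<sigma> where \<sigma>: "homeomorphic_maps (subtopology P U) euclidean \<phi> \<sigma>"
      using U(2) homeomorphic_map_maps unfolding foliated_chart_def plane_chart_def by blast
    \<comment> \<open>One inverse chart \<open>\<sigma>\<close> serves both foliations: the swap in
      the chart of the second one turns into \<open>flip\<close> on the complex coordinate.\<close>
    have "homeomorphic_maps euclidean euclidean prod.swap (prod.swap :: real \<times> real \<Rightarrow> real \<times> real)"
      by (auto simp: homeomorphic_maps_def prod.swap_def intro!: continuous_intros)
    from homeomorphic_maps_compose[OF conjI[OF \<sigma> this]]
    have \<sigma>': "homeomorphic_maps (subtopology P U) euclidean (prod.swap \<circ> \<phi>) (\<sigma> \<circ> prod.swap)" .
    have "F2.coordinate (\<sigma> \<circ> prod.swap) = F1.coordinate \<sigma> \<circ> flip"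
      by (simp add: fun_eq_iff F1.coordinate_def F2.coordinate_def flip_def)
    then have "F2.unoriented_chart (F1.coordinate \<sigma> \<circ> flip)"
      using F2.unoriented_chart_coordinate[OF U(3) \<sigma>'] by simp
    moreover have "z \<in> range (F1.coordinate \<sigma>)"
      using F1.coordinate_range[OF U(2) \<sigma>] U(1) F1.hk_eq[of z] by force
    ultimately show ?thesis using F1.unoriented_chart_coordinate[OF U(2) \<sigma>] by blast
  qed
  then have "transverse_leaves F1.leaf_params F2.leaf_params"
    by (intro bichart_from_unoriented F1.embedded_leaves F2.embedded_leaves F1.oriented_chart_exists F2.oriented_chart_exists)
  then interpret T: transverse_leaves F1.leaf_params F2.leaf_params .
  obtain less where less: "\<And>p. \<not> less p p" "\<And>p q r. less p q \<Longrightarrow> less q r \<Longrightarrow> less p r"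
    "\<And>p q. p \<noteq> q \<Longrightarrow> less p q \<or> less q p"
    and inv: "\<And>g p q. F1.leaf_automorphism g \<Longrightarrow> F2.leaf_automorphism g \<Longrightarrow> less p q \<Longrightarrow> less (g p) (g q)"
    using T.invariant_order by blast
  let ?G = "Aut_plus P F\<^sub>1 Or\<^sub>1 F\<^sub>2 Or\<^sub>2"
  have sub: "subgroup (carrier ?G) (BijGroup (topspace P))"
    using F1.leaf_subset F2.leaf_subset F1.param_in F2.param_in by (intro Aut_plus_subgroup) auto
  have "left_orderable (BijGroup (topspace P)\<lparr>carrier := carrier ?G\<rparr>)"
  \<comment> \<open>The order on the complex plane is pulled back along \<open>h\<close>, which is
    injective on \<open>topspace P\<close>.\<close>
  proof (rule left_orderable_BijGroup_subgroup[OF sub, of "\<lambda>x y. less (h x) (h y)"])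
    show "\<not> less (h x) (h x)" for x by (rule less(1))
    show "less (h x) (h z)" if "less (h x) (h y)" "less (h y) (h z)" for x y z by (rule less(2)[OF that])
    show "less (h x) (h y) \<or> less (h y) (h x)" if "x \<in> topspace P" "y \<in> topspace P" "x \<noteq> y" for x y
      using less(3) F1.h_inj that by blast
    show "less (h (f x)) (h (f y))"
      if f: "f \<in> carrier ?G" and xy: "x \<in> topspace P" "y \<in> topspace P" "less (h x) (h y)" for f x y
    proof -
      have "F1.leaf_automorphism (h \<circ> f \<circ> k)" "F2.leaf_automorphism (h \<circ> f \<circ> k)"
        using f by (auto simp: Aut_plus_def intro!: F1.automorphism_complex F2.automorphism_complex)
      from inv[OF this xy(3)] show ?thesis using F1.kh xy by simp
    qed
  qed
  moreover have "BijGroup (topspace P)\<lparr>carrier := carrier ?G\<rparr> = ?G"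
    by (simp add: Aut_plus_def)
  ultimately show ?thesis by simp
qed

end
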